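(* Let $n\ge 2$. There is a constant $C_0>0$, independent of $x,y$, such that for all $x,y\in\mathbb R^n_+$ with $x\ne y$ and all $i,j\in\{1,\dots,n\}$, the Green tensor $G_{ij}$ of the stationary Stokes system in the half space $\mathbb R^n_+$ satisfies $$|G_{ij}(x,y)|\le \frac{C_0\,x_ny_n}{|x-y|^{n-2}\,|x-y^*|^{2}}+C_0\,1_{n=2}\log\Big(2+\frac{y_n}{|x-y|}\Big).$$ Moreover, when $j=n$, $$|G_{in}(x,y)|\le \frac{C_0\,x_ny_n^2}{|x-y|^{n-2}\,|x-y^*|^{3}}+C_0\,1_{n=2}\log\Big(2+\frac{y_n}{|x-y|}\Big).$$
   Context: $\mathbb R^n_+=\{x=(x',x_n):x'\in\mathbb R^{n-1},x_n>0\}$, $\Sigma=\partial\mathbb R^n_+$, $y^*=(y',-y_n)$ for $y=(y',y_n)$, and $1_{n=2}$ is $1$ if $n=2$ and $0$ otherwise. $\omega_n=\frac{2\pi^{n/2}}{n\Gamma(n/2)}$ is the volume of the unit ball of $\mathbb R^n$. Set $E(x)=\frac{1}{n(n-2)\omega_n}|x|^{2-n}$ for $n\ge3$ and $E(x)=-\frac1{2\pi}\log|x|$ for $n=2$. The Lorentz tensor (fundamental solution of the Stokes system in $\mathbb R^n$) is $U_{ij}(x)=\frac12\delta_{ij}E(x)+\frac1{2n\omega_n}\frac{x_ix_j}{|x|^n}$. The Odqvist tensor (Poisson kernel of the Stokes system in $\mathbb R^n_+$) is $K_{ij}(x)=\frac{2x_nx_ix_j}{\omega_n|x|^{n+2}}$.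 Let $\epsilon_j=1-2\delta_{nj}$. The Green tensor of the Stokes system in $\mathbb R^n_+$ with zero Dirichlet boundary condition is, for $x\neq y$ in $\mathbb R^n_+$, $$G_{ij}(x,y)=U_{ij}(x-y)-\epsilon_jU_{ij}(x-y^* )-2\int_\Sigma K_{in}(x-\xi)U_{nj}(\xi-y)\,d\xi .$$ With a suitable pressure $g_j$ it satisfies $-\Delta_xG_{ij}+\partial_{x_i}g_j=\delta(x-y)\delta_{ij}$ and $\sum_i\partial_{x_i}G_{ij}=0$ for $x\in\mathbb R^n_+$, and $G_{ij}(x,y)=0$ for $x_n=0$. *)

theory Defs
  imports "HOL-Analysis.Analysis"
begin

text \<open>
  For \<open>n \<ge> 2\<close> the space \<open>\<real>\<^sup>n = \<real>\<^sup>n\<^sup>-\<^sup>1 \<times> \<real>\<close> is \<^typ>\<open>real ^ ('m::finite) option\<close> with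
  \<open>n = CARD('m option) = CARD('m) + 1\<close>: the indices \<open>Some a\<close> are the tangential directions
  \<open>1, \<dots>, n - 1\<close>, and \<^term>\<open>None\<close> is the normal direction \<open>n\<close>.  As \<open>'m\<close> ranges over the finite
  types, \<open>n\<close> takes exactly the values \<open>\<ge> 2\<close>.
\<close>

lemma CARD_option_ge_2: "CARD('m::finite option) \<ge> 2"
  using zero_less_card_finite[where 'a = 'm] by (simp del: zero_less_card_finite)

definition half_space :: "(real ^ ('m::finite) option) set" where
  "half_space = {x. x $ None > 0}"

text \<open>The boundary point \<open>(\<xi>', 0)\<close>.\<close>

definition bdry :: "real ^ 'm \<Rightarrow> real ^ ('m::finite) option" where
  "bdry \<xi> = (\<chi> k. case k of None \<Rightarrow> 0 | Some a \<Rightarrow> \<xi> $ a)"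

text \<open>The reflection \<open>y\<^sup>* = (y', -y\<^sub>n)\<close>.\<close>

definition refl_pt :: "real ^ ('m::finite) option \<Rightarrow> real ^ 'm option" where
  "refl_pt y = (\<chi> k. if k = None then - y $ None else y $ k)"

text \<open>The constant \<open>\<omega>\<^sub>n\<close> is \<^term>\<open>unit_ball_vol (real n)\<close>.\<close>

lemma unit_ball_vol_Gamma:
  assumes "n > 0"
  shows "unit_ball_vol (real n) = 2 * pi powr (real n / 2) / (real n * Gamma (real n / 2))"
proof -
  have "Gamma (real n / 2 + 1) = real n / 2 * Gamma (real n / 2)"
    using assms by (intro Gamma_plus1) (auto dest: nonpos_Ints_nonpos)
  then show ?thesis unfolding unit_ball_vol_def by (simp only:) simp
qed

definition fund_E :: "real ^ ('n::finite) \<Rightarrow> real" where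
  "fund_E x = (let n = CARD('n) in
     if n = 2 then - 1 / (2 * pi) * ln (norm x)
     else 1 / (real n * (real n - 2) * unit_ball_vol (real n)) * norm x powi (2 - int n))"

definition lorentz_U :: "'n \<Rightarrow> 'n \<Rightarrow> real ^ ('n::finite) \<Rightarrow> real" where
  "lorentz_U i j x = (let n = CARD('n) in
     1 / 2 * of_bool (i = j) * fund_E x
     + 1 / (2 * real n * unit_ball_vol (real n)) * (x $ i * x $ j / norm x ^ n))"

definition odqvist_K ::
  "'m option \<Rightarrow> 'm option \<Rightarrow> real ^ ('m::finite) option \<Rightarrow> real" where
  "odqvist_K i j x = (let n = CARD('m option) in
     2 * x $ None * x $ i * x $ j / (unit_ball_vol (real n) * norm x ^ (n + 2)))"

definition eps_sign :: "'m option \<Rightarrow> real" where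
  "eps_sign j = 1 - 2 * of_bool (j = None)"

text \<open>
  The surface integral over \<open>\<Sigma> = \<partial>\<real>\<^sup>n\<^sub>+\<close> is the Lebesgue integral over \<open>\<xi>' \<in> \<real>\<^sup>n\<^sup>-\<^sup>1\<close>.
  For \<open>x, y\<close> in the open half space the integrand is absolutely integrable.
\<close>

definition green_G ::
  "'m option \<Rightarrow> 'm option \<Rightarrow> real ^ ('m::finite) option \<Rightarrow> real ^ 'm option \<Rightarrow> real" where
  "green_G i j x y =
     lorentz_U i j (x - y) - eps_sign j * lorentz_U i j (x - refl_pt y)
     - 2 * (LINT \<xi>|lborel. odqvist_K i None (x - bdry \<xi>) * lorentz_U None j (bdry \<xi> - y))"

end

theory Submission
  imports Defs "HOL-Probability.Distributions"
begin

text \<open>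
  Write \<open>R = x - y\<^sup>*\<close>.  The Odqvist kernel \<open>K\<^sub>i\<^sub>n(x - \<xi>)\<close> is \<open>x\<^sub>n\<^sup>2\<close> times the derivative
  \<open>\<partial>\<^sub>i\<close> of \<open>|x - \<xi>|\<^sup>-\<^sup>n\<close> up to a constant, and the boundary trace of the Lorentz tensor is built from
  \<open>|\<xi> - y|\<^sup>2\<^sup>-\<^sup>n\<close> and its derivatives in \<open>y\<close>.  So for \<open>n \<ge> 3\<close> the surface integral is found by
  differentiating, in \<open>x\<close> and in \<open>y\<close>, the identity
  \<open>\<integral> x\<^sub>n |x - \<xi>|\<^sup>-\<^sup>n |\<xi> - y|\<^sup>2\<^sup>-\<^sup>n d\<xi> = c |R|\<^sup>2\<^sup>-\<^sup>n\<close>, which in turn is the semigroup property of the Poisson kernel,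
  integrated in \<open>y\<^sub>n\<close>.  The semigroup property follows by writing both kernels as superpositions of Gaussians.
  The resulting closed form of \<open>G\<^sub>i\<^sub>j\<close> is estimated using \<open>|R|\<^sup>2 - |x - y|\<^sup>2 = 4 x\<^sub>n y\<^sub>n\<close>, to first order
  for general \<open>j\<close>; for \<open>j = n\<close> to second order when \<open>|R| \<le> 2 |x - y|\<close>, the other case being implied
  by the first bound because then \<open>|R| \<le> C y\<^sub>n\<close>.

  For \<open>n = 2\<close> the logarithmic term absorbs all bounded quantities, so it suffices to show
  \<open>\<integral> K\<^sub>i\<^sub>n(x - \<xi>) log |\<xi> - y| d\<xi> = \<delta>\<^sub>i\<^sub>n log |R| + O(1)\<close>.
\<close>

section \<open>Gaussian and Gamma integrals\<close>

text \<open>Gaussians serve because two of them convolve explicitly over R^(n-1) in every dimension,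
  so the semigroup property reduces to two one-dimensional integrals. All of this runs with
  \<open>ennreal\<close> integrals of nonnegative functions, where orders of integration can be
  exchanged freely; signed integrands appear only afterwards, by differentiating under the integral
  sign.

  The closed form becomes useful after regrouping: it consists of differences of equal powers of 1 /
  |x - y| and 1 / |R| and of terms carrying the factor x_n y_n. The zeroth-order terms cancel, which
  reflects that G vanishes on the boundary. For j = n the terms linear in x_n y_n cancel as well, up
  to remainders that carry y_n once more. That cancellation rests on an expansion that is uniform
  only while |R| / |x - y| stays bounded, hence the case split.

  For n = 2 the integral over all heights diverges logarithmically, so it is cut off at height |R|,
  the scale at which log |\<xi> - y| is compared with log |R|.\<close>

lemma nn_integral_change_of_variables_real:
  fixes f g g' :: "real \<Rightarrow> real"
  assumes [measurable]: "S \<in> sets borel" "g ` S \<in> sets borel"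
    and "f \<in> borel_measurable borel" "(\<lambda>x. g' x * f (g x)) \<in> borel_measurable borel"
    and der: "\<And>x. x \<in> S \<Longrightarrow> (g has_field_derivative g' x) (at x within S)"
    and inj: "inj_on g S"
    and nonneg: "\<And>x. f x \<ge> 0"
  shows "(\<integral>\<^sup>+x\<in>S. ennreal (\<bar>g' x\<bar> * f (g x)) \<partial>lborel) = (\<integral>\<^sup>+x\<in>g ` S. ennreal (f x) \<partial>lborel)"
proof -
  have meas [measurable]: "f \<in> borel_measurable borel" "(\<lambda>x. \<bar>g' x\<bar> * f (g x)) \<in> borel_measurable borel"
  proof -
    have "(\<lambda>x. \<bar>g' x * f (g x)\<bar>) \<in> borel_measurable borel" using assms(4) by measurable
    moreover have "(\<lambda>x. \<bar>g' x * f (g x)\<bar>) = (\<lambda>x. \<bar>g' x\<bar> * f (g x))"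
      using nonneg by (auto simp: abs_mult)
    ultimately show "(\<lambda>x. \<bar>g' x\<bar> * f (g x)) \<in> borel_measurable borel" by simp
  qed fact
  \<comment> \<open>This change of variables compares only finite values \<open>b\<close>;
    \<open>key\<close> and \<open>eq\<close> translate its two sides into \<open>ennreal\<close>
    integrals.\<close>
  have iff: "(\<lambda>x. \<bar>g' x\<bar> * f (g x)) absolutely_integrable_on S \<and> integral S (\<lambda>x. \<bar>g' x\<bar> * f (g x)) = b
     \<longleftrightarrow> f absolutely_integrable_on (g ` S) \<and> integral (g ` S) f = b" for b
    using has_absolute_integral_change_of_variables_1'[of S g g' f b] der inj assms(1) by auto
  have key: "(h absolutely_integrable_on A \<and> integral A h = b) \<longleftrightarrow>
      (\<integral>\<^sup>+x\<in>A. ennreal (h x) \<partial>lborel) = ennreal b" 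
    if "b \<ge> 0" and [measurable]: "A \<in> sets borel" "h \<in> borel_measurable borel" and nn: "\<And>x. h x \<ge> 0"
    for h :: "real \<Rightarrow> real" and A b
  proof -
    have "(\<integral>\<^sup>+x\<in>A. ennreal (h x) \<partial>lborel) = (\<integral>\<^sup>+x. ennreal (indicator A x * h x) \<partial>lborel)"
      by (intro nn_integral_cong) (auto simp: indicator_def)
    also have "\<dots> = ennreal b \<longleftrightarrow> has_bochner_integral lborel (\<lambda>x. indicator A x * h x) b"
    proof
      assume "(\<integral>\<^sup>+x. ennreal (indicator A x * h x) \<partial>lborel) = ennreal b"
      then show "has_bochner_integral lborel (\<lambda>x. indicator A x * h x) b"
        using that nn by (intro has_bochner_integral_nn_integral) auto
    next
      assume *: "has_bochner_integral lborel (\<lambda>x. indicator A x * h x) b"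
      then show "(\<integral>\<^sup>+x. ennreal (indicator A x * h x) \<partial>lborel) = ennreal b"
        using nn nn_integral_eq_integral[of lborel "\<lambda>x. indicator A x * h x"]
        by (auto simp: has_bochner_integral_iff)
    qed
    also have "\<dots> \<longleftrightarrow> set_integrable lebesgue A h \<and> set_lebesgue_integral lebesgue A h = b"
      by (auto simp: has_bochner_integral_iff set_integrable_def set_lebesgue_integral_def
          integrable_completion integral_completion)
    also have "\<dots> \<longleftrightarrow> h absolutely_integrable_on A \<and> integral A h = b"
      using set_lebesgue_integral_eq_integral(2) by auto
    finally show ?thesis by simp
  qed
  have eq: "(\<integral>\<^sup>+x\<in>S. ennreal (\<bar>g' x\<bar> * f (g x)) \<partial>lborel) = ennreal b \<longleftrightarrow>
      (\<integral>\<^sup>+x\<in>g ` S. ennreal (f x) \<partial>lborel) = ennreal b" if "b \<ge> 0" for b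
    using iff[of b] key[OF that, of S "\<lambda>x. \<bar>g' x\<bar> * f (g x)"] key[OF that, of "g ` S" f] nonneg
    by auto
  \<comment> \<open>Both sides attain the same finite values, so when one is infinite the other
    cannot be finite; this covers divergent integrals.\<close>
  show ?thesis
  proof (cases "\<integral>\<^sup>+x\<in>g ` S. ennreal (f x) \<partial>lborel")
    case (real r)
    then show ?thesis using eq[of r] by auto
  next
    case top
    show ?thesis
    proof (cases "\<integral>\<^sup>+x\<in>S. ennreal (\<bar>g' x\<bar> * f (g x)) \<partial>lborel")
      case (real r)
      then show ?thesis using eq[of r] by auto
    qed (use top in auto)
  qed
qed

lemma nn_integral_gaussian:
  assumes "u > 0"
  shows "(\<integral>\<^sup>+x. ennreal (exp (- (u * x\<^sup>2))) \<partial>lborel) = ennreal (sqrt (pi / u))"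
proof -
  \<comment> \<open>Variance 1 / (2 u) makes the normal density equal to sqrt (u / pi) exp (- u
    x^2), whose total mass is one.\<close>
  define s where "s = 1 / sqrt (2 * u)"
  have s: "s > 0" "s\<^sup>2 = 1 / (2 * u)" using assms by (auto simp: s_def power_divide)
  interpret prob_space "density lborel (normal_density 0 s)" by (rule prob_space_normal_density) (use s in auto)
  have "1 = (\<integral>\<^sup>+x. ennreal (normal_density 0 s x) \<partial>lborel)"
    using emeasure_space_1 by (simp add: emeasure_density)
  also have "\<dots> = (\<integral>\<^sup>+x. ennreal (sqrt (u / pi)) * ennreal (exp (- (u * x\<^sup>2))) \<partial>lborel)"
    using assms by (intro nn_integral_cong)
      (simp add: normal_density_def s ennreal_mult'[symmetric] real_sqrt_divide field_simps)
  also have "\<dots> = ennreal (sqrt (u / pi)) * (\<integral>\<^sup>+x. ennreal (exp (- (u * x\<^sup>2))) \<partial>lborel)"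
    by (rule nn_integral_cmult) auto
  finally have e: "1 = ennreal (sqrt (u / pi)) * (\<integral>\<^sup>+x. ennreal (exp (- (u * x\<^sup>2))) \<partial>lborel)" .
  have "ennreal (sqrt (pi / u)) = ennreal (sqrt (pi / u)) * 1" by simp
  also have "\<dots> = ennreal (sqrt (pi / u)) * ennreal (sqrt (u / pi)) * (\<integral>\<^sup>+x. ennreal (exp (- (u * x\<^sup>2))) \<partial>lborel)"
    by (subst e) (simp add: mult.assoc)
  also have "ennreal (sqrt (pi / u)) * ennreal (sqrt (u / pi)) = 1"
    using assms by (simp add: ennreal_mult'[symmetric] real_sqrt_mult[symmetric])
  finally show ?thesis by simp
qed

lemma nn_integral_gaussian_vec:
  fixes a :: "real ^ ('m::finite)"
  assumes "u > 0"
  shows "(\<integral>\<^sup>+x. ennreal (exp (- (u * (norm (x - a))\<^sup>2))) \<partial>lborel) = ennreal ((pi / u) powr (CARD('m) / 2))"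
proof -
  have "(\<integral>\<^sup>+x. ennreal (exp (- (u * (norm (x - a))\<^sup>2))) \<partial>lborel)
      = (\<integral>\<^sup>+x. ennreal (exp (- (u * (norm (x - a))\<^sup>2))) \<partial>distr lborel borel ((+) a))"
    by (simp only: lborel_distr_plus)
  also have "\<dots> = (\<integral>\<^sup>+x. ennreal (exp (- (u * (norm (x::real^'m))\<^sup>2))) \<partial>lborel)"
    by (subst nn_integral_distr) auto
  also have "\<dots> = (\<integral>\<^sup>+x. (\<Prod>b\<in>Basis. ennreal (exp (- (u * ((x::real^'m) \<bullet> b)\<^sup>2)))) \<partial>lborel)"
  proof (intro nn_integral_cong)
    fix x :: "real ^ 'm"
    have "(norm x)\<^sup>2 = (\<Sum>b\<in>Basis. (x \<bullet> b)\<^sup>2)"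
      by (subst power2_norm_eq_inner, subst euclidean_inner) (simp add: power2_eq_square)
    then show "ennreal (exp (- (u * (norm x)\<^sup>2))) = (\<Prod>b\<in>Basis. ennreal (exp (- (u * (x \<bullet> b)\<^sup>2))))"
      by (simp add: prod_ennreal exp_sum[symmetric] sum_negf sum_distrib_left[symmetric])
  qed
  also have "\<dots> = (\<Prod>b\<in>(Basis::(real^'m) set). ennreal (sqrt (pi / u)))"
    using assms by (subst nn_integral_lborel_prod) (auto simp: nn_integral_gaussian)
  also have "\<dots> = ennreal (sqrt (pi / u) ^ CARD('m))" 
    using assms by (simp add: ennreal_power)
  also have "sqrt (pi / u) ^ CARD('m) = (pi / u) powr (CARD('m) / 2)"
    using assms by (simp add: powr_half_sqrt[symmetric] powr_powr powr_realpow[symmetric])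
  finally show ?thesis .
qed

text \<open>Completing the square at the weighted mean \<open>c\<close> of \<open>a\<close> and
  \<open>b\<close> leaves a Gaussian in \<xi> of rate s + \<sigma> and a constant whose rate s
  \<sigma> / (s + \<sigma>) is half the harmonic mean of the two rates.\<close>

lemma nn_integral_gaussian_convolution:
  fixes a b :: "real ^ ('m::finite)"
  assumes "s > 0" "\<sigma> > 0"
  shows "(\<integral>\<^sup>+\<xi>. ennreal (exp (- (s * (norm (a - \<xi>))\<^sup>2) - \<sigma> * (norm (\<xi> - b))\<^sup>2)) \<partial>lborel)
    = ennreal ((pi / (s + \<sigma>)) powr (CARD('m) / 2) * exp (- (s * \<sigma> / (s + \<sigma>) * (norm (a - b))\<^sup>2)))"
proof -
  define c where "c = (1 / (s + \<sigma>)) *\<^sub>R (s *\<^sub>R a + \<sigma> *\<^sub>R b)"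
  have id: "s * (norm (a - \<xi>))\<^sup>2 + \<sigma> * (norm (\<xi> - b))\<^sup>2
     = (s + \<sigma>) * (norm (\<xi> - c))\<^sup>2 + s * \<sigma> / (s + \<sigma>) * (norm (a - b))\<^sup>2" for \<xi>
  proof -
    have "(s + \<sigma>) * (\<xi> \<bullet> c) = s * (\<xi> \<bullet> a) + \<sigma> * (\<xi> \<bullet> b)"
      using assms by (simp add: c_def inner_add_right)
    moreover have "(s + \<sigma>) * (c \<bullet> c) = (s\<^sup>2 * (a \<bullet> a) + 2 * s * \<sigma> * (a \<bullet> b) + \<sigma>\<^sup>2 * (b \<bullet> b)) / (s + \<sigma>)"
      using assms by (simp add: c_def inner_add_right inner_add_left inner_commute power2_eq_square divide_simps)
    moreover have "s * (a \<bullet> a) + \<sigma> * (b \<bullet> b) =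
      (s\<^sup>2 * (a \<bullet> a) + 2 * s * \<sigma> * (a \<bullet> b) + \<sigma>\<^sup>2 * (b \<bullet> b)) / (s + \<sigma>) + s * \<sigma> / (s + \<sigma>) * (a \<bullet> a - 2 * (a \<bullet> b) + b \<bullet> b)"
      using assms by (simp add: divide_simps) (simp add: algebra_simps power2_eq_square)
    ultimately show ?thesis
      unfolding power2_norm_eq_inner
      by (simp add: inner_diff_left inner_diff_right inner_commute algebra_simps)
  qed
  have "(\<integral>\<^sup>+\<xi>. ennreal (exp (- (s * (norm (a - \<xi>))\<^sup>2) - \<sigma> * (norm (\<xi> - b))\<^sup>2)) \<partial>lborel)
    = (\<integral>\<^sup>+\<xi>. ennreal (exp (- (s * \<sigma> / (s + \<sigma>) * (norm (a - b))\<^sup>2))) * ennreal (exp (- ((s + \<sigma>) * (norm (\<xi> - c))\<^sup>2))) \<partial>lborel)"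
    by (intro nn_integral_cong arg_cong[of _ _ ennreal])
       (use id in \<open>simp add: ennreal_mult'[symmetric] exp_add[symmetric] algebra_simps\<close>)
  also have "\<dots> = ennreal (exp (- (s * \<sigma> / (s + \<sigma>) * (norm (a - b))\<^sup>2))) * ennreal ((pi / (s + \<sigma>)) powr (CARD('m) / 2))"
    using assms by (subst nn_integral_cmult) (auto simp: nn_integral_gaussian_vec)
  finally show ?thesis by (simp add: ennreal_mult'[symmetric] mult.commute)
qed

lemma nn_integral_powr_exp:
  assumes "p > 0" "A > 0"
  shows "(\<integral>\<^sup>+s\<in>{0<..}. ennreal (s powr (p - 1) * exp (- (s * A))) \<partial>lborel) = ennreal (Gamma p * A powr (- p))"
proof -
  have "(\<integral>\<^sup>+s\<in>{0<..}. ennreal (s powr (p - 1) * exp (- (s * A))) \<partial>lborel)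
     = ennreal \<bar>1 / A\<bar> * (\<integral>\<^sup>+t. ennreal ((0 + 1 / A * t) powr (p - 1) * exp (- ((0 + 1 / A * t) * A))) * indicator {0<..} (0 + 1 / A * t) \<partial>lborel)"
    using assms by (intro nn_integral_real_affine) auto
  \<comment> \<open>The Gamma integral runs over t >= 0 and the scaled one over t > 0; they differ
    on the null set {0}.\<close>
  also have "(\<integral>\<^sup>+t. ennreal ((0 + 1 / A * t) powr (p - 1) * exp (- ((0 + 1 / A * t) * A))) * indicator {0<..} (0 + 1 / A * t) \<partial>lborel)
     = (\<integral>\<^sup>+t. ennreal (A powr (1 - p)) * ennreal (indicator {0..} t * t powr (p - 1) / exp t) \<partial>lborel)"
    using assms AE_lborel_singleton[of "0::real"]
    by (intro nn_integral_cong_AE) (auto elim!: eventually_mono simp: indicator_def ennreal_mult'[symmetric] 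
        powr_divide powr_diff exp_minus field_simps zero_less_divide_iff zero_less_mult_iff)
  also have "\<dots> = ennreal (A powr (1 - p)) * ennreal (Gamma p)"
    using assms by (subst nn_integral_cmult) (auto simp: Gamma_conv_nn_integral_real)
  also have "ennreal \<bar>1 / A\<bar> * \<dots> = ennreal (Gamma p * A powr (- p))"
    using assms Gamma_real_pos[of p] by (simp add: ennreal_mult'[symmetric] powr_diff powr_minus field_simps)
  finally show ?thesis .
qed

section \<open>The semigroup property of the Poisson kernel\<close>

lemma set_nn_integral_swap:
  fixes f :: "'a::euclidean_space \<Rightarrow> 'b::euclidean_space \<Rightarrow> ennreal"
  assumes [measurable]: "A \<in> sets borel" "B \<in> sets borel"
    "(\<lambda>(x, y). f x y) \<in> borel_measurable (borel \<Otimes>\<^sub>M borel)"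
  shows "(\<integral>\<^sup>+x\<in>A. (\<integral>\<^sup>+y\<in>B. f x y \<partial>lborel) \<partial>lborel) = (\<integral>\<^sup>+y\<in>B. (\<integral>\<^sup>+x\<in>A. f x y \<partial>lborel) \<partial>lborel)"
proof -
  have "(\<integral>\<^sup>+x\<in>A. (\<integral>\<^sup>+y\<in>B. f x y \<partial>lborel) \<partial>lborel)
      = (\<integral>\<^sup>+x. (\<integral>\<^sup>+y. f x y * indicator B y * indicator A x \<partial>lborel) \<partial>lborel)"
    by (intro nn_integral_cong nn_integral_multc[symmetric]) measurable
  also have "\<dots> = (\<integral>\<^sup>+y. (\<integral>\<^sup>+x. f x y * indicator B y * indicator A x \<partial>lborel) \<partial>lborel)"
    by (rule lborel_pair.Fubini'[symmetric]) measurable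
  also have "\<dots> = (\<integral>\<^sup>+y. (\<integral>\<^sup>+x. f x y * indicator A x * indicator B y \<partial>lborel) \<partial>lborel)"
    by (intro nn_integral_cong) (simp add: mult.assoc mult.commute[of "indicator A _"])
  also have "\<dots> = (\<integral>\<^sup>+y\<in>B. (\<integral>\<^sup>+x\<in>A. f x y \<partial>lborel) \<partial>lborel)"
    by (intro nn_integral_cong nn_integral_multc) measurable
  finally show ?thesis .
qed

lemma set_nn_integral_scale:
  fixes f :: "real \<Rightarrow> ennreal"
  assumes "f \<in> borel_measurable borel" "c > 0"
  shows "(\<integral>\<^sup>+s\<in>{0<..}. f s \<partial>lborel) = (\<integral>\<^sup>+v\<in>{0<..}. ennreal c * f (c * v) \<partial>lborel)"
proof -
  note [measurable] = assms(1)
  have "(\<integral>\<^sup>+s\<in>{0<..}. f s \<partial>lborel) = ennreal \<bar>c\<bar> * (\<integral>\<^sup>+v. f (0 + c * v) * indicator {0<..} (0 + c * v) \<partial>lborel)"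
    using assms by (intro nn_integral_real_affine) auto
  also have "\<dots> = (\<integral>\<^sup>+v. ennreal c * (f (c * v) * indicator {0<..} v) \<partial>lborel)"
    using assms by (subst nn_integral_cmult) (auto simp: indicator_def zero_less_mult_iff intro!: nn_integral_cong)
  finally show ?thesis by (simp add: mult.assoc)
qed

text \<open>The Cauchy--Schloemilch substitution \<open>w = t \<surd>v - \<tau> / \<surd>v\<close>; the two summands carry
  equal weight up to the factor \<open>\<tau> / t\<close> because \<open>v \<mapsto> \<tau>\<^sup>2 / (t\<^sup>2 v)\<close> sends \<open>w\<close> to \<open>-w\<close>.\<close>

lemma nn_integral_Cauchy_Schloemilch:
  assumes "u > 0" "t > 0" "\<tau> > 0"
  shows "(\<integral>\<^sup>+v\<in>{0<..}. ennreal ((1 / sqrt v + 1 / (v * sqrt v)) * exp (- (u * (t * sqrt v - \<tau> / sqrt v)\<^sup>2))) \<partial>lborel)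
    = ennreal ((1 / t + 1 / \<tau>) * sqrt (pi / u))"
proof -
  define w where "w v = t * sqrt v - \<tau> / sqrt v" for v
  define e where "e v = exp (- (u * (w v)\<^sup>2))" for v
  have [measurable]: "w \<in> borel_measurable borel" "e \<in> borel_measurable borel"
    unfolding w_def [abs_def] e_def [abs_def] by measurable
  define X where "X = (\<integral>\<^sup>+v\<in>{0<..}. ennreal (1 / sqrt v * e v) \<partial>lborel)"
  define Y where "Y = (\<integral>\<^sup>+v\<in>{0<..}. ennreal (1 / (v * sqrt v) * e v) \<partial>lborel)"
  have e_pos: "e v > 0" for v by (simp add: e_def)
  have inj_w: "inj_on w {0<..}"
  proof (rule strict_mono_on_imp_inj_on, rule strict_mono_onI)
    fix r s :: real assume "r \<in> {0<..}" "s \<in> {0<..}" "r < s"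
    then have "t * sqrt r < t * sqrt s" "\<tau> / sqrt s < \<tau> / sqrt r"
      using assms by (auto intro!: divide_strict_left_mono)
    then show "w r < w s" by (simp add: w_def)
  qed
  have range_w: "w ` {0<..} = UNIV"
  proof (intro equalityI subsetI UNIV_I)
    fix y :: real
    \<comment> \<open>\<open>q\<close> is the positive root of t q^2 - y q - \<tau> = 0, which is
      the equation w (q^2) = y multiplied by q.\<close>
    define q where "q = (y + sqrt (y\<^sup>2 + 4 * t * \<tau>)) / (2 * t)"
    have "\<bar>y\<bar> < sqrt (y\<^sup>2 + 4 * t * \<tau>)" using assms by (intro real_less_rsqrt) auto
    then have q: "q > 0" using assms by (auto simp: q_def)
    have "(2 * t * q - y)\<^sup>2 = y\<^sup>2 + 4 * t * \<tau>"
      using assms by (simp add: q_def)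
    then have "4 * t * (t * q\<^sup>2 - y * q - \<tau>) = 0" by (simp add: algebra_simps power2_eq_square)
    then have "t * q\<^sup>2 - y * q - \<tau> = 0" using assms by simp
    then have "w (q\<^sup>2) = y" using q by (simp add: w_def field_simps power2_eq_square)
    then show "y \<in> w ` {0<..}" using q by (intro image_eqI[of _ _ "q\<^sup>2"]) auto
  qed
  have der_w: "(w has_field_derivative (t / sqrt v + \<tau> / (v * sqrt v)) / 2) (at v within {0<..})"
    if "v \<in> {0<..}" for v
    unfolding w_def [abs_def] using that
    by (auto intro!: derivative_eq_intros simp: field_simps)
  have "(\<integral>\<^sup>+v\<in>{0<..}. ennreal (\<bar>(t / sqrt v + \<tau> / (v * sqrt v)) / 2\<bar> * exp (- (u * (w v)\<^sup>2))) \<partial>lborel)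
      = (\<integral>\<^sup>+x\<in>w ` {0<..}. ennreal (exp (- (u * x\<^sup>2))) \<partial>lborel)"
    by (rule nn_integral_change_of_variables_real) (use der_w inj_w range_w in auto)
  also have "\<dots> = ennreal (sqrt (pi / u))"
    using range_w nn_integral_gaussian[OF assms(1)] by simp
  also have "(\<integral>\<^sup>+v\<in>{0<..}. ennreal (\<bar>(t / sqrt v + \<tau> / (v * sqrt v)) / 2\<bar> * exp (- (u * (w v)\<^sup>2))) \<partial>lborel)
     = (\<integral>\<^sup>+v. ennreal (t / 2) * (ennreal (1 / sqrt v * e v) * indicator {0<..} v)
            + ennreal (\<tau> / 2) * (ennreal (1 / (v * sqrt v) * e v) * indicator {0<..} v) \<partial>lborel)"
    using assms e_pos
    by (intro nn_integral_cong)
      (auto simp: indicator_def e_def ennreal_mult'[symmetric] ennreal_plus[symmetric] field_simps 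
         simp del: ennreal_plus)
  also have "\<dots> = ennreal (t / 2) * X + ennreal (\<tau> / 2) * Y"
    unfolding X_def Y_def by (subst nn_integral_add) (auto simp: nn_integral_cmult)
  \<comment> \<open>First of two linear equations for \<open>X\<close> and \<open>Y\<close>, from
    the substitution w. The second, \<open>XY\<close>, makes the two summands here equal, so each is
    half of the Gaussian integral.\<close>
  finally have sum: "ennreal (t / 2) * X + ennreal (\<tau> / 2) * Y = ennreal (sqrt (pi / u))" .

  define k where "k = \<tau>\<^sup>2 / t\<^sup>2"
  have k: "k > 0" "sqrt k = \<tau> / t" using assms by (auto simp: k_def real_sqrt_divide)
  have img: "(\<lambda>v. k / v) ` {0<..} = {0<..}"
  proof (intro equalityI subsetI)
    fix y :: real assume "y \<in> {0<..}"
    then show "y \<in> (\<lambda>v. k / v) ` {0<..}" using k by (intro image_eqI[of _ _ "k / y"]) auto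
  qed (use k in auto)
  \<comment> \<open>The indicator is built into \<open>f\<close> because \<open>sqrt\<close> is odd:
    1 / sqrt v is negative for v < 0, and the change of variables asks for a function that is
    nonnegative on the whole line.\<close>
  define f where "f v = indicator {0<..} v * (1 / sqrt v * e v)" for v :: real
  have [measurable]: "f \<in> borel_measurable borel" unfolding f_def [abs_def] by measurable
  have "(\<integral>\<^sup>+v\<in>{0<..}. ennreal (\<bar>- (k / v\<^sup>2)\<bar> * f (k / v)) \<partial>lborel) = (\<integral>\<^sup>+x\<in>(\<lambda>v. k / v) ` {0<..}. ennreal (f x) \<partial>lborel)"
  proof (rule nn_integral_change_of_variables_real)
    show "inj_on (\<lambda>v. k / v) {0<..}" using k by (auto simp: inj_on_def)
    show "((\<lambda>v. k / v) has_real_derivative - (k / v\<^sup>2)) (at v within {0<..})" if "v \<in> {0<..}" for v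
      using that by (auto intro!: derivative_eq_intros simp: field_simps power2_eq_square)
  qed (use img e_pos in \<open>auto simp: f_def indicator_def less_imp_le\<close>)
  also have "\<dots> = X"
    unfolding img X_def by (intro nn_integral_cong) (auto simp: f_def indicator_def)
  also have "(\<integral>\<^sup>+v\<in>{0<..}. ennreal (\<bar>- (k / v\<^sup>2)\<bar> * f (k / v)) \<partial>lborel)
     = (\<integral>\<^sup>+v. ennreal (\<tau> / t) * (ennreal (1 / (v * sqrt v) * e v) * indicator {0<..} v) \<partial>lborel)"
  proof (intro nn_integral_cong)
    fix v :: real
    show "ennreal (\<bar>- (k / v\<^sup>2)\<bar> * f (k / v)) * indicator {0<..} v
      = ennreal (\<tau> / t) * (ennreal (1 / (v * sqrt v) * e v) * indicator {0<..} v)"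
    proof (cases "v > 0")
      case True
      have "w (k / v) = - w v"
        using True assms k by (simp add: w_def real_sqrt_divide field_simps)
      then have "e (k / v) = e v" by (simp add: e_def)
      moreover have "k / v\<^sup>2 * (1 / sqrt (k / v)) = \<tau> / t * (1 / (v * sqrt v))"
      proof -
        define q where "q = sqrt v"
        have q: "q > 0" "v = q\<^sup>2" using True by (auto simp: q_def)
        show ?thesis unfolding real_sqrt_divide k(2) q_def[symmetric]
          unfolding k_def q(2) using q(1) assms by (simp add: field_simps power2_eq_square)
      qed
      moreover have "\<bar>- (k / v\<^sup>2)\<bar> * f (k / v) = k / v\<^sup>2 * (1 / sqrt (k / v)) * e (k / v)"
        using True k by (simp add: f_def)
      ultimately have "\<bar>- (k / v\<^sup>2)\<bar> * f (k / v) = \<tau> / t * (1 / (v * sqrt v) * e v)"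
        by (simp only: mult.assoc)
      then show ?thesis
        using assms True e_pos[of v] by (simp add: ennreal_mult'[symmetric])
    qed auto
  qed
  also have "\<dots> = ennreal (\<tau> / t) * Y"
    unfolding Y_def by (rule nn_integral_cmult) measurable
  finally have XY: "X = ennreal (\<tau> / t) * Y" by simp
  have "ennreal (t / 2) * X = ennreal (\<tau> / 2) * Y"
    using assms by (simp add: XY mult.assoc[symmetric] ennreal_mult'[symmetric])
  then have "ennreal \<tau> * Y = ennreal (sqrt (pi / u))"
    using sum assms by (simp add: distrib_right[symmetric] ennreal_plus[symmetric] del: ennreal_plus)
  then have "ennreal (1 / \<tau>) * (ennreal \<tau> * Y) = ennreal (sqrt (pi / u) / \<tau>)"
    using assms by (simp add: ennreal_mult'[symmetric])
  then have Y: "Y = ennreal (sqrt (pi / u) / \<tau>)"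
    using assms by (simp add: mult.assoc[symmetric] ennreal_mult'[symmetric])
  then have X: "X = ennreal (sqrt (pi / u) / t)"
    using assms by (simp add: XY ennreal_mult'[symmetric])
  have "(\<integral>\<^sup>+v\<in>{0<..}. ennreal ((1 / sqrt v + 1 / (v * sqrt v)) * e v) \<partial>lborel)
     = (\<integral>\<^sup>+v. ennreal (1 / sqrt v * e v) * indicator {0<..} v + ennreal (1 / (v * sqrt v) * e v) * indicator {0<..} v \<partial>lborel)"
    using e_pos
    by (intro nn_integral_cong) 
       (auto simp: indicator_def distrib_right less_imp_le ennreal_plus[symmetric] simp del: ennreal_plus)
  also have "\<dots> = X + Y"
    unfolding X_def Y_def by (subst nn_integral_add) auto
  also have "\<dots> = ennreal ((1 / t + 1 / \<tau>) * sqrt (pi / u))"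
    using assms by (simp add: X Y ennreal_plus[symmetric] field_simps del: ennreal_plus)
  finally show ?thesis by (simp add: e_def w_def)
qed

text \<open>The Gamma integral read backwards: a negative power of a squared distance is a
  superposition of Gaussians exp (- s A) with weight s^(p-1).\<close>

lemma nn_integral_powr_exp_powr:
  assumes "p > 0" "A > 0"
  shows "ennreal (A powr (- p)) = ennreal (1 / Gamma p) * (\<integral>\<^sup>+s\<in>{0<..}. ennreal (s powr (p - 1) * exp (- (s * A))) \<partial>lborel)"
proof -
  have "Gamma p \<noteq> 0" using Gamma_real_pos[OF assms(1)] by linarith
  then show ?thesis
    using assms by (simp add: nn_integral_powr_exp ennreal_mult'[symmetric])
qed

text \<open>After writing the power as a superposition of Gaussians, the \<xi>-integration leaves
  s^(-1/2) exp (- s t^2), a Gamma integral with parameter 1/2 in every dimension, because p exceeds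
  half the dimension of the boundary by exactly 1/2.\<close>

lemma nn_integral_poisson:
  fixes a :: "real ^ ('m::finite)"
  assumes t: "t > 0" and p: "p = (CARD('m) + 1) / 2"
  shows "(\<integral>\<^sup>+\<xi>. ennreal (((norm (a - \<xi>))\<^sup>2 + t\<^sup>2) powr (- p)) \<partial>lborel)
    = ennreal (pi powr p / Gamma p / t)"
proof -
  have p0: "p > 0" by (simp add: p)
  have G: "Gamma p > 0" using p0 by (rule Gamma_real_pos)
  have sqrt_pi: "pi powr (p - 1 / 2) * sqrt pi = pi powr p"
    by (simp add: powr_half_sqrt[symmetric] powr_add[symmetric])
  have pos: "(norm (a - \<xi>))\<^sup>2 + t\<^sup>2 > 0" for \<xi> using t by (simp add: add_nonneg_pos)
  have "(\<integral>\<^sup>+\<xi>. ennreal (((norm (a - \<xi>))\<^sup>2 + t\<^sup>2) powr (- p)) \<partial>lborel)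
    = ennreal (1 / Gamma p) * (\<integral>\<^sup>+\<xi>\<in>UNIV. (\<integral>\<^sup>+s\<in>{0<..}. ennreal (s powr (p - 1) * exp (- (s * ((norm (a - \<xi>))\<^sup>2 + t\<^sup>2)))) \<partial>lborel) \<partial>lborel)"
    by (simp add: nn_integral_powr_exp_powr[OF p0 pos] nn_integral_cmult)
  also have "(\<integral>\<^sup>+\<xi>\<in>UNIV. (\<integral>\<^sup>+s\<in>{0<..}. ennreal (s powr (p - 1) * exp (- (s * ((norm (a - \<xi>))\<^sup>2 + t\<^sup>2)))) \<partial>lborel) \<partial>lborel)
    = (\<integral>\<^sup>+s\<in>{0<..}. (\<integral>\<^sup>+\<xi>\<in>UNIV. ennreal (s powr (p - 1) * exp (- (s * ((norm (a - \<xi>))\<^sup>2 + t\<^sup>2)))) \<partial>lborel) \<partial>lborel)"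
    by (rule set_nn_integral_swap) measurable
  also have "\<dots> = (\<integral>\<^sup>+s\<in>{0<..}. ennreal (pi powr (p - 1/2)) * ennreal (s powr (1/2 - 1) * exp (- (s * t\<^sup>2))) \<partial>lborel)"
  proof (intro nn_integral_cong)
    fix s :: real
    show "(\<integral>\<^sup>+\<xi>\<in>UNIV. ennreal (s powr (p - 1) * exp (- (s * ((norm (a - \<xi>))\<^sup>2 + t\<^sup>2)))) \<partial>lborel) * indicator {0<..} s
      = ennreal (pi powr (p - 1/2)) * ennreal (s powr (1/2 - 1) * exp (- (s * t\<^sup>2))) * indicator {0<..} s"
    proof (cases "s > 0")
      case True
      have "(\<integral>\<^sup>+\<xi>\<in>UNIV. ennreal (s powr (p - 1) * exp (- (s * ((norm (a - \<xi>))\<^sup>2 + t\<^sup>2)))) \<partial>lborel)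
        = (\<integral>\<^sup>+\<xi>. ennreal (s powr (p - 1) * exp (- (s * t\<^sup>2))) * ennreal (exp (- (s * (norm (\<xi> - a))\<^sup>2))) \<partial>lborel)"
        by (intro nn_integral_cong) (simp add: ennreal_mult'[symmetric] exp_add[symmetric] algebra_simps norm_minus_commute)
      also have "\<dots> = ennreal (s powr (p - 1) * exp (- (s * t\<^sup>2)) * (pi / s) powr (CARD('m) / 2))"
        using True by (subst nn_integral_cmult) (auto simp: nn_integral_gaussian_vec ennreal_mult')
      also have "s powr (p - 1) * exp (- (s * t\<^sup>2)) * (pi / s) powr (CARD('m) / 2)
         = pi powr (p - 1/2) * (s powr (1/2 - 1) * exp (- (s * t\<^sup>2)))"
      proof -
        have "CARD('m) / 2 = p - 1/2" by (simp add: p field_simps)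
        moreover have "s powr (p - 1) = s powr (p - 1/2) * s powr (1/2 - 1)" by (simp add: powr_add[symmetric])
        ultimately show ?thesis using True by (simp only: powr_divide) (simp add: field_simps)
      qed
      finally show ?thesis using True by (simp add: ennreal_mult'[symmetric])
    qed auto
  qed
  also have "\<dots> = ennreal (pi powr (p - 1/2)) * ennreal (Gamma (1/2) * t\<^sup>2 powr (- (1/2)))"
    using t nn_integral_powr_exp[of "1/2" "t\<^sup>2"] by (simp add: nn_integral_cmult mult.assoc)
  also have "t\<^sup>2 powr (- (1/2)) = 1 / t"
    using t by (simp add: powr_minus powr_half_sqrt divide_simps)
  finally show ?thesis
    using t G sqrt_pi
    by (simp add: ennreal_mult'[symmetric] Gamma_one_half_real mult.commute)
qed

text \<open>The two kernels are superpositions of Gaussians of rates s and \<sigma>. In the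
  coordinates u = s \<sigma> / (s + \<sigma>) and v = s / \<sigma> the exponent after the
  \<xi>-integration is - u \<rho> - u (t sqrt v - \<tau> / sqrt v)^2: completing the square in v
  produces the mixed term 2 t \<tau> that turns t^2 + \<tau>^2 into (t + \<tau>)^2. The v-integral
  is then of Cauchy--Schloemilch type, and the u-integral is a Gamma integral in \<rho>.\<close>

lemma nn_integral_poisson_semigroup:
  fixes a b :: "real ^ ('m::finite)"
  assumes t: "t > 0" and \<tau>: "\<tau> > 0" and p: "p = (CARD('m) + 1) / 2"
  shows "(\<integral>\<^sup>+\<xi>. ennreal (t * ((norm (a - \<xi>))\<^sup>2 + t\<^sup>2) powr (- p) * (\<tau> * ((norm (\<xi> - b))\<^sup>2 + \<tau>\<^sup>2) powr (- p))) \<partial>lborel)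
    = ennreal (pi powr p / Gamma p * ((t + \<tau>) * ((norm (a - b))\<^sup>2 + (t + \<tau>)\<^sup>2) powr (- p)))"
proof -
  have p0: "p > 0" by (simp add: p)
  have G: "Gamma p > 0" using p0 by (rule Gamma_real_pos)
  define A B where "A \<xi> = (norm (a - \<xi>))\<^sup>2 + t\<^sup>2" and "B \<xi> = (norm (\<xi> - b))\<^sup>2 + \<tau>\<^sup>2" for \<xi>
  have [measurable]: "A \<in> borel_measurable borel" "B \<in> borel_measurable borel"
    unfolding A_def [abs_def] B_def [abs_def] by measurable
  have A: "A \<xi> > 0" and B: "B \<xi> > 0" for \<xi> using t \<tau> by (auto simp: A_def B_def add_nonneg_pos)
  define r where "r = norm (a - b)"
  define \<rho> where "\<rho> = r\<^sup>2 + (t + \<tau>)\<^sup>2"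
  have \<rho>: "\<rho> > 0" using t \<tau> by (auto simp: \<rho>_def add_nonneg_pos)
  \<comment> \<open>\<open>K\<close> is the integrand before the \<xi>-integration, \<open>L\<close>
    the result of it, and \<open>M\<close> is \<open>L\<close> together with both Jacobians in the
    coordinates v and u.\<close>
  define K where "K \<xi> \<sigma> s = t * \<tau> * (s powr (p - 1) * exp (- (s * A \<xi>)) * (\<sigma> powr (p - 1) * exp (- (\<sigma> * B \<xi>))))"
    for \<xi> \<sigma> s
  define L where "L \<sigma> s = t * \<tau> * (s powr (p - 1) * \<sigma> powr (p - 1) * exp (- (s * t\<^sup>2 + \<sigma> * \<tau>\<^sup>2)))
      * ((pi / (s + \<sigma>)) powr (p - 1 / 2) * exp (- (s * \<sigma> / (s + \<sigma>) * r\<^sup>2)))" for s \<sigma>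
  define c where "c u = t * \<tau> * pi powr (p - 1 / 2) * (u powr (p - 1 / 2) * exp (- (u * \<rho>)))" for u
  define M where "M v u = c u * ((1 / sqrt v + 1 / (v * sqrt v)) * exp (- (u * (t * sqrt v - \<tau> / sqrt v)\<^sup>2)))" for u v
  have c: "c u \<ge> 0" for u using t \<tau> by (simp add: c_def)
  have [measurable]: "(\<lambda>(\<xi>, \<sigma>). ennreal (K \<xi> \<sigma> s)) \<in> borel_measurable (borel \<Otimes>\<^sub>M borel)" for s
    unfolding K_def by measurable
  have Kint: "(\<integral>\<^sup>+\<sigma>\<in>{0<..}. (\<integral>\<^sup>+s\<in>{0<..}. ennreal (K \<xi> \<sigma> s) \<partial>lborel) \<partial>lborel)
     = ennreal ((Gamma p)\<^sup>2) * ennreal (t * A \<xi> powr (- p) * (\<tau> * B \<xi> powr (- p)))" for \<xi>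
  proof -
    have "(\<integral>\<^sup>+s\<in>{0<..}. ennreal (K \<xi> \<sigma> s) \<partial>lborel)
      = ennreal (t * \<tau> * (Gamma p * A \<xi> powr (- p))) * ennreal (\<sigma> powr (p - 1) * exp (- (\<sigma> * B \<xi>)))" for \<sigma>
    proof -
      have "(\<integral>\<^sup>+s\<in>{0<..}. ennreal (K \<xi> \<sigma> s) \<partial>lborel)
        = (\<integral>\<^sup>+s. ennreal (t * \<tau> * (\<sigma> powr (p - 1) * exp (- (\<sigma> * B \<xi>)))) * (ennreal (s powr (p - 1) * exp (- (s * A \<xi>))) * indicator {0<..} s) \<partial>lborel)"
        using t \<tau> by (intro nn_integral_cong) (simp add: K_def ennreal_mult'[symmetric] mult_ac)
      also have "\<dots> = ennreal (t * \<tau> * (\<sigma> powr (p - 1) * exp (- (\<sigma> * B \<xi>)))) * ennreal (Gamma p * A \<xi> powr (- p))"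
        by (subst nn_integral_cmult) (auto simp: nn_integral_powr_exp[OF p0 A])
      finally show ?thesis
        using t \<tau> G by (simp add: ennreal_mult'[symmetric] mult_ac)
    qed
    then have "(\<integral>\<^sup>+\<sigma>\<in>{0<..}. (\<integral>\<^sup>+s\<in>{0<..}. ennreal (K \<xi> \<sigma> s) \<partial>lborel) \<partial>lborel)
      = ennreal (t * \<tau> * (Gamma p * A \<xi> powr (- p))) * ennreal (Gamma p * B \<xi> powr (- p))"
      by (simp add: mult.assoc nn_integral_cmult nn_integral_powr_exp[OF p0 B])
    then show ?thesis
      using t \<tau> G by (simp add: ennreal_mult'[symmetric] power2_eq_square mult_ac)
  qed
  have Lint: "(\<integral>\<^sup>+\<xi>\<in>UNIV. ennreal (K \<xi> \<sigma> s) \<partial>lborel) = ennreal (L \<sigma> s)" if "s > 0" "\<sigma> > 0" for s \<sigma>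
  proof -
    have "(\<integral>\<^sup>+\<xi>\<in>UNIV. ennreal (K \<xi> \<sigma> s) \<partial>lborel)
      = (\<integral>\<^sup>+\<xi>. ennreal (t * \<tau> * (s powr (p - 1) * \<sigma> powr (p - 1) * exp (- (s * t\<^sup>2 + \<sigma> * \<tau>\<^sup>2))))
          * ennreal (exp (- (s * (norm (a - \<xi>))\<^sup>2) - \<sigma> * (norm (\<xi> - b))\<^sup>2)) \<partial>lborel)"
    proof (intro nn_integral_cong)
      fix \<xi>
      have "exp (- (s * A \<xi>)) * exp (- (\<sigma> * B \<xi>))
        = exp (- (s * t\<^sup>2 + \<sigma> * \<tau>\<^sup>2)) * exp (- (s * (norm (a - \<xi>))\<^sup>2) - \<sigma> * (norm (\<xi> - b))\<^sup>2)"
        by (simp add: exp_add[symmetric] A_def B_def algebra_simps)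
      then have "K \<xi> \<sigma> s = t * \<tau> * (s powr (p - 1) * \<sigma> powr (p - 1) * exp (- (s * t\<^sup>2 + \<sigma> * \<tau>\<^sup>2)))
          * exp (- (s * (norm (a - \<xi>))\<^sup>2) - \<sigma> * (norm (\<xi> - b))\<^sup>2)"
        by (simp add: K_def mult_ac)
      then show "ennreal (K \<xi> \<sigma> s) * indicator UNIV \<xi>
        = ennreal (t * \<tau> * (s powr (p - 1) * \<sigma> powr (p - 1) * exp (- (s * t\<^sup>2 + \<sigma> * \<tau>\<^sup>2))))
          * ennreal (exp (- (s * (norm (a - \<xi>))\<^sup>2) - \<sigma> * (norm (\<xi> - b))\<^sup>2))"
        by (simp add: ennreal_mult'')
    qed
    also have "\<dots> = ennreal (t * \<tau> * (s powr (p - 1) * \<sigma> powr (p - 1) * exp (- (s * t\<^sup>2 + \<sigma> * \<tau>\<^sup>2))))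
          * ennreal ((pi / (s + \<sigma>)) powr (CARD('m) / 2) * exp (- (s * \<sigma> / (s + \<sigma>) * (norm (a - b))\<^sup>2)))"
      using that by (subst nn_integral_cmult) (auto simp: nn_integral_gaussian_convolution)
    also have "CARD('m) / 2 = p - 1 / 2" by (simp add: p field_simps)
    finally show ?thesis by (simp add: L_def r_def ennreal_mult'')
  qed
  \<comment> \<open>The substitutions are s = \<sigma> v for fixed \<sigma>, then \<sigma> = u (1 +
    v) / v for fixed v, so that s = u (1 + v). The factors \<sigma> and (1 + v) / v are their
    Jacobians.\<close>
  have LM: "(1 + v) / v * ((u * ((1 + v) / v)) * L (u * ((1 + v) / v)) (u * ((1 + v) / v) * v)) = M v u"
    if u: "u > 0" and v: "v > 0" for u v
  proof -
    define \<sigma> where "\<sigma> = u * ((1 + v) / v)"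
    have \<sigma>: "\<sigma> > 0" using u v by (simp add: \<sigma>_def)
    define q where "q = sqrt v"
    have q: "q > 0" "v = q\<^sup>2" using v by (auto simp: q_def)
    have sum: "\<sigma> * v + \<sigma> = \<sigma> * (1 + v)" by (simp add: algebra_simps)
    have "\<sigma> * v * \<sigma> / (\<sigma> * v + \<sigma>) = u"
    proof -
      have "1 + v \<noteq> 0" using v by simp
      then have "\<sigma> * v / (1 + v) = u" using v by (simp add: \<sigma>_def)
      then show ?thesis unfolding sum using \<sigma> by simp
    qed
    moreover have "\<sigma> * v * t\<^sup>2 + \<sigma> * \<tau>\<^sup>2 + u * r\<^sup>2 = u * \<rho> + u * (t * sqrt v - \<tau> / sqrt v)\<^sup>2"
      unfolding q_def[symmetric] \<sigma>_def \<rho>_def q(2) using q(1) by (simp add: field_simps power2_eq_square)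
    ultimately have ex: "exp (- (\<sigma> * v * t\<^sup>2 + \<sigma> * \<tau>\<^sup>2)) * exp (- (\<sigma> * v * \<sigma> / (\<sigma> * v + \<sigma>) * r\<^sup>2))
       = exp (- (u * \<rho>)) * exp (- (u * (t * sqrt v - \<tau> / sqrt v)\<^sup>2))"
      by (simp add: exp_add[symmetric] algebra_simps)
    have pw: "(1 + v) / v * (\<sigma> * ((\<sigma> * v) powr (p - 1) * \<sigma> powr (p - 1) * (pi / (\<sigma> * v + \<sigma>)) powr (p - 1 / 2)))
      = pi powr (p - 1 / 2) * u powr (p - 1 / 2) * (1 / sqrt v + 1 / (v * sqrt v))"
    proof -
      have "(\<sigma> * v) powr (p - 1) * \<sigma> powr (p - 1) = (\<sigma>\<^sup>2 * v) powr (p - 1)"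
        using \<sigma> v by (simp add: powr_mult power2_eq_square)
      also have "\<sigma>\<^sup>2 * v = u * (\<sigma> * (1 + v))"
        using v by (simp add: \<sigma>_def power2_eq_square)
      also have "\<dots> powr (p - 1) = u powr (p - 1) * (\<sigma> * (1 + v)) powr (p - 1 / 2) / sqrt (\<sigma> * (1 + v))"
      proof -
        have "(\<sigma> * (1 + v)) powr (p - 1) = (\<sigma> * (1 + v)) powr (p - 1 / 2) / (\<sigma> * (1 + v)) powr (1 / 2)"
          by (simp add: powr_diff[symmetric])
        then show ?thesis using u v \<sigma> by (simp add: powr_mult powr_half_sqrt real_sqrt_mult)
      qed
      finally have 1: "(\<sigma> * v) powr (p - 1) * \<sigma> powr (p - 1) = 
         u powr (p - 1) * (\<sigma> * (1 + v)) powr (p - 1 / 2) / sqrt (\<sigma> * (1 + v))" .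
      have "(\<sigma> * v) powr (p - 1) * \<sigma> powr (p - 1) * (pi / (\<sigma> * v + \<sigma>)) powr (p - 1 / 2)
        = pi powr (p - 1 / 2) * u powr (p - 1) / sqrt (\<sigma> * (1 + v))"
        unfolding 1 sum using \<sigma> v by (simp only: powr_divide) simp
      also have "sqrt (\<sigma> * (1 + v)) = sqrt u * (1 + v) / sqrt v"
      proof -
        have "\<sigma> * (1 + v) = u * (1 + v)\<^sup>2 / v" by (simp add: \<sigma>_def power2_eq_square)
        then show ?thesis using v u by (simp add: real_sqrt_mult real_sqrt_divide)
      qed
      also have "u powr (p - 1) = u powr (p - 1 / 2) / sqrt u"
        using u by (simp add: powr_half_sqrt[symmetric] powr_diff[symmetric])
      finally have 2: "(\<sigma> * v) powr (p - 1) * \<sigma> powr (p - 1) * (pi / (\<sigma> * v + \<sigma>)) powr (p - 1 / 2)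
        = pi powr (p - 1 / 2) * (u powr (p - 1 / 2) / sqrt u) / (sqrt u * (1 + v) / sqrt v)" .
      have q_ne: "1 + q\<^sup>2 \<noteq> 0" by (metis add_pos_nonneg less_irrefl zero_le_power2 zero_less_one)
      define w where "w = sqrt u"
      have w: "w > 0" "u = w\<^sup>2" using u by (auto simp: w_def)
      have "(1 + v) / v * (\<sigma> * (x * (y / sqrt u) / (sqrt u * (1 + v) / sqrt v))) = x * y * (1 / sqrt v + 1 / (v * sqrt v))" for x y
      proof -
        have m: "z / q\<^sup>2 * (w\<^sup>2 * (z / q\<^sup>2) * (x * (y / w) / (w * z / q))) = x * y * (z / (q\<^sup>2 * q))" if "z \<noteq> 0" for z
          using that q(1) w(1) by (simp add: field_simps power2_eq_square)
        have e: "(1 + q\<^sup>2) / (q\<^sup>2 * q) = 1 / q + 1 / (q\<^sup>2 * q)"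
          using q(1) by (simp add: field_simps power2_eq_square)
        show ?thesis
          unfolding q_def[symmetric] w_def[symmetric] \<sigma>_def unfolding w(2) q(2) by (simp only: m[OF q_ne] e)
      qed
      then show ?thesis unfolding 2 by blast
    qed
    have "(1 + v) / v * (\<sigma> * L \<sigma> (\<sigma> * v))
      = t * \<tau> * ((1 + v) / v * (\<sigma> * ((\<sigma> * v) powr (p - 1) * \<sigma> powr (p - 1) * (pi / (\<sigma> * v + \<sigma>)) powr (p - 1 / 2))))
        * (exp (- (\<sigma> * v * t\<^sup>2 + \<sigma> * \<tau>\<^sup>2)) * exp (- (\<sigma> * v * \<sigma> / (\<sigma> * v + \<sigma>) * r\<^sup>2)))"
      by (simp only: L_def mult_ac)
    also have "\<dots> = M v u"
      unfolding pw ex by (simp only: M_def c_def mult_ac)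
    finally show ?thesis by (simp only: \<sigma>_def)
  qed
  \<comment> \<open>The prefactor t \<tau> turns 1 / t + 1 / \<tau> into t + \<tau>, and the factor
    1 / sqrt u lowers the power of u from p - 1/2 to p - 1.\<close>
  have Mint: "(\<integral>\<^sup>+v\<in>{0<..}. ennreal (M v u) \<partial>lborel)
     = ennreal ((t + \<tau>) * pi powr p) * ennreal (u powr (p - 1) * exp (- (u * \<rho>)))" if u: "u > 0" for u
  proof -
    have "(\<integral>\<^sup>+v\<in>{0<..}. ennreal (M v u) \<partial>lborel) = ennreal (c u) * ennreal ((1 / t + 1 / \<tau>) * sqrt (pi / u))"
      unfolding M_def nn_integral_Cauchy_Schloemilch[OF u t \<tau>, symmetric]
      using c[of u] by (subst nn_integral_cmult[symmetric]) (auto simp: ennreal_mult' mult.assoc intro!: nn_integral_cong)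
    also have "\<dots> = ennreal (c u * ((1 / t + 1 / \<tau>) * sqrt (pi / u)))"
      using c by (simp add: ennreal_mult'[symmetric])
    also have "c u * ((1 / t + 1 / \<tau>) * sqrt (pi / u)) = (t + \<tau>) * pi powr p * (u powr (p - 1) * exp (- (u * \<rho>)))"
    proof -
      have "pi powr p = pi powr (p - 1 / 2) * sqrt pi" "u powr (p - 1 / 2) = u powr (p - 1) * sqrt u"
        using u by (simp_all add: powr_half_sqrt[symmetric] powr_add[symmetric])
      then show ?thesis using t \<tau> u by (simp add: c_def real_sqrt_divide field_simps)
    qed
    finally show ?thesis using t \<tau> by (simp add: ennreal_mult')
  qed
  have "ennreal ((Gamma p)\<^sup>2) * (\<integral>\<^sup>+\<xi>. ennreal (t * A \<xi> powr (- p) * (\<tau> * B \<xi> powr (- p))) \<partial>lborel)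
     = (\<integral>\<^sup>+\<xi>\<in>UNIV. (\<integral>\<^sup>+\<sigma>\<in>{0<..}. (\<integral>\<^sup>+s\<in>{0<..}. ennreal (K \<xi> \<sigma> s) \<partial>lborel) \<partial>lborel) \<partial>lborel)"
    by (simp add: Kint nn_integral_cmult)
  also have "\<dots> = (\<integral>\<^sup>+\<sigma>\<in>{0<..}. (\<integral>\<^sup>+\<xi>\<in>UNIV. (\<integral>\<^sup>+s\<in>{0<..}. ennreal (K \<xi> \<sigma> s) \<partial>lborel) \<partial>lborel) \<partial>lborel)"
    unfolding K_def by (rule set_nn_integral_swap) measurable
  also have "\<dots> = (\<integral>\<^sup>+\<sigma>\<in>{0<..}. (\<integral>\<^sup>+s\<in>{0<..}. (\<integral>\<^sup>+\<xi>\<in>UNIV. ennreal (K \<xi> \<sigma> s) \<partial>lborel) \<partial>lborel) \<partial>lborel)"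
    unfolding K_def by (intro nn_integral_cong arg_cong2[of _ _ _ _ "(*)"] set_nn_integral_swap refl) measurable
  also have "\<dots> = (\<integral>\<^sup>+\<sigma>\<in>{0<..}. (\<integral>\<^sup>+s\<in>{0<..}. ennreal (L \<sigma> s) \<partial>lborel) \<partial>lborel)"
    by (intro set_nn_integral_cong refl Lint) auto
  also have "\<dots> = (\<integral>\<^sup>+\<sigma>\<in>{0<..}. (\<integral>\<^sup>+v\<in>{0<..}. ennreal \<sigma> * ennreal (L \<sigma> (\<sigma> * v)) \<partial>lborel) \<partial>lborel)"
    by (intro set_nn_integral_cong refl set_nn_integral_scale) (auto simp: L_def)
  also have "\<dots> = (\<integral>\<^sup>+v\<in>{0<..}. (\<integral>\<^sup>+\<sigma>\<in>{0<..}. ennreal \<sigma> * ennreal (L \<sigma> (\<sigma> * v)) \<partial>lborel) \<partial>lborel)"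
    unfolding L_def by (rule set_nn_integral_swap) measurable
  also have "\<dots> = (\<integral>\<^sup>+v\<in>{0<..}. (\<integral>\<^sup>+u\<in>{0<..}. ennreal ((1 + v) / v) * (ennreal ((1 + v) / v * u) *
       ennreal (L ((1 + v) / v * u) ((1 + v) / v * u * v))) \<partial>lborel) \<partial>lborel)"
    by (intro set_nn_integral_cong refl set_nn_integral_scale) (auto simp: L_def)
  also have "\<dots> = (\<integral>\<^sup>+v\<in>{0<..}. (\<integral>\<^sup>+u\<in>{0<..}. ennreal (M v u) \<partial>lborel) \<partial>lborel)"
    using LM by (intro set_nn_integral_cong refl) (auto simp: ennreal_mult'[symmetric] mult_ac)
  also have "\<dots> = (\<integral>\<^sup>+u\<in>{0<..}. (\<integral>\<^sup>+v\<in>{0<..}. ennreal (M v u) \<partial>lborel) \<partial>lborel)"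
    unfolding M_def c_def by (rule set_nn_integral_swap) measurable
  also have "\<dots> = (\<integral>\<^sup>+u\<in>{0<..}. ennreal ((t + \<tau>) * pi powr p) * ennreal (u powr (p - 1) * exp (- (u * \<rho>))) \<partial>lborel)"
    by (intro set_nn_integral_cong refl Mint) auto
  also have "\<dots> = ennreal ((t + \<tau>) * pi powr p) * ennreal (Gamma p * \<rho> powr (- p))"
    using \<rho> p0 by (simp add: mult.assoc nn_integral_cmult nn_integral_powr_exp)
  finally have fin: "ennreal ((Gamma p)\<^sup>2) * (\<integral>\<^sup>+\<xi>. ennreal (t * A \<xi> powr (- p) * (\<tau> * B \<xi> powr (- p))) \<partial>lborel)
     = ennreal ((t + \<tau>) * pi powr p * (Gamma p * \<rho> powr (- p)))"
    using t \<tau> by (simp add: ennreal_mult')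
  have "(\<integral>\<^sup>+\<xi>. ennreal (t * A \<xi> powr (- p) * (\<tau> * B \<xi> powr (- p))) \<partial>lborel)
    = ennreal (1 / (Gamma p)\<^sup>2) * (ennreal ((Gamma p)\<^sup>2) * (\<integral>\<^sup>+\<xi>. ennreal (t * A \<xi> powr (- p) * (\<tau> * B \<xi> powr (- p))) \<partial>lborel))"
    using G by (simp add: mult.assoc[symmetric] ennreal_mult'[symmetric])
  also have "\<dots> = ennreal (1 / (Gamma p)\<^sup>2 * ((t + \<tau>) * pi powr p * (Gamma p * \<rho> powr (- p))))"
    unfolding fin by (rule ennreal_mult'[symmetric]) simp
  also have "1 / (Gamma p)\<^sup>2 * ((t + \<tau>) * pi powr p * (Gamma p * \<rho> powr (- p)))
     = pi powr p / Gamma p * ((t + \<tau>) * \<rho> powr (- p))"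
    using G by (simp add: power2_eq_square)
  finally show ?thesis by (simp only: A_def B_def \<rho>_def r_def)
qed

section \<open>Poisson kernels and potentials in the half space\<close>

lemma has_real_derivative_lebesgue_integral:
  fixes F F' :: "real \<Rightarrow> 'a \<Rightarrow> real"
  assumes \<delta>: "\<delta> > 0"
    and int: "\<And>h. \<bar>h\<bar> < \<delta> \<Longrightarrow> integrable M (F h)"
    and der: "\<And>h x. \<bar>h\<bar> < \<delta> \<Longrightarrow> x \<in> space M \<Longrightarrow> ((\<lambda>h. F h x) has_real_derivative F' h x) (at h)"
    and bound: "\<And>h x. \<bar>h\<bar> < \<delta> \<Longrightarrow> x \<in> space M \<Longrightarrow> \<bar>F' h x\<bar> \<le> g x"
    and g: "integrable M g"
    and meas: "F' 0 \<in> borel_measurable M"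
  shows "((\<lambda>h. \<integral>x. F h x \<partial>M) has_real_derivative (\<integral>x. F' 0 x \<partial>M)) (at 0)"
  unfolding has_field_derivative_iff
proof (simp, subst tendsto_at_iff_sequentially, intro allI impI)
  fix X :: "nat \<Rightarrow> real"
  assume X: "\<forall>i. X i \<in> UNIV - {0}" "X \<longlonglongrightarrow> 0"
  from X(1) have nz: "X k \<noteq> 0" for k by auto
  have ev: "\<forall>\<^sub>F k in sequentially. \<bar>X k\<bar> < \<delta>"
    using order_tendstoD(2)[OF tendsto_rabs[OF X(2)], of \<delta>] \<delta> by simp
  \<comment> \<open>The difference quotient is set to 0 while |X k| >= \<delta>, so that
    measurability and the bound by \<open>g\<close> hold for every k, as dominated convergence
    requires.\<close>
  define s where "s k x = (if \<bar>X k\<bar> < \<delta> then (F (X k) x - F 0 x) / X k else 0)" for k x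
  have [measurable]: "F h \<in> borel_measurable M" if "\<bar>h\<bar> < \<delta>" for h
    using int[OF that] by (rule borel_measurable_integrable)
  have "(\<lambda>k. \<integral>x. s k x \<partial>M) \<longlonglongrightarrow> (\<integral>x. F' 0 x \<partial>M)"
  proof (rule integral_dominated_convergence[OF meas _ g])
    show "s k \<in> borel_measurable M" for k
      unfolding s_def [abs_def] using \<delta> by (cases "\<bar>X k\<bar> < \<delta>") simp_all
    show "AE x in M. (\<lambda>k. s k x) \<longlonglongrightarrow> F' 0 x"
    proof (rule AE_I2)
      fix x assume x: "x \<in> space M"
      have "((\<lambda>h. (F h x - F 0 x) / h) \<longlongrightarrow> F' 0 x) (at 0)"
        using der[of 0 x] \<delta> x by (simp add: has_field_derivative_iff)
      then have "(\<lambda>k. (F (X k) x - F 0 x) / X k) \<longlonglongrightarrow> F' 0 x"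
        using X unfolding tendsto_at_iff_sequentially by (auto simp: o_def)
      then show "(\<lambda>k. s k x) \<longlonglongrightarrow> F' 0 x"
        by (rule Lim_transform_eventually) (use ev in \<open>auto elim!: eventually_mono simp: s_def\<close>)
    qed
    show "AE x in M. norm (s k x) \<le> g x" for k
    proof (rule AE_I2)
      fix x assume x: "x \<in> space M"
      show "norm (s k x) \<le> g x"
      proof (cases "\<bar>X k\<bar> < \<delta>")
        case True
        \<comment> \<open>The mean value inequality carries the bound on F' over to the difference
          quotients.\<close>
        have "norm (F (X k) x - F 0 x) \<le> g x * norm (X k - 0)"
        proof (rule field_differentiable_bound[where S = "{-\<delta><..<\<delta>}" and f' = "\<lambda>h. F' h x"])
          show "((\<lambda>h. F h x) has_field_derivative F' h x) (at h within {-\<delta><..<\<delta>})" if "h \<in> {-\<delta><..<\<delta>}" for h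
            using der[of h x] that x by (auto intro: has_field_derivative_at_within)
          show "norm (F' h x) \<le> g x" if "h \<in> {-\<delta><..<\<delta>}" for h
            using bound[of h x] that x by auto
        qed (use True \<delta> in auto)
        then show ?thesis using True nz[of k] by (simp add: s_def divide_simps)
      next
        case False
        have "\<bar>F' 0 x\<bar> \<le> g x" using bound[of 0 x] \<delta> x by simp
        then show ?thesis using False by (simp add: s_def)
      qed
    qed
  qed
  then show "((\<lambda>h. ((\<integral>x. F h x \<partial>M) - (\<integral>x. F 0 x \<partial>M)) / h) \<circ> X) \<longlonglongrightarrow> (\<integral>x. F' 0 x \<partial>M)"
  proof (rule Lim_transform_eventually)
    show "\<forall>\<^sub>F k in sequentially. (\<integral>x. s k x \<partial>M) = ((\<lambda>h. ((\<integral>x. F h x \<partial>M) - (\<integral>x. F 0 x \<partial>M)) / h) \<circ> X) k"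
      using ev
    proof eventually_elim
      case (elim k)
      then show ?case using int[of "X k"] int[of 0] \<delta>
        by (simp add: s_def)
    qed
  qed
qed

lemma has_real_derivative_inverse_norm_power:
  fixes w v :: "'a::real_inner"
  assumes "w + h *\<^sub>R v \<noteq> 0"
  shows "((\<lambda>h. 1 / norm (w + h *\<^sub>R v) ^ k) has_real_derivative
     - real k * ((w + h *\<^sub>R v) \<bullet> v) / norm (w + h *\<^sub>R v) ^ (k + 2)) (at h)"
proof -
  have "((\<lambda>h. w + h *\<^sub>R v) has_derivative (\<lambda>x. x *\<^sub>R v)) (at h)"
    by (auto intro!: derivative_eq_intros)
  from has_derivative_compose[OF this has_derivative_norm[OF assms]]
  have "((\<lambda>h. norm (w + h *\<^sub>R v)) has_derivative (\<lambda>x. x * (((w + h *\<^sub>R v) \<bullet> v) / norm (w + h *\<^sub>R v)))) (at h)"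
    by (simp add: sgn_div_norm inner_commute divide_inverse mult_ac)
  then have 1: "((\<lambda>h. norm (w + h *\<^sub>R v)) has_real_derivative ((w + h *\<^sub>R v) \<bullet> v) / norm (w + h *\<^sub>R v)) (at h)"
    by (simp only: has_field_derivative_def mult.commute[of _ "_ / _"])
  have nz: "norm (w + h *\<^sub>R v) > 0" using assms by simp
  have "- (inverse (r ^ k) * (real k * (X / r * r ^ (k - Suc 0))) * inverse (r ^ k)) = - real k * X / r ^ (k + 2)"
    if "r > 0" for r X :: real
    using that by (cases k) (auto simp: field_simps)
  note eq = this[OF nz]
  have "((\<lambda>h. inverse (norm (w + h *\<^sub>R v) ^ k)) has_real_derivative
     - real k * ((w + h *\<^sub>R v) \<bullet> v) / norm (w + h *\<^sub>R v) ^ (k + 2)) (at h)"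
    by (rule DERIV_cong[OF DERIV_inverse'[OF DERIV_power[OF 1]] eq]) (use nz in simp)
  then show ?thesis by (simp only: inverse_eq_divide)
qed

section \<open>Tangential and normal coordinates\<close>

definition tang :: "real ^ ('m::finite) option \<Rightarrow> real ^ 'm" where
  "tang x = (\<chi> a. x $ Some a)"

lemma sum_option: "(\<Sum>k\<in>UNIV. f k) = f None + (\<Sum>a\<in>UNIV. f (Some (a :: 'm::finite)))"
  by (simp add: UNIV_option_conv sum.reindex)

lemma norm_option_sq: "(norm x)\<^sup>2 = (norm (tang x))\<^sup>2 + (x $ None)\<^sup>2"
  unfolding power2_norm_eq_inner inner_vec_def sum_option by (simp add: tang_def power2_eq_square)

lemma tang_simps [simp]:
  "tang (x - y) = tang x - tang y" "tang (bdry \<xi>) = \<xi>" "tang (refl_pt y) = tang y"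
  by (simp_all add: tang_def vec_eq_iff bdry_def refl_pt_def)

lemma normal_simps [simp]: "bdry \<xi> $ None = 0" "refl_pt y $ None = - y $ None"
  by (simp_all add: bdry_def refl_pt_def)

lemma bdry_measurable [measurable]: "bdry \<in> borel_measurable borel"
proof -
  have "linear bdry"
    by (rule linearI) (auto simp: vec_eq_iff bdry_def split: option.split)
  then show ?thesis
    by (intro borel_measurable_continuous_onI linear_continuous_on linear_conv_bounded_linear[THEN iffD1])
qed

lemma vec_nth_measurable [measurable]: "(\<lambda>x::real ^ 'n::finite. x $ i) \<in> borel_measurable borel"
  by (intro borel_measurable_continuous_onI continuous_on_component continuous_on_id)

lemma norm_sub_bdry_sq: "(norm (x - bdry \<xi>))\<^sup>2 = (norm (tang x - \<xi>))\<^sup>2 + (x $ None)\<^sup>2"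
  by (simp add: norm_option_sq)

lemma norm_bdry_sub_sq: "(norm (bdry \<xi> - y))\<^sup>2 = (norm (\<xi> - tang y))\<^sup>2 + (y $ None)\<^sup>2"
  by (simp add: norm_option_sq)

lemma norm_sub_refl_sq: "(norm (x - refl_pt y))\<^sup>2 = (norm (tang x - tang y))\<^sup>2 + (x $ None + y $ None)\<^sup>2"
  by (simp add: norm_option_sq)

lemma normal_le_norm: "x $ None \<le> norm (x - bdry \<xi>)" "y $ None \<le> norm (bdry \<xi> - y)"
  using component_le_norm_cart[of "x - bdry \<xi>" None] component_le_norm_cart[of "bdry \<xi> - y" None] by auto

text \<open>Passes from real powers of squared distances, the form natural for Gaussians, to integer
  powers of norms, the form in the tensors.\<close>

lemma power2_powr_half:
  assumes "(r::real) > 0" "s = r\<^sup>2"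
  shows "s powr (- (real n / 2)) = 1 / r ^ n"
proof -
  have "s = r powr 2" using assms by simp
  then have "s powr (- (real n / 2)) = r powr (- real n)" by (simp only: powr_powr) simp
  also have "\<dots> = inverse (r powr real n)" by (rule powr_minus)
  also have "r powr real n = r ^ n" using assms by (intro powr_realpow)
  finally show ?thesis by (simp only: inverse_eq_divide)
qed

text \<open>Half the area of the unit sphere in R^n, which is the mass of x_n / |x - \<xi>|^n over
  the boundary. The \<open>itself\<close> argument carries the dimension.\<close>

definition poisson_const :: "'m::finite itself \<Rightarrow> real" where
  "poisson_const _ = pi powr (CARD('m option) / 2) / Gamma (CARD('m option) / 2)"

lemma poisson_const_eq:
  "poisson_const TYPE('m::finite) = CARD('m option) * unit_ball_vol (CARD('m option)) / 2"
  by (subst unit_ball_vol_Gamma) (auto simp: poisson_const_def)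

lemma poisson_const_pos: "poisson_const TYPE('m::finite) > 0"
  by (simp add: poisson_const_def Gamma_real_pos)

section \<open>Mass and potentials of the Poisson kernel\<close>

lemma has_bochner_integral_poisson:
  fixes x :: "real ^ ('m::finite) option"
  assumes "x \<in> half_space"
  shows "has_bochner_integral lborel (\<lambda>\<xi>. 1 / norm (x - bdry \<xi>) ^ CARD('m option)) (poisson_const TYPE('m) / x $ None)"
proof (rule has_bochner_integral_nn_integral)
  have x: "x $ None > 0" using assms by (simp add: half_space_def)
  have pos: "norm (x - bdry \<xi>) > 0" for \<xi>
    using normal_le_norm(1)[of x \<xi>] x by linarith
  have "(\<integral>\<^sup>+\<xi>. ennreal (1 / norm (x - bdry \<xi>) ^ CARD('m option)) \<partial>lborel)
     = (\<integral>\<^sup>+\<xi>. ennreal (((norm (tang x - \<xi>))\<^sup>2 + (x $ None)\<^sup>2) powr (- (CARD('m option) / 2))) \<partial>lborel)"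
    by (intro nn_integral_cong arg_cong[of _ _ ennreal] power2_powr_half[symmetric] norm_sub_bdry_sq[symmetric] pos)
  also have "\<dots> = ennreal (poisson_const TYPE('m) / x $ None)"
    unfolding poisson_const_def by (rule nn_integral_poisson) (use x in auto)
  finally show "(\<integral>\<^sup>+\<xi>. ennreal (1 / norm (x - bdry \<xi>) ^ CARD('m option)) \<partial>lborel) = ennreal (poisson_const TYPE('m) / x $ None)" .
  show "0 \<le> poisson_const TYPE('m) / x $ None" using x poisson_const_pos[where 'm = 'm] by simp
qed auto

lemma integrable_poisson:
  fixes x :: "real ^ ('m::finite) option"
  assumes "x \<in> half_space"
  shows "integrable lborel (\<lambda>\<xi>. 1 / norm (x - bdry \<xi>) ^ CARD('m option))"
  using has_bochner_integral_poisson[OF assms] by (rule integrable.intros)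

text \<open>Integrating the semigroup identity over the height of the second kernel produces potentials.\<close>

lemma nn_integral_poisson_potential:
  fixes a b :: "real ^ ('m::finite)"
  assumes t: "t > 0" and S: "S \<in> sets borel" "S \<subseteq> {0<..}" and p: "p = (CARD('m) + 1) / 2"
  shows "(\<integral>\<^sup>+\<xi>. ennreal (t * ((norm (a - \<xi>))\<^sup>2 + t\<^sup>2) powr (- p)) *
        (\<integral>\<^sup>+\<sigma>\<in>S. ennreal (\<sigma> * ((norm (\<xi> - b))\<^sup>2 + \<sigma>\<^sup>2) powr (- p)) \<partial>lborel) \<partial>lborel)
    = ennreal (pi powr p / Gamma p) * (\<integral>\<^sup>+\<sigma>\<in>S. ennreal ((t + \<sigma>) * ((norm (a - b))\<^sup>2 + (t + \<sigma>)\<^sup>2) powr (- p)) \<partial>lborel)"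
proof -
  have p0: "p > 0" by (simp add: p)
  have G: "pi powr p / Gamma p \<ge> 0" using Gamma_real_pos[OF p0] by simp
  note [measurable] = S(1)
  have "(\<integral>\<^sup>+\<xi>. ennreal (t * ((norm (a - \<xi>))\<^sup>2 + t\<^sup>2) powr (- p)) *
        (\<integral>\<^sup>+\<sigma>\<in>S. ennreal (\<sigma> * ((norm (\<xi> - b))\<^sup>2 + \<sigma>\<^sup>2) powr (- p)) \<partial>lborel) \<partial>lborel)
    = (\<integral>\<^sup>+\<xi>\<in>UNIV. (\<integral>\<^sup>+\<sigma>\<in>S. ennreal (t * ((norm (a - \<xi>))\<^sup>2 + t\<^sup>2) powr (- p)) *
        ennreal (\<sigma> * ((norm (\<xi> - b))\<^sup>2 + \<sigma>\<^sup>2) powr (- p)) \<partial>lborel) \<partial>lborel)"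
    by (intro nn_integral_cong) (simp add: mult.assoc nn_integral_cmult)
  also have "\<dots> = (\<integral>\<^sup>+\<sigma>\<in>S. (\<integral>\<^sup>+\<xi>\<in>UNIV. ennreal (t * ((norm (a - \<xi>))\<^sup>2 + t\<^sup>2) powr (- p)) *
        ennreal (\<sigma> * ((norm (\<xi> - b))\<^sup>2 + \<sigma>\<^sup>2) powr (- p)) \<partial>lborel) \<partial>lborel)"
    by (rule set_nn_integral_swap) measurable
  also have "\<dots> = (\<integral>\<^sup>+\<sigma>\<in>S. ennreal (pi powr p / Gamma p) * ennreal ((t + \<sigma>) * ((norm (a - b))\<^sup>2 + (t + \<sigma>)\<^sup>2) powr (- p)) \<partial>lborel)"
  proof (intro set_nn_integral_cong refl)
    fix \<sigma> assume "\<sigma> \<in> space lborel \<inter> S"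
    then have \<sigma>: "\<sigma> > 0" using S by auto
    show "(\<integral>\<^sup>+\<xi>\<in>UNIV. ennreal (t * ((norm (a - \<xi>))\<^sup>2 + t\<^sup>2) powr (- p)) *
        ennreal (\<sigma> * ((norm (\<xi> - b))\<^sup>2 + \<sigma>\<^sup>2) powr (- p)) \<partial>lborel)
      = ennreal (pi powr p / Gamma p) * ennreal ((t + \<sigma>) * ((norm (a - b))\<^sup>2 + (t + \<sigma>)\<^sup>2) powr (- p))"
      using nn_integral_poisson_semigroup[OF t \<sigma> p, of a b] t G
      by (simp add: ennreal_mult'[symmetric])
  qed
  also have "\<dots> = ennreal (pi powr p / Gamma p) * (\<integral>\<^sup>+\<sigma>\<in>S. ennreal ((t + \<sigma>) * ((norm (a - b))\<^sup>2 + (t + \<sigma>)\<^sup>2) powr (- p)) \<partial>lborel)"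
    by (simp add: mult.assoc nn_integral_cmult)
  finally show ?thesis .
qed

text \<open>The antiderivative vanishes at infinity because p > 1. With p = n / 2 this is the range
  n >= 3, and it produces the power 2 - n of the distance.\<close>

lemma nn_integral_radial_power:
  assumes "p > 1" "t \<ge> 0" "\<tau> > 0"
  shows "(\<integral>\<^sup>+\<sigma>\<in>{\<tau>..}. ennreal ((t + \<sigma>) * (r\<^sup>2 + (t + \<sigma>)\<^sup>2) powr (- p)) \<partial>lborel)
    = ennreal ((r\<^sup>2 + (t + \<tau>)\<^sup>2) powr (1 - p) / (2 * (p - 1)))"
proof -
  define F where "F \<sigma> = - ((r\<^sup>2 + (t + \<sigma>)\<^sup>2) powr (1 - p) / (2 * (p - 1)))" for \<sigma>
  have "(\<integral>\<^sup>+\<sigma>\<in>{\<tau>..}. ennreal ((t + \<sigma>) * (r\<^sup>2 + (t + \<sigma>)\<^sup>2) powr (- p)) \<partial>lborel) = ennreal (0 - F \<tau>)"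
  proof (rule nn_integral_FTC_atLeast)
    show "(F has_real_derivative (t + \<sigma>) * (r\<^sup>2 + (t + \<sigma>)\<^sup>2) powr (- p)) (at \<sigma>)" if "\<tau> \<le> \<sigma>" for \<sigma>
    proof -
      have "t + \<sigma> > 0" using assms that by linarith
      then have "r\<^sup>2 + (t + \<sigma>)\<^sup>2 > 0" by (intro add_nonneg_pos) auto
      then show ?thesis
        unfolding F_def [abs_def] using assms
        by (auto intro!: DERIV_cong[OF DERIV_minus[OF DERIV_cdivide[OF DERIV_chain2[OF has_real_derivative_powr]]]]
             derivative_eq_intros simp: divide_simps)
          (simp add: algebra_simps)
    qed
    have "((\<lambda>\<sigma>. (r\<^sup>2 + (t + \<sigma>)\<^sup>2) powr (1 - p)) \<longlongrightarrow> 0) at_top"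
    proof (rule tendsto_neg_powr)
      show "filterlim (\<lambda>\<sigma>. r\<^sup>2 + (t + \<sigma>)\<^sup>2) at_top at_top"
        by (intro filterlim_tendsto_add_at_top[OF tendsto_const] filterlim_pow_at_top filterlim_ident) auto
    qed (use assms in auto)
    from tendsto_minus[OF tendsto_divide[OF this tendsto_const, of "2 * (p - 1)"]]
    show "(F \<longlongrightarrow> 0) at_top" unfolding F_def [abs_def] using assms by simp
  qed (use assms in auto)
  then show ?thesis by (simp add: F_def)
qed

text \<open>The borderline p = 1, that is n = 2: the antiderivative is a logarithm and unbounded, so
  the heights stop at a finite \<open>T\<close>.\<close>

lemma nn_integral_radial_log:
  assumes "t \<ge> 0" "\<tau> > 0" "\<tau> \<le> T"
  shows "(\<integral>\<^sup>+\<sigma>\<in>{\<tau>..T}. ennreal ((t + \<sigma>) * (r\<^sup>2 + (t + \<sigma>)\<^sup>2) powr (- 1)) \<partial>lborel)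
    = ennreal (ln (r\<^sup>2 + (t + T)\<^sup>2) / 2 - ln (r\<^sup>2 + (t + \<tau>)\<^sup>2) / 2)"
proof (rule nn_integral_FTC_Icc)
  show "((\<lambda>\<sigma>. ln (r\<^sup>2 + (t + \<sigma>)\<^sup>2) / 2) has_real_derivative (t + \<sigma>) * (r\<^sup>2 + (t + \<sigma>)\<^sup>2) powr (- 1)) (at \<sigma>)"
    if "\<sigma> \<in> {\<tau>..T}" for \<sigma>
  proof -
    have "t + \<sigma> > 0" using assms that by auto
    then have "r\<^sup>2 + (t + \<sigma>)\<^sup>2 > 0" by (intro add_nonneg_pos) auto
    then show ?thesis
      by (auto intro!: DERIV_cong[OF DERIV_cdivide[OF DERIV_chain2[OF DERIV_ln_divide]]]
           derivative_eq_intros simp: powr_minus divide_simps) (simp_all add: algebra_simps)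
  qed
qed (use assms in auto)

lemma half_space_pos: "x \<in> half_space \<Longrightarrow> x $ None > 0"
  by (simp add: half_space_def)

lemma norm_sub_bdry_pos:
  assumes "x \<in> half_space"
  shows "norm (x - bdry \<xi>) > 0" "norm (bdry \<xi> - x) > 0"
  using normal_le_norm[of x \<xi>] half_space_pos[OF assms] by (auto simp: norm_minus_commute)

lemma norm_sub_refl_pos:
  assumes "x \<in> half_space" "y \<in> half_space"
  shows "norm (x - refl_pt y) > 0"
  using component_le_norm_cart[of "x - refl_pt y" None] assms by (auto simp: half_space_def)

text \<open>This is the Poisson formula for the function |x - \<open>refl_pt y\<close>|^(2-n) of x,
  harmonic in the half space: its boundary values are |\<xi> - y|^(2-n), because boundary points are
  equidistant from y and its reflection.\<close>

lemma has_bochner_integral_poisson_potential: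
  fixes x y :: "real ^ ('m::finite) option"
  assumes "x \<in> half_space" "y \<in> half_space" and n: "CARD('m option) \<ge> 3"
  shows "has_bochner_integral lborel
    (\<lambda>\<xi>. 1 / norm (x - bdry \<xi>) ^ CARD('m option) * (1 / norm (bdry \<xi> - y) ^ (CARD('m option) - 2)))
    (poisson_const TYPE('m) / (x $ None * norm (x - refl_pt y) ^ (CARD('m option) - 2)))"
    (is "has_bochner_integral _ ?f ?I")
proof (rule has_bochner_integral_nn_integral)
  note pos = half_space_pos[OF assms(1)] half_space_pos[OF assms(2)]
    norm_sub_bdry_pos(1)[OF assms(1)] norm_sub_bdry_pos(2)[OF assms(2)] norm_sub_refl_pos[OF assms(1,2)]
  define n where "n = CARD('m option)"
  define p where "p = real n / 2"
  have p: "p = (CARD('m) + 1) / 2" by (simp add: p_def n_def)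
  have p1: "p > 1" "2 * (p - 1) = real (n - 2)" "1 - p = - (real (n - 2) / 2)"
    using assms(3) by (auto simp: p_def n_def field_simps of_nat_diff)
  have k: "real (n - 2) > 0" using assms(3) by (simp add: n_def)
  \<comment> \<open>The factor x_n completes the Poisson kernel and 1 / (n - 2) comes from the
    integration over heights; both are divided out again at the end.\<close>
  have "ennreal (x $ None / real (n - 2)) * (\<integral>\<^sup>+\<xi>. ennreal (?f \<xi>) \<partial>lborel)
    = (\<integral>\<^sup>+\<xi>. ennreal (x $ None * ((norm (tang x - \<xi>))\<^sup>2 + (x $ None)\<^sup>2) powr (- p)) *
       (\<integral>\<^sup>+\<sigma>\<in>{y $ None..}. ennreal (\<sigma> * ((norm (\<xi> - tang y))\<^sup>2 + \<sigma>\<^sup>2) powr (- p)) \<partial>lborel) \<partial>lborel)"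
  proof (subst nn_integral_cmult[symmetric])
    show "(\<integral>\<^sup>+\<xi>. ennreal (x $ None / real (n - 2)) * ennreal (?f \<xi>) \<partial>lborel) = 
      (\<integral>\<^sup>+\<xi>. ennreal (x $ None * ((norm (tang x - \<xi>))\<^sup>2 + (x $ None)\<^sup>2) powr (- p)) *
       (\<integral>\<^sup>+\<sigma>\<in>{y $ None..}. ennreal (\<sigma> * ((norm (\<xi> - tang y))\<^sup>2 + \<sigma>\<^sup>2) powr (- p)) \<partial>lborel) \<partial>lborel)"
    proof (intro nn_integral_cong)
      fix \<xi>
      have 1: "((norm (tang x - \<xi>))\<^sup>2 + (x $ None)\<^sup>2) powr (- p) = 1 / norm (x - bdry \<xi>) ^ n"
        unfolding p_def by (rule power2_powr_half[OF pos(3) norm_sub_bdry_sq[symmetric]])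
      have 2: "((norm (\<xi> - tang y))\<^sup>2 + (y $ None)\<^sup>2) powr (1 - p) = 1 / norm (bdry \<xi> - y) ^ (n - 2)"
        unfolding p1(3) by (rule power2_powr_half[OF pos(4) norm_bdry_sub_sq[symmetric]])
      have 3: "(\<integral>\<^sup>+\<sigma>\<in>{y $ None..}. ennreal (\<sigma> * ((norm (\<xi> - tang y))\<^sup>2 + \<sigma>\<^sup>2) powr (- p)) \<partial>lborel)
        = ennreal (1 / norm (bdry \<xi> - y) ^ (n - 2) / real (n - 2))"
        using nn_integral_radial_power[OF p1(1), of 0 "y $ None" "norm (\<xi> - tang y)", unfolded add_0 2 p1(2)] pos
        by simp
      show "ennreal (x $ None / real (n - 2)) * ennreal (?f \<xi>) =
        ennreal (x $ None * ((norm (tang x - \<xi>))\<^sup>2 + (x $ None)\<^sup>2) powr (- p)) *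
       (\<integral>\<^sup>+\<sigma>\<in>{y $ None..}. ennreal (\<sigma> * ((norm (\<xi> - tang y))\<^sup>2 + \<sigma>\<^sup>2) powr (- p)) \<partial>lborel)"
        unfolding 1 3 n_def[symmetric] using pos k by (simp add: ennreal_mult'[symmetric] mult_ac)
    qed
  qed (auto simp: n_def)
  also have "\<dots> = ennreal (pi powr p / Gamma p) * (\<integral>\<^sup>+\<sigma>\<in>{y $ None..}. ennreal ((x $ None + \<sigma>) *
      ((norm (tang x - tang y))\<^sup>2 + (x $ None + \<sigma>)\<^sup>2) powr (- p)) \<partial>lborel)"
    by (rule nn_integral_poisson_potential) (use pos p in auto)
  also have "\<dots> = ennreal (poisson_const TYPE('m)) * ennreal (1 / norm (x - refl_pt y) ^ (n - 2) / real (n - 2))"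
  proof -
    have "((norm (tang x - tang y))\<^sup>2 + (x $ None + y $ None)\<^sup>2) powr (1 - p) = 1 / norm (x - refl_pt y) ^ (n - 2)"
      unfolding p1(3) by (rule power2_powr_half[OF pos(5) norm_sub_refl_sq[symmetric]])
    moreover have "pi powr p / Gamma p = poisson_const TYPE('m)"
      by (simp add: poisson_const_def p_def n_def)
    ultimately show ?thesis
      using nn_integral_radial_power[OF p1(1), of "x $ None" "y $ None" "norm (tang x - tang y)", unfolded p1(2)] pos
      by simp
  qed
  finally have "ennreal (real (n - 2) / x $ None) * (ennreal (x $ None / real (n - 2)) * (\<integral>\<^sup>+\<xi>. ennreal (?f \<xi>) \<partial>lborel))
    = ennreal (real (n - 2) / x $ None) * ennreal (poisson_const TYPE('m) * (1 / norm (x - refl_pt y) ^ (n - 2) / real (n - 2)))"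
    using pos k poisson_const_pos[where 'm = 'm] by (simp add: ennreal_mult'[symmetric])
  also have "\<dots> = ennreal ?I"
    unfolding n_def[symmetric] using pos k poisson_const_pos[where 'm = 'm]
    by (simp add: ennreal_mult'[symmetric] field_simps)
  finally show "(\<integral>\<^sup>+\<xi>. ennreal (?f \<xi>) \<partial>lborel) = ennreal ?I"
    using pos k by (simp add: mult.assoc[symmetric] ennreal_mult'[symmetric])
  show "0 \<le> ?I" using pos poisson_const_pos[where 'm = 'm] by simp
qed (auto simp: less_imp_le)

section \<open>Differentiating the Poisson identities in x and in y\<close>

lemma integrable_poisson_bounded:
  fixes x :: "real ^ ('m::finite) option"
  assumes x: "x \<in> half_space" and [measurable]: "f \<in> borel_measurable borel" and B: "\<And>\<xi>. \<bar>f \<xi>\<bar> \<le> B"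
  shows "integrable lborel (\<lambda>\<xi>. 1 / norm (x - bdry \<xi>) ^ CARD('m option) * f \<xi>)"
    and "integrable lborel (\<lambda>\<xi>. (x - bdry \<xi>) $ i / norm (x - bdry \<xi>) ^ (CARD('m option) + 2) * f \<xi>)"
proof -
  note pos = half_space_pos[OF x] norm_sub_bdry_pos(1)[OF x]
  have int: "integrable lborel (\<lambda>\<xi>. B * (1 / norm (x - bdry \<xi>) ^ CARD('m option)))"
    by (intro integrable_mult_right integrable_poisson x)
  show "integrable lborel (\<lambda>\<xi>. 1 / norm (x - bdry \<xi>) ^ CARD('m option) * f \<xi>)"
  proof (rule Bochner_Integration.integrable_bound[OF int])
    show "AE \<xi> in lborel. norm (1 / norm (x - bdry \<xi>) ^ CARD('m option) * f \<xi>)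
        \<le> norm (B * (1 / norm (x - bdry \<xi>) ^ CARD('m option)))"
    proof (rule AE_I2)
      fix \<xi>
      show "norm (1 / norm (x - bdry \<xi>) ^ CARD('m option) * f \<xi>) \<le> norm (B * (1 / norm (x - bdry \<xi>) ^ CARD('m option)))"
        using B[of \<xi>] pos(2)[of \<xi>] by (simp add: abs_mult divide_right_mono)
    qed
  qed auto
  \<comment> \<open>One factor |x - \<xi>| of the denominator cancels the component in the
    numerator, and the other is at least x_n.\<close>
  have int: "integrable lborel (\<lambda>\<xi>. B / x $ None * (1 / norm (x - bdry \<xi>) ^ CARD('m option)))"
    by (intro integrable_mult_right integrable_poisson x)
  show "integrable lborel (\<lambda>\<xi>. (x - bdry \<xi>) $ i / norm (x - bdry \<xi>) ^ (CARD('m option) + 2) * f \<xi>)"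
  proof (rule Bochner_Integration.integrable_bound[OF int])
    show "AE \<xi> in lborel. norm ((x - bdry \<xi>) $ i / norm (x - bdry \<xi>) ^ (CARD('m option) + 2) * f \<xi>)
        \<le> norm (B / x $ None * (1 / norm (x - bdry \<xi>) ^ CARD('m option)))"
    proof (rule AE_I2)
      fix \<xi>
      define r where "r = norm (x - bdry \<xi>)"
      have r: "r > 0" "x $ None \<le> r" using pos(2) normal_le_norm(1)[of x] by (auto simp: r_def)
      have "norm ((x - bdry \<xi>) $ i / r ^ (CARD('m option) + 2) * f \<xi>) \<le> r / r ^ (CARD('m option) + 2) * B"
        unfolding real_norm_def abs_mult abs_divide using r B[of \<xi>] component_le_norm_cart[of "x - bdry \<xi>" i]
        by (intro mult_mono divide_mono) (auto simp: r_def)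
      also have "\<dots> = B / r * (1 / r ^ CARD('m option))" using r by (simp add: power_add power2_eq_square)
      also have "\<dots> \<le> B / x $ None * (1 / r ^ CARD('m option))"
        using r pos(1) B[of \<xi>] by (intro mult_right_mono divide_left_mono) auto
      also have "\<dots> \<le> norm \<dots>" by (simp only: real_norm_def abs_ge_self)
      finally show "norm ((x - bdry \<xi>) $ i / norm (x - bdry \<xi>) ^ (CARD('m option) + 2) * f \<xi>)
        \<le> norm (B / x $ None * (1 / norm (x - bdry \<xi>) ^ CARD('m option)))" by (simp add: r_def)
    qed
  qed auto
qed

text \<open>Since the i-th derivative of |x - \<xi>|^(-n) is - n (x - \<xi>)_i |x - \<xi>|^(-n-2), a
  known integral \<open>H\<close> against the Poisson kernel determines the integral against this
  kernel, which is \<open>odqvist_K i None\<close> up to the factor 2 x_n^2 / omega_n.\<close>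

lemma has_bochner_integral_deriv_poisson:
  fixes x :: "real ^ ('m::finite) option"
  assumes x: "x \<in> half_space" and [measurable]: "f \<in> borel_measurable borel" and B: "\<And>\<xi>. \<bar>f \<xi>\<bar> \<le> B"
    and H: "\<And>x'. x' \<in> half_space \<Longrightarrow> (LINT \<xi>|lborel. 1 / norm (x' - bdry \<xi>) ^ CARD('m option) * f \<xi>) = H x'"
    and D: "((\<lambda>h. H (x + h *\<^sub>R axis i 1)) has_real_derivative D) (at 0)"
  shows "has_bochner_integral lborel
    (\<lambda>\<xi>. (x - bdry \<xi>) $ i / norm (x - bdry \<xi>) ^ (CARD('m option) + 2) * f \<xi>) (- D / CARD('m option))"
proof -
  define n where "n = CARD('m option)"
  have n0: "n > 0" by (simp add: n_def)
  define e where "e = (axis i 1 :: real ^ 'm option)"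
  have e: "norm e = 1" "\<And>z. z \<bullet> e = z $ i" by (auto simp: e_def inner_axis)
  \<comment> \<open>Shifts below half the height keep |x - \<xi> + h e| at least |x - \<xi>| / 2,
    uniformly in \<xi>; the factor 2 ^ (n + 1) in the dominating function comes from this
    halving.\<close>
  define \<delta> where "\<delta> = x $ None / 2"
  have xn: "x $ None > 0" by (rule half_space_pos[OF x])
  then have \<delta>: "\<delta> > 0" by (simp add: \<delta>_def)
  have B0: "B \<ge> 0" using B[of 0] by (meson abs_ge_zero order_trans)
  have xh: "x + h *\<^sub>R e \<in> half_space" if "\<bar>h\<bar> < \<delta>" for h
  proof -
    have "\<bar>h * e $ None\<bar> \<le> \<bar>h\<bar>" using component_le_norm_cart[of e None] e(1)
      by (simp add: abs_mult mult_left_le)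
    then show ?thesis using that xn by (simp add: half_space_def \<delta>_def)
  qed
  define F where "F h \<xi> = 1 / norm (x - bdry \<xi> + h *\<^sub>R e) ^ n * f \<xi>" for h \<xi>
  define F' where "F' h \<xi> = - real n * ((x - bdry \<xi> + h *\<^sub>R e) \<bullet> e) / norm (x - bdry \<xi> + h *\<^sub>R e) ^ (n + 2) * f \<xi>" for h \<xi>
  have Feq: "F h \<xi> = 1 / norm (x + h *\<^sub>R e - bdry \<xi>) ^ n * f \<xi>" for h \<xi>
    by (simp add: F_def algebra_simps)
  have lower: "norm (x - bdry \<xi> + h *\<^sub>R e) \<ge> norm (x - bdry \<xi>) / 2" if "\<bar>h\<bar> < \<delta>" for h \<xi>
  proof -
    have "norm (x - bdry \<xi>) \<le> norm (x - bdry \<xi> + h *\<^sub>R e) + norm (h *\<^sub>R e)"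
      using norm_triangle_ineq4[of "x - bdry \<xi> + h *\<^sub>R e" "h *\<^sub>R e"] by simp
    moreover have "norm (h *\<^sub>R e) \<le> norm (x - bdry \<xi>) / 2"
      using that normal_le_norm(1)[of x \<xi>] by (simp add: e \<delta>_def)
    ultimately show ?thesis by linarith
  qed
  have "((\<lambda>h. LINT \<xi>|lborel. F h \<xi>) has_real_derivative (LINT \<xi>|lborel. F' 0 \<xi>)) (at 0)"
  proof (rule has_real_derivative_lebesgue_integral[OF \<delta>])
    show "integrable lborel (F h)" if "\<bar>h\<bar> < \<delta>" for h
      using integrable_poisson_bounded(1)[OF xh[OF that] assms(2) B] unfolding Feq n_def .
    show "((\<lambda>h. F h \<xi>) has_real_derivative F' h \<xi>) (at h)" if "\<bar>h\<bar> < \<delta>" for h \<xi>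
    proof -
      have "x - bdry \<xi> + h *\<^sub>R e \<noteq> 0" using lower[OF that, of \<xi>] norm_sub_bdry_pos(1)[OF x, of \<xi>] by auto
      then show ?thesis
        unfolding F_def F'_def by (intro DERIV_cmult_right has_real_derivative_inverse_norm_power)
    qed
    show "integrable lborel (\<lambda>\<xi>. real n * 2 ^ (n + 1) * B / x $ None * (1 / norm (x - bdry \<xi>) ^ n))"
      unfolding n_def by (intro integrable_mult_right integrable_poisson x)
    show "\<bar>F' h \<xi>\<bar> \<le> real n * 2 ^ (n + 1) * B / x $ None * (1 / norm (x - bdry \<xi>) ^ n)" if "\<bar>h\<bar> < \<delta>" for h \<xi>
    proof -
      define w where "w = x - bdry \<xi> + h *\<^sub>R e"
      define r where "r = norm (x - bdry \<xi>)"
      have r: "r > 0" "x $ None \<le> r" "r / 2 \<le> norm w" 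
        using norm_sub_bdry_pos(1)[OF x] normal_le_norm(1)[of x] lower[OF that] by (auto simp: r_def w_def)
      then have w: "norm w > 0" by linarith
      have "\<bar>F' h \<xi>\<bar> \<le> real n * norm w / norm w ^ (n + 2) * B"
        unfolding F'_def w_def[symmetric] abs_mult abs_divide e(2)
        using B[of \<xi>] component_le_norm_cart[of w i] w by (intro mult_mono divide_mono) auto
      also have "\<dots> = real n * B / norm w ^ (n + 1)" using w by (simp add: power_add power2_eq_square)
      also have "\<dots> \<le> real n * B / (r / 2) ^ (n + 1)"
        using r w B0 by (intro divide_left_mono power_mono mult_nonneg_nonneg) auto
      also have "\<dots> = real n * 2 ^ (n + 1) * B / r * (1 / r ^ n)"
        using r by (simp add: power_divide)
      also have "\<dots> \<le> real n * 2 ^ (n + 1) * B / x $ None * (1 / r ^ n)"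
        using r xn B0 by (intro mult_right_mono divide_left_mono) auto
      finally show ?thesis by (simp add: r_def)
    qed
    show "F' 0 \<in> borel_measurable lborel" unfolding F'_def [abs_def] e(2) by measurable
  qed
  moreover have "((\<lambda>h. LINT \<xi>|lborel. F h \<xi>) has_real_derivative D) (at 0)"
  proof (rule has_field_derivative_transform_within_open[where S = "{-\<delta><..<\<delta>}", OF D])
    show "H (x + h *\<^sub>R axis i 1) = (LINT \<xi>|lborel. F h \<xi>)" if "h \<in> {-\<delta><..<\<delta>}" for h
      using H[OF xh[of h]] that unfolding Feq by (auto simp: n_def e_def)
  qed (use \<delta> in auto)
  ultimately have "(LINT \<xi>|lborel. F' 0 \<xi>) = D" by (rule DERIV_unique)
  moreover have "F' 0 = (\<lambda>\<xi>. - real n * ((x - bdry \<xi>) $ i / norm (x - bdry \<xi>) ^ (n + 2) * f \<xi>))"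
    by (rule ext) (simp add: F'_def e(2))
  ultimately have "- real n * (LINT \<xi>|lborel. (x - bdry \<xi>) $ i / norm (x - bdry \<xi>) ^ (n + 2) * f \<xi>) = D"
    by (simp only: integral_mult_right_zero)
  then have "(LINT \<xi>|lborel. (x - bdry \<xi>) $ i / norm (x - bdry \<xi>) ^ (n + 2) * f \<xi>) = - D / n"
    using n0 by (auto simp: field_simps)
  then show ?thesis
    using integrable_poisson_bounded(2)[OF x assms(2) B, of i] by (simp add: has_bochner_integral_iff n_def)
qed

text \<open>The counterpart in the source point: the j-th derivative of |\<xi> - y|^(-q) in y is q
  (\<xi> - y)_j |\<xi> - y|^(-q-2). For small shifts the height stays above y_n / 2, so this factor
  is bounded and |k| dominates; as \<open>k\<close> is an arbitrary integrable weight, the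
  x-derivative can already have been taken.\<close>

lemma has_bochner_integral_deriv_source:
  fixes y :: "real ^ ('m::finite) option" and k :: "real ^ 'm \<Rightarrow> real"
  assumes y: "y \<in> half_space" and k: "integrable lborel k" and q: "q > 0"
    and H: "\<And>y'. y' \<in> half_space \<Longrightarrow> has_bochner_integral lborel (\<lambda>\<xi>. k \<xi> * (1 / norm (bdry \<xi> - y') ^ q)) (H y')"
    and D: "((\<lambda>h. H (y + h *\<^sub>R axis j 1)) has_real_derivative D) (at 0)"
  shows "has_bochner_integral lborel (\<lambda>\<xi>. k \<xi> * ((bdry \<xi> - y) $ j / norm (bdry \<xi> - y) ^ (q + 2))) (D / q)"
proof -
  define e where "e = (axis j 1 :: real ^ 'm option)"
  have e: "norm e = 1" "\<And>z. z \<bullet> e = z $ j" by (auto simp: e_def inner_axis)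
  define \<delta> where "\<delta> = y $ None / 2"
  have yn: "y $ None > 0" by (rule half_space_pos[OF y])
  then have \<delta>: "\<delta> > 0" by (simp add: \<delta>_def)
  have [measurable]: "k \<in> borel_measurable borel" using borel_measurable_integrable[OF k] by simp
  have yh: "(y + h *\<^sub>R e) $ None > \<delta>" if "\<bar>h\<bar> < \<delta>" for h
  proof -
    have "\<bar>h * e $ None\<bar> \<le> \<bar>h\<bar>" using component_le_norm_cart[of e None] e(1)
      by (simp add: abs_mult mult_left_le)
    then show ?thesis using that yn by (simp add: \<delta>_def)
  qed
  define F where "F h \<xi> = k \<xi> * (1 / norm (bdry \<xi> - y + h *\<^sub>R (- e)) ^ q)" for h \<xi>
  define F' where "F' h \<xi> = k \<xi> * (- real q * ((bdry \<xi> - y + h *\<^sub>R (- e)) \<bullet> (- e)) / norm (bdry \<xi> - y + h *\<^sub>R (- e)) ^ (q + 2))" for h \<xi>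
  have Feq: "F h \<xi> = k \<xi> * (1 / norm (bdry \<xi> - (y + h *\<^sub>R e)) ^ q)" for h \<xi>
    by (simp add: F_def algebra_simps)
  have lower: "norm (bdry \<xi> - y + h *\<^sub>R (- e)) > \<delta>" if "\<bar>h\<bar> < \<delta>" for h \<xi>
    using yh[OF that] normal_le_norm(2)[of "y + h *\<^sub>R e" \<xi>] by (simp add: algebra_simps)
  have int: "integrable lborel (F h)" if "\<bar>h\<bar> < \<delta>" for h
    unfolding Feq using H[of "y + h *\<^sub>R e"] yh[OF that] \<delta> by (auto simp: half_space_def has_bochner_integral_iff)
  have F'_bound: "\<bar>F' h \<xi>\<bar> \<le> \<bar>k \<xi>\<bar> * (real q / \<delta> ^ (q + 1))" if "\<bar>h\<bar> < \<delta>" for h \<xi>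
  proof -
    define w where "w = bdry \<xi> - y + h *\<^sub>R (- e)"
    have w: "norm w > \<delta>" "norm w > 0" using lower[OF that, of \<xi>] \<delta> by (auto simp: w_def)
    have "\<bar>F' h \<xi>\<bar> \<le> \<bar>k \<xi>\<bar> * (real q * norm w / norm w ^ (q + 2))"
      unfolding F'_def w_def[symmetric] abs_mult abs_divide inner_minus_right e(2)
      using component_le_norm_cart[of w j] w by (intro mult_mono divide_mono) auto
    also have "real q * norm w / norm w ^ (q + 2) = real q / norm w ^ (q + 1)"
      using w by (simp add: power_add power2_eq_square)
    also have "\<bar>k \<xi>\<bar> * (real q / norm w ^ (q + 1)) \<le> \<bar>k \<xi>\<bar> * (real q / \<delta> ^ (q + 1))"
      using w \<delta> by (intro mult_left_mono divide_left_mono power_mono) auto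
    finally show ?thesis .
  qed
  have meas: "F' 0 \<in> borel_measurable lborel" unfolding F'_def [abs_def] inner_minus_right e(2) by measurable
  have "((\<lambda>h. LINT \<xi>|lborel. F h \<xi>) has_real_derivative (LINT \<xi>|lborel. F' 0 \<xi>)) (at 0)"
  proof (rule has_real_derivative_lebesgue_integral[OF \<delta>])
    show "((\<lambda>h. F h \<xi>) has_real_derivative F' h \<xi>) (at h)" if "\<bar>h\<bar> < \<delta>" for h \<xi>
    proof -
      have "bdry \<xi> - y + h *\<^sub>R (- e) \<noteq> 0" using lower[OF that, of \<xi>] \<delta> by auto
      then show ?thesis
        unfolding F_def F'_def by (intro DERIV_cmult has_real_derivative_inverse_norm_power)
    qed
    show "integrable lborel (\<lambda>\<xi>. \<bar>k \<xi>\<bar> * (real q / \<delta> ^ (q + 1)))" using k by simp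
  qed (use int F'_bound meas in auto)
  moreover have "((\<lambda>h. LINT \<xi>|lborel. F h \<xi>) has_real_derivative D) (at 0)"
  proof (rule has_field_derivative_transform_within_open[where S = "{-\<delta><..<\<delta>}", OF D])
    show "H (y + h *\<^sub>R axis j 1) = (LINT \<xi>|lborel. F h \<xi>)" if "h \<in> {-\<delta><..<\<delta>}" for h
    proof -
      have "y + h *\<^sub>R e \<in> half_space" using order_less_trans[OF \<delta> yh[of h]] that by (auto simp: half_space_def)
      from H[OF this] show ?thesis unfolding Feq e_def by (simp only: has_bochner_integral_iff)
    qed
  qed (use \<delta> in auto)
  ultimately have "(LINT \<xi>|lborel. F' 0 \<xi>) = D" by (rule DERIV_unique)
  moreover have "integrable lborel (F' 0)"
    by (rule Bochner_Integration.integrable_bound[OF _ meas, of "\<lambda>\<xi>. \<bar>k \<xi>\<bar> * (real q / \<delta> ^ (q + 1))"])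
      (use k F'_bound[of 0] \<delta> in \<open>auto intro: order_trans[OF _ abs_ge_self]\<close>)
  ultimately have "has_bochner_integral lborel (F' 0) D" by (simp add: has_bochner_integral_iff)
  then have "has_bochner_integral lborel (\<lambda>\<xi>. F' 0 \<xi> / q) (D / q)" by (rule has_bochner_integral_divide_zero)
  moreover have "F' 0 \<xi> / q = k \<xi> * ((bdry \<xi> - y) $ j / norm (bdry \<xi> - y) ^ (q + 2))" for \<xi>
  proof -
    have "F' 0 \<xi> = k \<xi> * (real q * (bdry \<xi> - y) $ j / norm (bdry \<xi> - y) ^ (q + 2))"
      unfolding F'_def inner_minus_right e(2) by (simp only: scaleR_zero_left add_0_right minus_mult_minus)
    then show ?thesis using q by (simp only: times_divide_eq_right) simp
  qed
  ultimately show ?thesis by (simp only:)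
qed

lemma axis_component: "(axis i 1 :: real ^ 'n::finite) $ k = of_bool (k = i)"
  by (simp add: axis_def)

text \<open>The case f = 1: the integral c / x_n depends on the height alone, so only the normal
  derivative survives. It provides the integrability of the differentiated kernel and, for n = 2,
  the mass of \<open>odqvist_K i None\<close>.\<close>

lemma has_bochner_integral_deriv_poisson_1:
  fixes x :: "real ^ ('m::finite) option"
  assumes x: "x \<in> half_space"
  shows "has_bochner_integral lborel
    (\<lambda>\<xi>. (x - bdry \<xi>) $ i / norm (x - bdry \<xi>) ^ (CARD('m option) + 2))
    (poisson_const TYPE('m) / CARD('m option) * of_bool (i = None) / (x $ None)\<^sup>2)"
proof -
  define c where "c = poisson_const TYPE('m)"
  have xn: "x $ None \<noteq> 0" using half_space_pos[OF x] by simp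
  have "has_bochner_integral lborel
    (\<lambda>\<xi>. (x - bdry \<xi>) $ i / norm (x - bdry \<xi>) ^ (CARD('m option) + 2) * 1)
    (- (- (c * of_bool (i = None) / (x $ None)\<^sup>2)) / CARD('m option))"
  proof (rule has_bochner_integral_deriv_poisson[OF x, where H = "\<lambda>x. c / x $ None" and B = 1])
    show "(LINT \<xi>|lborel. 1 / norm (x' - bdry \<xi>) ^ CARD('m option) * 1) = c / x' $ None" if "x' \<in> half_space" 
      for x' :: "real ^ 'm option"
      using has_bochner_integral_poisson[OF that] by (simp only: mult_1_right has_bochner_integral_iff c_def)
    show "((\<lambda>h. c / (x + h *\<^sub>R axis i 1) $ None) has_real_derivative - (c * of_bool (i = None) / (x $ None)\<^sup>2)) (at 0)"
      using xn by (auto intro!: derivative_eq_intros simp: axis_component power2_eq_square)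
  qed auto
  moreover have "- (- (c * of_bool (i = None) / (x $ None)\<^sup>2)) / CARD('m option)
      = poisson_const TYPE('m) / CARD('m option) * of_bool (i = None) / (x $ None)\<^sup>2"
    by (simp add: c_def)
  ultimately show ?thesis by (simp only: mult_1_right)
qed

lemma has_bochner_integral_deriv_poisson_potential:
  fixes x y :: "real ^ ('m::finite) option"
  assumes x: "x \<in> half_space" and y: "y \<in> half_space" and n: "n = CARD('m option)" "n \<ge> 3"
  shows "has_bochner_integral lborel
    (\<lambda>\<xi>. (x - bdry \<xi>) $ i / norm (x - bdry \<xi>) ^ (n + 2) * (1 / norm (bdry \<xi> - y) ^ (n - 2)))
    (poisson_const TYPE('m) / n * (real (n - 2) * (x - refl_pt y) $ i / (x $ None * norm (x - refl_pt y) ^ n)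
       + of_bool (i = None) / ((x $ None)\<^sup>2 * norm (x - refl_pt y) ^ (n - 2))))"
    (is "has_bochner_integral _ _ ?I")
proof -
  define c where "c = poisson_const TYPE('m)"
  define R where "R = x - refl_pt y"
  have xn: "x $ None > 0" and yn: "y $ None > 0" using half_space_pos x y by auto
  have R: "R \<noteq> 0" using norm_sub_refl_pos[OF x y] by (auto simp: R_def)
  have n2: "n - 2 + 2 = n" using n by simp
  \<comment> \<open>Product rule for |R|^(2-n) times 1 / x_n; the second term is present only in the
    normal direction.\<close>
  define D where "D = c * (- (real (n - 2) * R $ i / norm R ^ n) * (1 / x $ None)
     + - (of_bool (i = None) / (x $ None)\<^sup>2) * (1 / norm R ^ (n - 2)))"
  have "has_bochner_integral lborel
    (\<lambda>\<xi>. (x - bdry \<xi>) $ i / norm (x - bdry \<xi>) ^ (CARD('m option) + 2) * (1 / norm (bdry \<xi> - y) ^ (n - 2)))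
    (- D / CARD('m option))"
  proof (rule has_bochner_integral_deriv_poisson[OF x])
    show "(LINT \<xi>|lborel. 1 / norm (x' - bdry \<xi>) ^ CARD('m option) * (1 / norm (bdry \<xi> - y) ^ (n - 2)))
      = c * (1 / norm (x' - refl_pt y) ^ (n - 2) * (1 / x' $ None))" if "x' \<in> half_space" for x'
      using has_bochner_integral_poisson_potential[OF that y] n
      by (simp add: has_bochner_integral_iff c_def mult.commute)
    have A: "((\<lambda>h. 1 / norm (R + h *\<^sub>R axis i 1) ^ (n - 2)) has_real_derivative - (real (n - 2) * R $ i / norm R ^ n)) (at 0)"
      using has_real_derivative_inverse_norm_power[of R 0 "axis i 1" "n - 2", unfolded n2] R by (simp add: inner_axis)
    have B: "((\<lambda>h. 1 / (x + h *\<^sub>R axis i 1) $ None) has_real_derivative - (of_bool (i = None) / (x $ None)\<^sup>2)) (at 0)"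
      using xn by (auto intro!: derivative_eq_intros simp: axis_component power2_eq_square)
    have "((\<lambda>h. c * (1 / norm (R + h *\<^sub>R axis i 1) ^ (n - 2) * (1 / (x + h *\<^sub>R axis i 1) $ None))) has_real_derivative D) (at 0)"
      unfolding D_def by (rule DERIV_cong[OF DERIV_cmult[OF DERIV_mult[OF A B]]]) simp
    moreover have "x + h *\<^sub>R axis i 1 - refl_pt y = R + h *\<^sub>R axis i 1" for h by (simp add: R_def)
    ultimately show "((\<lambda>h. c * (1 / norm (x + h *\<^sub>R axis i 1 - refl_pt y) ^ (n - 2) * (1 / (x + h *\<^sub>R axis i 1) $ None))) has_real_derivative D) (at 0)"
      by (simp only:)
    show "\<bar>1 / norm (bdry \<xi> - y) ^ (n - 2)\<bar> \<le> 1 / (y $ None) ^ (n - 2)" for \<xi>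
    proof -
      have "(y $ None) ^ (n - 2) \<le> norm (bdry \<xi> - y) ^ (n - 2)"
        using normal_le_norm(2)[of y \<xi>] yn by (intro power_mono) auto
      then show ?thesis using yn by (simp add: frac_le)
    qed
  qed auto
  moreover have "- D / n = ?I"
    using xn R by (simp add: D_def R_def[symmetric] c_def[symmetric] algebra_simps add_divide_distrib)
  ultimately show ?thesis by (simp only: n(1)[symmetric])
qed

lemma has_bochner_integral_deriv_poisson_deriv_potential:
  fixes x y :: "real ^ ('m::finite) option"
  assumes x: "x \<in> half_space" and y: "y \<in> half_space" and n: "n = CARD('m option)" "n \<ge> 3"
  defines "R \<equiv> x - refl_pt y"
  shows "has_bochner_integral lborel
    (\<lambda>\<xi>. (x - bdry \<xi>) $ i / norm (x - bdry \<xi>) ^ (n + 2) * ((bdry \<xi> - y) $ j / norm (bdry \<xi> - y) ^ n))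
    (poisson_const TYPE('m) / n * eps_sign j * (n * R $ i * R $ j / (x $ None * norm R ^ (n + 2))
       - of_bool (i = j) / (x $ None * norm R ^ n)
       + of_bool (i = None) * R $ j / ((x $ None)\<^sup>2 * norm R ^ n)))"
    (is "has_bochner_integral _ _ ?I")
proof -
  define c where "c = poisson_const TYPE('m) / n"
  have xn: "x $ None > 0" and yn: "y $ None > 0" using half_space_pos x y by auto
  have R: "R \<noteq> 0" using norm_sub_refl_pos[OF x y] by (auto simp: R_def)
  have n2: "n - 2 + 2 = n" "real (n - 2) > 0" using n by auto
  \<comment> \<open>Moving y along e_j moves R along - \<open>eps_sign j\<close> e_j, since the
    reflection reverses the normal direction.\<close>
  define v :: "real ^ 'm option" where "v = (- eps_sign j) *\<^sub>R axis j 1"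
  have v: "z \<bullet> v = - eps_sign j * z $ j" for z by (simp add: v_def inner_axis)
  have vi: "v $ i = - eps_sign j * of_bool (i = j)" by (simp add: v_def axis_component)
  have Rv: "x - refl_pt (y + h *\<^sub>R axis j 1) = R + h *\<^sub>R v" for h
    by (cases j) (auto simp: vec_eq_iff R_def v_def refl_pt_def eps_sign_def axis_component)
  define H where "H y = c * (real (n - 2) / x $ None * ((x - refl_pt y) $ i * (1 / norm (x - refl_pt y) ^ n))
       + of_bool (i = None) / (x $ None)\<^sup>2 * (1 / norm (x - refl_pt y) ^ (n - 2)))" for y
  define D where "D = c * (real (n - 2) / x $ None * (v $ i * (1 / norm R ^ n) + - (real n * (R \<bullet> v) / norm R ^ (n + 2)) * R $ i)
     + of_bool (i = None) / (x $ None)\<^sup>2 * - (real (n - 2) * (R \<bullet> v) / norm R ^ n))"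
  have "has_bochner_integral lborel
    (\<lambda>\<xi>. (x - bdry \<xi>) $ i / norm (x - bdry \<xi>) ^ (n + 2) * ((bdry \<xi> - y) $ j / norm (bdry \<xi> - y) ^ ((n - 2) + 2)))
    (D / real (n - 2))"
  proof (rule has_bochner_integral_deriv_source[OF y])
    show "integrable lborel (\<lambda>\<xi>. (x - bdry \<xi>) $ i / norm (x - bdry \<xi>) ^ (n + 2))"
      using has_bochner_integral_deriv_poisson_1[OF x, of i] n(1) by (simp only: has_bochner_integral_iff)
    show "has_bochner_integral lborel (\<lambda>\<xi>. (x - bdry \<xi>) $ i / norm (x - bdry \<xi>) ^ (n + 2) * (1 / norm (bdry \<xi> - y') ^ (n - 2))) (H y')"
      if "y' \<in> half_space" for y'
      using has_bochner_integral_deriv_poisson_potential[OF x that n, of i] by (simp add: H_def c_def)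
    have A: "((\<lambda>h. 1 / norm (R + h *\<^sub>R v) ^ (n - 2)) has_real_derivative - (real (n - 2) * (R \<bullet> v) / norm R ^ n)) (at 0)"
      using has_real_derivative_inverse_norm_power[of R 0 v "n - 2", unfolded n2] R by simp
    have A': "((\<lambda>h. 1 / norm (R + h *\<^sub>R v) ^ n) has_real_derivative - (real n * (R \<bullet> v) / norm R ^ (n + 2))) (at 0)"
      using has_real_derivative_inverse_norm_power[of R 0 v n] R by simp
    have B: "((\<lambda>h. (R + h *\<^sub>R v) $ i) has_real_derivative v $ i) (at 0)"
      by (auto intro!: derivative_eq_intros)
    have "((\<lambda>h. c * (real (n - 2) / x $ None * ((R + h *\<^sub>R v) $ i * (1 / norm (R + h *\<^sub>R v) ^ n))
       + of_bool (i = None) / (x $ None)\<^sup>2 * (1 / norm (R + h *\<^sub>R v) ^ (n - 2)))) has_real_derivative D) (at 0)"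
      unfolding D_def
      by (rule DERIV_cong[OF DERIV_cmult[OF DERIV_add[OF DERIV_cmult[OF DERIV_mult[OF B A']] DERIV_cmult[OF A]]]]) simp
    then show "((\<lambda>h. H (y + h *\<^sub>R axis j 1)) has_real_derivative D) (at 0)"
      unfolding H_def Rv .
  qed (use n in auto)
  moreover have "D / real (n - 2) = ?I"
  proof -
    have "c * (d / X * (V * N + W * r) + o' / Y * - (d * Q / M)) / d = c * ((V * N + W * r) / X - o' * Q / (Y * M))" 
      if "d \<noteq> 0" for V N W r o' X Y Q M d :: real
      using that by (simp add: divide_simps) (simp add: algebra_simps)
    note 1 = this[OF n2(2)[THEN less_imp_neq, symmetric]]
    have 2: "c * ((- e * d * (1 / N) + - (real n * (- e * q) / M) * r) / X - o' * (- e * q) / (Y * N))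
      = c * e * (real n * r * q / (X * M) - d / (X * N) + o' * q / (Y * N))" for e d N q M r X o' Y :: real
      by (simp add: algebra_simps add_divide_distrib diff_divide_distrib)
    show ?thesis unfolding D_def 1 v vi c_def[symmetric] by (rule 2)
  qed
  ultimately show ?thesis by (simp only: n2)
qed

section \<open>The explicit Green tensor in dimension at least three\<close>

lemma inverse_power_diff_bound:
  fixes a b :: real
  assumes "0 < a" "a \<le> b"
  shows "0 \<le> 1 / a ^ k - 1 / b ^ k" "1 / a ^ k - 1 / b ^ k \<le> k * (b\<^sup>2 - a\<^sup>2) / (a ^ k * b\<^sup>2)"
proof -
  \<comment> \<open>Scaling by b reduces the claim to 1 - q^k <= k (1 - q) <= k (1 - q^2) on (0, 1]:
    Bernoulli's inequality, then q^2 <= q.\<close>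
  define q where "q = a / b"
  have q: "0 < q" "q \<le> 1" and b: "b > 0" using assms by (auto simp: q_def)
  have a: "a = q * b" using b by (simp add: q_def)
  show "0 \<le> 1 / a ^ k - 1 / b ^ k" using assms power_mono[of a b k] by (simp add: frac_le)
  have "1 - q ^ k \<le> k * (1 - q)" using Bernoulli_inequality[of "q - 1" k] q by (simp add: algebra_simps)
  also have "\<dots> \<le> k * (1 - q\<^sup>2)" using q by (intro mult_left_mono) (auto simp: power2_eq_square mult_left_le)
  finally have "(1 - q ^ k) / (q ^ k * b ^ k) \<le> k * (1 - q\<^sup>2) / (q ^ k * b ^ k)"
    using q b by (intro divide_right_mono) auto
  moreover have "1 / a ^ k - 1 / b ^ k = (1 - q ^ k) / (q ^ k * b ^ k)"
    using q b by (simp add: a power_mult_distrib field_simps)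
  moreover have "k * (b\<^sup>2 - a\<^sup>2) / (a ^ k * b\<^sup>2) = k * (1 - q\<^sup>2) / (q ^ k * b ^ k)"
    using q b by (simp add: a power_mult_distrib field_simps)
  ultimately show "1 / a ^ k - 1 / b ^ k \<le> k * (b\<^sup>2 - a\<^sup>2) / (a ^ k * b\<^sup>2)" by simp
qed

text \<open>A counterpart from above to Bernoulli's inequality: the remainders satisfy e_(k+1) = p
  e_k + k (p - 1)^2, and p <= 2 makes each step cost at most a factor 2.\<close>

lemma power_second_order:
  fixes p :: real
  assumes "1 \<le> p" "p \<le> 2"
  shows "p ^ k - 1 - k * (p - 1) \<le> (real k)\<^sup>2 * 2 ^ k * (p - 1)\<^sup>2"
proof (induction k)
  case (Suc k)
  have "p ^ Suc k - 1 - Suc k * (p - 1) = p * (p ^ k - 1 - k * (p - 1)) + k * (p - 1)\<^sup>2"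
    by (simp add: algebra_simps power2_eq_square)
  also have "\<dots> \<le> 2 * ((real k)\<^sup>2 * 2 ^ k * (p - 1)\<^sup>2) + 2 ^ Suc k * (k * (p - 1)\<^sup>2)"
  proof (rule add_mono)
    have "p * (p ^ k - 1 - k * (p - 1)) \<le> p * ((real k)\<^sup>2 * 2 ^ k * (p - 1)\<^sup>2)"
      using assms Suc.IH by (intro mult_left_mono) auto
    also have "\<dots> \<le> 2 * ((real k)\<^sup>2 * 2 ^ k * (p - 1)\<^sup>2)"
      using assms by (intro mult_right_mono) auto
    finally show "p * (p ^ k - 1 - k * (p - 1)) \<le> 2 * ((real k)\<^sup>2 * 2 ^ k * (p - 1)\<^sup>2)" .
    have "1 * (k * (p - 1)\<^sup>2) \<le> 2 ^ Suc k * (k * (p - 1)\<^sup>2)"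
      by (intro mult_right_mono) (auto intro: one_le_power simp del: power_Suc)
    then show "k * (p - 1)\<^sup>2 \<le> 2 ^ Suc k * (k * (p - 1)\<^sup>2)" by simp
  qed
  also have "\<dots> = ((real k)\<^sup>2 + k) * 2 ^ Suc k * (p - 1)\<^sup>2" by (simp add: algebra_simps)
  also have "\<dots> \<le> (real (Suc k))\<^sup>2 * 2 ^ Suc k * (p - 1)\<^sup>2"
  proof (intro mult_right_mono)
    show "(real k)\<^sup>2 + k \<le> (real (Suc k))\<^sup>2" by (simp add: power2_eq_square algebra_simps)
  qed auto
  finally show ?case .
qed simp

text \<open>An expansion in d = (b^2 - a^2) / b^2, because b^2 - a^2 is known exactly when a = |x -
  y| and b = |R|. With p = b / a the difference is (p^k - 1) / b^k; the condition p <= 2 bounds the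
  remainder of p^k and gives p - 1 <= 2 d.\<close>

lemma inverse_power_second_order:
  fixes a b :: real
  assumes "0 < a" "a \<le> b" "b \<le> 2 * a"
  shows "\<bar>1 / a ^ k - 1 / b ^ k - k / 2 * (b\<^sup>2 - a\<^sup>2) / b ^ (k + 2)\<bar>
     \<le> (4 * (real k)\<^sup>2 * 2 ^ k + 6 * k) * (b\<^sup>2 - a\<^sup>2)\<^sup>2 / b ^ (k + 4)"
proof -
  define p where "p = b / a"
  have p: "1 \<le> p" "p \<le> 2" and b: "b > 0" using assms by (auto simp: p_def field_simps)
  have a: "b = p * a" using assms by (simp add: p_def)
  define d where "d = 1 - 1 / p\<^sup>2"
  have bd: "b\<^sup>2 - a\<^sup>2 = d * b\<^sup>2" using assms p by (simp add: d_def a field_simps power2_eq_square)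
  define T where "T = p ^ k - 1 - k / 2 * d"
  \<comment> \<open>The second summand is the discrepancy k (p - 1) - (k / 2) d of the linear terms,
    itself quadratic in p - 1.\<close>
  have T: "T = (p ^ k - 1 - k * (p - 1)) + k * ((p - 1)\<^sup>2 * ((2 * p + 1) / (2 * p\<^sup>2)))"
    using p by (simp add: T_def d_def field_simps power2_eq_square)
  have "(2 * p + 1) / (2 * p\<^sup>2) \<le> 3 / 2"
  proof -
    have "p \<le> p\<^sup>2" "1 \<le> p\<^sup>2" using p by (auto simp: power2_eq_square mult_le_cancel_left1 intro: order_trans)
    then show ?thesis using p by (simp add: divide_simps)
  qed
  then have 2: "k * ((p - 1)\<^sup>2 * ((2 * p + 1) / (2 * p\<^sup>2))) \<le> k * ((p - 1)\<^sup>2 * (3 / 2))"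
    by (intro mult_left_mono) auto
  have "0 \<le> T"
  proof -
    have "0 \<le> p ^ k - 1 - k * (p - 1)" using Bernoulli_inequality[of "p - 1" k] p by simp
    moreover have "0 \<le> k * ((p - 1)\<^sup>2 * ((2 * p + 1) / (2 * p\<^sup>2)))" using p by simp
    ultimately show ?thesis unfolding T by linarith
  qed
  have "T \<le> (real k)\<^sup>2 * 2 ^ k * (p - 1)\<^sup>2 + k * ((p - 1)\<^sup>2 * (3 / 2))"
    unfolding T by (rule add_mono[OF power_second_order[OF p] 2])
  also have "\<dots> = ((real k)\<^sup>2 * 2 ^ k + 3 / 2 * k) * (p - 1)\<^sup>2" by (simp add: algebra_simps)
  finally have T_le: "T \<le> ((real k)\<^sup>2 * 2 ^ k + 3 / 2 * k) * (p - 1)\<^sup>2" .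
  have d_le: "(p - 1)\<^sup>2 \<le> (2 * d)\<^sup>2"
  proof (rule power_mono)
    have "p ^ 3 - p\<^sup>2 \<le> 2 * (p\<^sup>2 - 1)"
    proof -
      have "0 \<le> (p - 1) * (2 * (p + 1) - p\<^sup>2)"
      proof (rule mult_nonneg_nonneg)
        have "p\<^sup>2 \<le> 2\<^sup>2" using p by (intro power_mono) auto
        then show "0 \<le> 2 * (p + 1) - p\<^sup>2" using p by simp
      qed (use p in auto)
      then show ?thesis by (simp add: algebra_simps power2_eq_square power3_eq_cube)
    qed
    then show "p - 1 \<le> 2 * d" using p by (simp add: d_def field_simps power2_eq_square power3_eq_cube)
  qed (use p in auto)
  have "T \<le> ((real k)\<^sup>2 * 2 ^ k + 3 / 2 * k) * (2 * d)\<^sup>2"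
    by (rule order_trans[OF T_le mult_left_mono[OF d_le]]) simp
  also have "\<dots> = (4 * (real k)\<^sup>2 * 2 ^ k + 6 * k) * d\<^sup>2"
    by (simp add: power_mult_distrib algebra_simps)
  finally have "T \<le> (4 * (real k)\<^sup>2 * 2 ^ k + 6 * k) * d\<^sup>2" .
  then have "\<bar>T / b ^ k\<bar> \<le> (4 * (real k)\<^sup>2 * 2 ^ k + 6 * k) * d\<^sup>2 / b ^ k"
    using \<open>0 \<le> T\<close> b by (simp add: divide_right_mono)
  moreover have "1 / a ^ k - 1 / b ^ k - k / 2 * (b\<^sup>2 - a\<^sup>2) / b ^ (k + 2) = T / b ^ k"
  proof -
    have "1 / a ^ k = p ^ k / b ^ k" using assms p by (simp add: a power_mult_distrib)
    then show ?thesis unfolding bd T_def using b by (simp add: field_simps power_add power2_eq_square)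
  qed
  moreover have "(4 * (real k)\<^sup>2 * 2 ^ k + 6 * k) * (b\<^sup>2 - a\<^sup>2)\<^sup>2 / b ^ (k + 4)
      = (4 * (real k)\<^sup>2 * 2 ^ k + 6 * k) * d\<^sup>2 / b ^ k"
    unfolding bd using b by (simp add: power_add power_mult_distrib)
  ultimately show ?thesis by simp
qed

section \<open>The closed form of the Green tensor\<close>

lemma norm_sub_refl_minus_sub_sq:
  "(norm (x - refl_pt y))\<^sup>2 - (norm (x - y))\<^sup>2 = 4 * (x $ None * y $ None)"
  unfolding norm_sub_refl_sq norm_option_sq[of "x - y"] by (simp add: power2_eq_square algebra_simps)

text \<open>In this form both parts of the Lorentz tensor share the factor 1 / (2 n omega_n), called
  \<open>\<kappa>\<close> below.\<close>

lemma fund_E_ge_3: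
  assumes "CARD('n::finite) \<ge> 3"
  shows "fund_E (z :: real ^ 'n) = 2 * (1 / (2 * real CARD('n) * unit_ball_vol (real CARD('n)))) / real (CARD('n) - 2) / norm z ^ (CARD('n) - 2)"
proof -
  have "norm z powi (2 - int CARD('n)) = 1 / norm z ^ (CARD('n) - 2)"
  proof -
    have "2 - int CARD('n) = - int (CARD('n) - 2)" using assms by (simp add: of_nat_diff)
    then show ?thesis by (simp only: power_int_minus power_int_of_nat inverse_eq_divide)
  qed
  then show ?thesis using assms by (simp add: fund_E_def Let_def of_nat_diff mult_ac)
qed

lemma green_G_explicit:
  fixes x y :: "real ^ ('m::finite) option"
  assumes x: "x \<in> half_space" and y: "y \<in> half_space" and n: "n = CARD('m option)" "n \<ge> 3"
  defines "z \<equiv> x - y" and "R \<equiv> x - refl_pt y" and "\<kappa> \<equiv> 1 / (2 * real n * unit_ball_vol (real n))"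
  shows "green_G i j x y = \<kappa> * (
      of_bool (i = j) * (1 / norm z ^ (n - 2) - eps_sign j / norm R ^ (n - 2)) / real (n - 2)
    + z $ i * z $ j / norm z ^ n - eps_sign j * (R $ i * R $ j / norm R ^ n)
    - 2 * (of_bool (j = None) * (x $ None * R $ i / norm R ^ n + of_bool (i = None) / (real (n - 2) * norm R ^ (n - 2)))
      - eps_sign j * (x $ None * y $ None) * (real n * R $ i * R $ j / norm R ^ (n + 2) - of_bool (i = j) / norm R ^ n)
      - eps_sign j * y $ None * of_bool (i = None) * R $ j / norm R ^ n))"
proof -
  define \<omega> where "\<omega> = unit_ball_vol (real n)"
  have \<omega>: "\<omega> > 0" unfolding \<omega>_def by (rule unit_ball_vol_pos) simp
  have xn: "x $ None > 0" and yn: "y $ None > 0" using half_space_pos x y by auto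
  have n0: "real n > 0" "real (n - 2) > 0" using n by auto
  have U: "lorentz_U k l w = \<kappa> * (of_bool (k = l) / real (n - 2) / norm w ^ (n - 2) + w $ k * w $ l / norm w ^ n)"
    for k l and w :: "real ^ 'm option"
    using n unfolding lorentz_U_def fund_E_ge_3[OF n(2)[unfolded n(1)]] \<kappa>_def n(1)[symmetric] Let_def
    by (simp add: algebra_simps)
  \<comment> \<open>On the boundary (x - \<xi>)_n = x_n and (\<xi> - y)_n = - y_n, so the product
    splits into the two integrands evaluated in \<open>J\<close> and \<open>M\<close>.\<close>
  have KU: "odqvist_K i None (x - bdry \<xi>) * lorentz_U None j (bdry \<xi> - y)
     = 2 * (x $ None)\<^sup>2 / \<omega> * \<kappa> * (
       of_bool (j = None) / real (n - 2) * ((x - bdry \<xi>) $ i / norm (x - bdry \<xi>) ^ (n + 2) * (1 / norm (bdry \<xi> - y) ^ (n - 2)))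
       - y $ None * ((x - bdry \<xi>) $ i / norm (x - bdry \<xi>) ^ (n + 2) * ((bdry \<xi> - y) $ j / norm (bdry \<xi> - y) ^ n)))" for \<xi>
  proof -
    have "2 * X * a * X / (\<omega> * N) * (\<kappa> * (b / k / P + - Y * s / M))
      = 2 * X\<^sup>2 / \<omega> * \<kappa> * (b / k * (a / N * (1 / P)) - Y * (a / N * (s / M)))" for X a N b k P Y s M :: real
      by (simp add: divide_inverse algebra_simps power2_eq_square)
    moreover have "(x - bdry \<xi>) $ None = x $ None" "(bdry \<xi> - y) $ None = - y $ None" "(None = j) = (j = None)" by auto
    ultimately show ?thesis
      unfolding U odqvist_K_def Let_def n(1)[symmetric] \<omega>_def[symmetric] by (simp only:)
  qed
  note J = has_bochner_integral_deriv_poisson_potential[OF x y n, of i, folded R_def]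
  note M = has_bochner_integral_deriv_poisson_deriv_potential[OF x y n, of i j, folded R_def]
  have pc: "poisson_const TYPE('m) / n = \<omega> / 2"
    unfolding poisson_const_eq n(1)[symmetric] \<omega>_def using n0 by simp
  have "(LINT \<xi>|lborel. odqvist_K i None (x - bdry \<xi>) * lorentz_U None j (bdry \<xi> - y))
    = 2 * (x $ None)\<^sup>2 / \<omega> * \<kappa> * (
       of_bool (j = None) / real (n - 2) * (\<omega> / 2 * (real (n - 2) * R $ i / (x $ None * norm R ^ n)
       + of_bool (i = None) / ((x $ None)\<^sup>2 * norm R ^ (n - 2))))
       - y $ None * (\<omega> / 2 * eps_sign j * (n * R $ i * R $ j / (x $ None * norm R ^ (n + 2))
       - of_bool (i = j) / (x $ None * norm R ^ n)
       + of_bool (i = None) * R $ j / ((x $ None)\<^sup>2 * norm R ^ n))))"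
    unfolding KU
    by (rule has_bochner_integral_integral_eq)
      (intro has_bochner_integral_mult_right has_bochner_integral_diff J[unfolded pc] M[unfolded pc])
  also have "\<dots> = \<kappa> * (of_bool (j = None) * (x $ None * R $ i / norm R ^ n + of_bool (i = None) / (real (n - 2) * norm R ^ (n - 2)))
      - eps_sign j * (x $ None * y $ None) * (real n * R $ i * R $ j / norm R ^ (n + 2) - of_bool (i = j) / norm R ^ n)
      - eps_sign j * y $ None * of_bool (i = None) * R $ j / norm R ^ n)"
  proof -
    have "2 * X\<^sup>2 / \<omega> * \<kappa> * (J / k * (\<omega> / 2 * (k * r / (X * N) + o' / (X\<^sup>2 * N')))
       - Y * (\<omega> / 2 * e * (n * r * s / (X * M) - d / (X * N) + o' * s / (X\<^sup>2 * N))))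
     = \<kappa> * (J * (X * r / N + o' / (k * N')) - e * (X * Y) * (real n * r * s / M - d / N) - e * Y * o' * s / N)"
      if "X > 0" "k > 0" for X Y J k r s N o' N' M d e :: real
    proof -
      have c: "2 * X\<^sup>2 / \<omega> * \<kappa> * (Q * (\<omega> / 2 * V)) = \<kappa> * (Q * (X\<^sup>2 * V))" for Q V
        using \<omega> by simp
      have d: "X\<^sup>2 * (s / (X * N)) = X * s / N" "X\<^sup>2 * (s / (X\<^sup>2 * N)) = s / N" for s N
        using that by (simp_all add: power2_eq_square)
      have 1: "2 * X\<^sup>2 / \<omega> * \<kappa> * (J / k * (\<omega> / 2 * (k * r / (X * N) + o' / (X\<^sup>2 * N'))))
        = \<kappa> * (J * (X * r / N + o' / (k * N')))"
        unfolding c distrib_left[of "X\<^sup>2"] d using that by (simp add: distrib_left)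
      have 2: "2 * X\<^sup>2 / \<omega> * \<kappa> * (Y * (\<omega> / 2 * e * (n * r * s / (X * M) - d / (X * N) + o' * s / (X\<^sup>2 * N))))
        = \<kappa> * (Y * (e * (X * (n * r * s) / M - X * d / N + o' * s / N)))"
      proof -
        have "Y * (\<omega> / 2 * e * V) = Y * e * (\<omega> / 2 * V)" for V by (simp only: mult_ac)
        then show ?thesis
          by (simp only: c distrib_left[of "X\<^sup>2"] right_diff_distrib[of "X\<^sup>2"] d)
      qed
      have 3: "\<kappa> * (J * (X * r / N + o' / (k * N'))) - \<kappa> * (Y * (e * (X * (n * r * s) / M - X * d / N + o' * s / N)))
        = \<kappa> * (J * (X * r / N + o' / (k * N')) - e * (X * Y) * (n * r * s / M - d / N) - e * Y * o' * s / N)"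
        by (simp add: divide_inverse algebra_simps)
      show ?thesis unfolding right_diff_distrib[of "2 * X\<^sup>2 / \<omega> * \<kappa>"] 1 2 by (rule 3)
    qed
    from this[OF xn n0(2)] show ?thesis by (simp only:)
  qed
  finally have I: "(LINT \<xi>|lborel. odqvist_K i None (x - bdry \<xi>) * lorentz_U None j (bdry \<xi> - y)) = \<dots>" .
  have "\<kappa> * (d / k / P + z1 * z2 / Q) - e * (\<kappa> * (d / k / P' + r1 * r2 / Q')) - 2 * (\<kappa> * S)
    = \<kappa> * (d * (1 / P - e / P') / k + z1 * z2 / Q - e * (r1 * r2 / Q') - 2 * S)" for d k P z1 z2 Q e P' r1 r2 Q' S :: real
    by (simp add: divide_inverse algebra_simps)
  then show ?thesis
    unfolding green_G_def I unfolding U z_def[symmetric] R_def[symmetric] by (simp only:)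
qed

lemma norm_sub_le_norm_sub_refl:
  assumes "x \<in> half_space" "y \<in> half_space"
  shows "norm (x - y) \<le> norm (x - refl_pt y)"
proof (rule power2_le_imp_le)
  have "0 < x $ None * y $ None" using assms by (simp add: half_space_def)
  then show "(norm (x - y))\<^sup>2 \<le> (norm (x - refl_pt y))\<^sup>2"
    using norm_sub_refl_minus_sub_sq[of x y] by linarith
qed simp

text \<open>Tangential components of z and R agree, and z_n = R_n - 2 y_n = 2 x_n - R_n. With these
  relations the quadratic terms over |R|^n join those over |z|^n to form \<open>D\<close>; only
  \<open>D\<close>, \<open>E\<close> and multiples of q remain, all of first order in q.\<close>

lemma green_G_ge_3_cases:
  fixes x y :: "real ^ ('m::finite) option"
  assumes x: "x \<in> half_space" and y: "y \<in> half_space" and n: "n = CARD('m option)" "n \<ge> 3"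
  defines "z \<equiv> x - y" and "R \<equiv> x - refl_pt y" and "\<kappa> \<equiv> 1 / (2 * real n * unit_ball_vol (real n))"
    and "q \<equiv> x $ None * y $ None"
  defines "D \<equiv> 1 / norm z ^ n - 1 / norm R ^ n" and "E \<equiv> (1 / norm z ^ (n - 2) - 1 / norm R ^ (n - 2)) / real (n - 2)"
  shows "green_G (Some a) (Some b) x y = \<kappa> * (of_bool (a = b) * E + z $ Some a * z $ Some b * D
          - 2 * (of_bool (a = b) * q / norm R ^ n) + 2 * (real n * (q * (R $ Some a * R $ Some b) / norm R ^ (n + 2))))"
    and "green_G None (Some b) x y = \<kappa> * (z $ None * z $ Some b * D + 2 * (real n * (q * (R $ None * R $ Some b) / norm R ^ (n + 2))))"
    and "green_G (Some a) None x y = \<kappa> * (z $ Some a * z $ None * D - 2 * (real n * (q * (R $ Some a * R $ None) / norm R ^ (n + 2))))"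
    and "green_G None None x y = \<kappa> * (E + z $ None * z $ None * D - 2 * (q / norm R ^ n) - 2 * (real n * (q * (R $ None * R $ None) / norm R ^ (n + 2))))"
proof -
  note G = green_G_explicit[OF x y n, folded z_def R_def \<kappa>_def q_def]
  have RS: "R $ Some a = z $ Some a" for a by (simp add: R_def z_def refl_pt_def)
  have RN: "R $ None = x $ None + y $ None" "z $ None = x $ None - y $ None" by (simp_all add: R_def z_def)
  show "green_G (Some a) (Some b) x y = \<kappa> * (of_bool (a = b) * E + z $ Some a * z $ Some b * D
          - 2 * (of_bool (a = b) * q / norm R ^ n) + 2 * (real n * (q * (R $ Some a * R $ Some b) / norm R ^ (n + 2))))"
    unfolding G D_def E_def by (simp add: eps_sign_def RS algebra_simps diff_divide_distrib)
  show "green_G None (Some b) x y = \<kappa> * (z $ None * z $ Some b * D + 2 * (real n * (q * (R $ None * R $ Some b) / norm R ^ (n + 2))))"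
    unfolding G D_def E_def by (simp add: eps_sign_def RS RN algebra_simps diff_divide_distrib add_divide_distrib)
  show "green_G (Some a) None x y = \<kappa> * (z $ Some a * z $ None * D - 2 * (real n * (q * (R $ Some a * R $ None) / norm R ^ (n + 2))))"
    unfolding G D_def E_def by (simp add: eps_sign_def RS RN algebra_simps diff_divide_distrib add_divide_distrib)
  \<comment> \<open>This says - R_n^2 + 2 q = - z_n^2 - 2 q, that is R_n^2 = z_n^2 + 4 q.\<close>
  have "(x $ None + y $ None)\<^sup>2 - 2 * x $ None * (x $ None + y $ None) - 2 * y $ None * (x $ None + y $ None) + 2 * q
      = - (z $ None)\<^sup>2 - 2 * q"
    by (simp add: RN q_def algebra_simps power2_eq_square)
  then have "((x $ None + y $ None)\<^sup>2 - 2 * x $ None * (x $ None + y $ None) - 2 * y $ None * (x $ None + y $ None) + 2 * q) / norm R ^ n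
      = (- (z $ None)\<^sup>2 - 2 * q) / norm R ^ n" by simp
  then have *: "R $ None * R $ None / norm R ^ n - 2 * (x $ None * R $ None / norm R ^ n) - 2 * (y $ None * R $ None / norm R ^ n) + 2 * q / norm R ^ n
      = - (z $ None * z $ None / norm R ^ n) - 2 * (q / norm R ^ n)"
    unfolding RN(1) by (simp add: power2_eq_square diff_divide_distrib add_divide_distrib)
  have "(1 / norm z ^ (n - 2) + 1 / norm R ^ (n - 2)) / real (n - 2) - 2 * (1 / (real (n - 2) * norm R ^ (n - 2))) = E"
    unfolding E_def by (simp add: add_divide_distrib diff_divide_distrib mult.commute)
  with * show "green_G None None x y = \<kappa> * (E + z $ None * z $ None * D - 2 * (q / norm R ^ n) - 2 * (real n * (q * (R $ None * R $ None) / norm R ^ (n + 2))))"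
    unfolding G D_def by (intro arg_cong[of _ _ "(*) \<kappa>"]) (simp add: eps_sign_def algebra_simps)
qed

section \<open>The two pointwise bounds for n at least three\<close>

lemma green_G_bounds_ge_3:
  assumes n: "CARD('m::finite option) \<ge> 3"
  obtains C where "C > 0"
    and "\<And>x y :: real ^ 'm option. \<And>i j. x \<in> half_space \<Longrightarrow> y \<in> half_space \<Longrightarrow> x \<noteq> y \<Longrightarrow>
      \<bar>green_G i j x y\<bar> \<le> C * (x $ None * y $ None) / (norm (x - y) ^ (CARD('m option) - 2) * norm (x - refl_pt y) ^ 2)"
    and "\<And>x y :: real ^ 'm option. \<And>i. x \<in> half_space \<Longrightarrow> y \<in> half_space \<Longrightarrow> x \<noteq> y \<Longrightarrow>
      \<bar>green_G i None x y\<bar> \<le> C * (x $ None * (y $ None)\<^sup>2) / (norm (x - y) ^ (CARD('m option) - 2) * norm (x - refl_pt y) ^ 3)"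
proof -
  define n where "n = CARD('m option)"
  have n3: "n \<ge> 3" using n by (simp add: n_def)
  define \<kappa> where "\<kappa> = 1 / (2 * real n * unit_ball_vol (real n))"
  have \<kappa>: "\<kappa> > 0" using n3 by (simp add: \<kappa>_def)
  \<comment> \<open>The constant of \<open>inverse_power_second_order\<close>, times 16 from (b^2 -
    a^2)^2 = (4 q)^2.\<close>
  define A where "A k = 16 * (4 * (real k)\<^sup>2 * 2 ^ k + 6 * k)" for k :: nat
  have A0: "A k \<ge> 0" for k by (simp add: A_def)
  \<comment> \<open>\<open>B\<close> is a common majorant for the three constants in
    \<open>B0\<close>: the first-order bound, that bound times 16/3 for |R| > 2 |x - y|, and the
    second-order bound for j = n.\<close>
  define B where "B = (10 * real n + 10) * 6 + 16 * A n + A (n - 2) + 8 * real n + 2 * (2 * real n + A n)"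
  have B0: "B \<ge> 10 * real n + 10" "B \<ge> (10 * real n + 10) * (16 / 3)" "B \<ge> A n + A (n - 2) + 4 * (2 * real n + A n)"
    using A0[of n] A0[of "n - 2"] by (auto simp: B_def)
  have main: "\<bar>green_G i j x y\<bar> \<le> \<kappa> * ((10 * real n + 10) * (x $ None * y $ None) / (norm (x - y) ^ (n - 2) * norm (x - refl_pt y) ^ 2))"
    and main2: "norm (x - refl_pt y) \<le> 2 * norm (x - y) \<Longrightarrow> \<bar>green_G i None x y\<bar> \<le> \<kappa> * (B * (x $ None * (y $ None)\<^sup>2) / norm (x - refl_pt y) ^ (n + 1))"
    if x: "x \<in> half_space" and y: "y \<in> half_space" and xy: "x \<noteq> y" for x y :: "real ^ 'm option" and i j
  proof -
    define z R where "z = x - y" and "R = x - refl_pt y"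
    define X Y q where "X = x $ None" and "Y = y $ None" and "q = X * Y"
    define r N where "r = norm z" and "N = norm R"
    define D where "D = 1 / r ^ n - 1 / N ^ n"
    define E where "E = (1 / r ^ (n - 2) - 1 / N ^ (n - 2)) / real (n - 2)"
    note G = green_G_ge_3_cases[OF x y n_def n3, folded z_def R_def \<kappa>_def X_def Y_def q_def, folded r_def N_def, folded D_def E_def]
    have pos: "X > 0" "Y > 0" "q > 0" "r > 0" using half_space_pos[OF x] half_space_pos[OF y] xy by (auto simp: X_def Y_def q_def r_def z_def)
    have Nr: "N\<^sup>2 - r\<^sup>2 = 4 * q"
      unfolding N_def r_def z_def R_def q_def X_def Y_def by (rule norm_sub_refl_minus_sub_sq)
    then have "r\<^sup>2 \<le> N\<^sup>2" using pos by linarith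
    then have rN: "r \<le> N" by (rule power2_le_imp_le) (simp add: N_def)
    then have N: "N > 0" using pos by linarith
    have zr: "\<bar>z $ k\<bar> \<le> r" "\<bar>R $ k\<bar> \<le> N" for k by (simp_all add: r_def N_def component_le_norm_cart)
    have XYN: "X + Y \<le> N" using zr(2)[of None] pos by (simp add: R_def X_def Y_def)
    have n22: "n - 2 + 2 = n" using n3 by simp
    have npow: "r ^ n = r ^ (n - 2) * r\<^sup>2" "N ^ n = N ^ (n - 2) * N\<^sup>2" "N ^ (n + 2) = N ^ n * N\<^sup>2"
      using power_add[of r "n - 2" 2, unfolded n22] power_add[of N "n - 2" 2, unfolded n22] power_add[of N n 2] by auto
    \<comment> \<open>\<open>T\<close> is the shape of the first estimate, and every term of
      \<open>G\<close> is bounded by a multiple of it.\<close>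
    define T where "T = q / (r ^ (n - 2) * N\<^sup>2)"
    have T0: "T \<ge> 0" using pos N by (simp add: T_def)
    have D: "0 \<le> D" "D \<le> n * (4 * q) / (r ^ n * N\<^sup>2)"
      using inverse_power_diff_bound[OF pos(4) rN, of n] by (simp_all add: D_def Nr)
    define k where "k = real (n - 2)"
    have k: "k > 0" using n3 by (simp add: k_def)
    have "1 / r ^ (n - 2) - 1 / N ^ (n - 2) \<le> k * (4 * q) / (r ^ (n - 2) * N\<^sup>2)"
      "0 \<le> 1 / r ^ (n - 2) - 1 / N ^ (n - 2)"
      using inverse_power_diff_bound[OF pos(4) rN, of "n - 2"] by (simp_all add: Nr k_def)
    then have E: "0 \<le> E" "E \<le> 4 * T"
      unfolding E_def k_def[symmetric] using k by (simp_all add: pos_divide_le_eq T_def mult_ac)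
    have qT: "q / N ^ n \<le> T"
      unfolding T_def npow using pos N rN by (intro divide_left_mono mult_right_mono power_mono) auto
    have zz: "\<bar>z $ k * z $ l * D\<bar> \<le> 4 * n * T" for k l
    proof -
      have "\<bar>z $ k * z $ l * D\<bar> \<le> r * r * (n * (4 * q) / (r ^ n * N\<^sup>2))"
        unfolding abs_mult using zr D pos by (intro mult_mono) auto
      also have "\<dots> = 4 * n * T" using pos by (simp add: T_def npow power2_eq_square)
      finally show ?thesis .
    qed
    have RR: "\<bar>real n * (q * (R $ k * R $ l) / N ^ (n + 2))\<bar> \<le> n * T" for k l
    proof -
      have "\<bar>q * (R $ k * R $ l) / N ^ (n + 2)\<bar> \<le> q * (N * N) / N ^ (n + 2)"
        unfolding abs_mult abs_divide using zr N pos by (intro divide_mono mult_mono) auto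
      also have "\<dots> = q / N ^ n" using N by (simp add: power2_eq_square power_add)
      also have "\<dots> \<le> T" by (rule qT)
      finally show ?thesis
        unfolding abs_mult[of "real n"] abs_of_nat by (rule mult_left_mono[OF _ of_nat_0_le_iff])
    qed
    have bT: "\<bar>of_bool P * q / N ^ n\<bar> \<le> T" for P
      using qT T0 pos N by (cases P) auto
    have bE: "\<bar>of_bool P * E\<bar> \<le> 4 * T" for P
      using E T0 by (cases P) auto
    have first: "\<bar>green_G i j x y\<bar> \<le> \<kappa> * ((10 * n + 10) * T)" for i j
    proof -
      have "\<bar>\<kappa> * S\<bar> \<le> \<kappa> * ((10 * n + 10) * T)" if "\<bar>S\<bar> \<le> 4 * T + 4 * n * T + 2 * T + 2 * (n * T)" for S
      proof -
        have "4 * T + 4 * n * T + 2 * T + 2 * (n * T) \<le> (10 * n + 10) * T" using T0 by (simp add: algebra_simps)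
        then have "\<kappa> * \<bar>S\<bar> \<le> \<kappa> * ((10 * n + 10) * T)" using that \<kappa> by (intro mult_left_mono) auto
        then show ?thesis using \<kappa> by (simp only: abs_mult abs_of_pos)
      qed
      note K = this
      have ab: "\<bar>u + v - 2 * w + 2 * s\<bar> \<le> 4 * T + b + 2 * T + 2 * d" "\<bar>u + v - 2 * w - 2 * s\<bar> \<le> 4 * T + b + 2 * T + 2 * d"
        if "\<bar>u\<bar> \<le> 4 * T" "\<bar>v\<bar> \<le> b" "\<bar>w\<bar> \<le> T" "\<bar>s\<bar> \<le> d" for u v w s b d :: real
        using that by linarith+
      have ab0: "\<bar>v + 2 * s\<bar> \<le> 4 * T + b + 2 * T + 2 * d" "\<bar>v - 2 * s\<bar> \<le> 4 * T + b + 2 * T + 2 * d"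
        if "\<bar>v\<bar> \<le> b" "\<bar>s\<bar> \<le> d" for v s b d :: real
        using that T0 by linarith+
      have E4: "\<bar>E\<bar> \<le> 4 * T" and qN: "\<bar>q / N ^ n\<bar> \<le> T" using E qT pos N by auto
      show ?thesis
      proof (cases i; cases j)
        fix a b assume ij: "i = Some a" "j = Some b"
        show ?thesis unfolding ij G(1)
          by (rule K[OF ab(1)[OF bE zz bT RR]])
      next
        fix b assume ij: "i = None" "j = Some b"
        show ?thesis unfolding ij G(2)
          by (rule K[OF ab0(1)[OF zz RR]])
      next
        fix a assume ij: "i = Some a" "j = None"
        show ?thesis unfolding ij G(3)
          by (rule K[OF ab0(2)[OF zz RR]])
      next
        assume ij: "i = None" "j = None"
        show ?thesis unfolding ij G(4)
          by (rule K[OF ab(2)[OF E4 zz qN RR]])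
      qed
    qed
    then show "\<bar>green_G i j x y\<bar> \<le> \<kappa> * ((10 * real n + 10) * (x $ None * y $ None) / (norm (x - y) ^ (n - 2) * norm (x - refl_pt y) ^ 2))"
      by (simp add: T_def q_def X_def Y_def r_def N_def z_def R_def)
    assume "norm (x - refl_pt y) \<le> 2 * norm (x - y)"
    then have N2: "N \<le> 2 * r" by (simp add: N_def r_def z_def R_def)
    \<comment> \<open>The natural size of a second-order remainder, (q / N^2)^2 / N^(n-2). Because X
      <= N it is at most \<open>V\<close>, the shape of the second estimate when r and N are
      comparable.\<close>
    define W where "W = q\<^sup>2 / N ^ (n + 2)"
    have W0: "W \<ge> 0" using N by (simp add: W_def)
    \<comment> \<open>\<open>D\<close> minus its linear term in q; the quotient q / N ^ n plays the
      same part for \<open>E\<close> in \<open>E2\<close>.\<close>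
    define \<Delta> where "\<Delta> = D - 2 * (real n * (q / N ^ (n + 2)))"
    have "k / 2 * (4 * q) / M = 2 * (real k * (q / M))" "(4 * (real k)\<^sup>2 * 2 ^ k + 6 * k) * (4 * q)\<^sup>2 / M = A k * (q\<^sup>2 / M)" for k M
      by (simp_all add: A_def power2_eq_square)
    note so = inverse_power_second_order[OF pos(4) rN N2, unfolded Nr this]
    have \<Delta>: "\<bar>\<Delta>\<bar> \<le> A n * (q\<^sup>2 / N ^ (n + 4))"
      using so[of n] by (simp add: \<Delta>_def D_def)
    have N4: "N\<^sup>2 * (q\<^sup>2 / N ^ (n + 4)) = W"
      unfolding W_def using N by (simp add: power_add power2_eq_square power4_eq_xxxx)
    have E2: "\<bar>E - 2 * (q / N ^ n)\<bar> \<le> A (n - 2) * W"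
    proof -
      have n24: "n - 2 + 4 = n + 2" using n3 by simp
      have kE: "1 / r ^ (n - 2) - 1 / N ^ (n - 2) = k * E" using k by (simp add: E_def k_def[symmetric])
      have "\<bar>k * E - 2 * (k * (q / N ^ n))\<bar> \<le> A (n - 2) * W"
        using so[of "n - 2", unfolded n22 n24 kE k_def[symmetric]] unfolding W_def .
      moreover have "k * E - 2 * (k * (q / N ^ n)) = k * (E - 2 * (q / N ^ n))" by (simp add: algebra_simps)
      ultimately have "k * \<bar>E - 2 * (q / N ^ n)\<bar> \<le> A (n - 2) * W"
        using k by (simp only: abs_mult abs_of_pos)
      moreover have "1 * \<bar>E - 2 * (q / N ^ n)\<bar> \<le> k * \<bar>E - 2 * (q / N ^ n)\<bar>"
        using n3 by (intro mult_right_mono) (auto simp: k_def)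
      ultimately show ?thesis unfolding mult_1 by (rule order_trans[rotated])
    qed
    have RD: "\<bar>R $ k * R $ l * \<Delta>\<bar> \<le> A n * W" for k l
    proof -
      have "\<bar>R $ k * R $ l * \<Delta>\<bar> \<le> N * N * (A n * (q\<^sup>2 / N ^ (n + 4)))"
        unfolding abs_mult using zr \<Delta> N by (intro mult_mono) auto
      also have "\<dots> = A n * (N\<^sup>2 * (q\<^sup>2 / N ^ (n + 4)))" by (simp add: power2_eq_square)
      finally show ?thesis unfolding N4 .
    qed
    have qN: "q \<le> N\<^sup>2"
      unfolding q_def power2_eq_square using pos XYN by (intro mult_mono) auto
    have D2: "D \<le> (2 * n + A n) * (q / N ^ (n + 2))"
    proof -
      have "q\<^sup>2 / N ^ (n + 4) \<le> q / N ^ (n + 2)"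
      proof -
        have "q * q / N ^ (n + 4) \<le> q * N\<^sup>2 / N ^ (n + 4)"
          using qN pos N by (intro divide_right_mono mult_left_mono) auto
        also have "\<dots> = q / N ^ (n + 2)" using N by (simp add: power_add power2_eq_square power4_eq_xxxx)
        finally show ?thesis by (simp add: power2_eq_square)
      qed
      from order_trans[OF abs_ge_self order_trans[OF \<Delta> mult_left_mono[OF this A0[of n]]]]
      show ?thesis by (simp add: \<Delta>_def algebra_simps add_divide_distrib)
    qed
    define V where "V = X * Y\<^sup>2 / N ^ (n + 1)"
    have V0: "V \<ge> 0" using pos N by (simp add: V_def)
    have WV: "W \<le> V"
    proof -
      have "X * (X * Y\<^sup>2) / N ^ (n + 2) \<le> N * (X * Y\<^sup>2) / N ^ (n + 2)"
        using pos XYN N by (intro divide_right_mono mult_right_mono) auto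
      also have "\<dots> = V" using N by (simp add: V_def)
      finally show ?thesis by (simp add: W_def q_def power2_eq_square mult_ac)
    qed
    define c where "c = 2 * real n + A n"
    have c0: "c \<ge> 0" using A0[of n] by (simp add: c_def)
    have AW: "A k * W \<le> A k * V" for k using WV A0 by (rule mult_left_mono)
    have cV: "c * V \<ge> 0" using c0 V0 by simp
    have AV: "A k * V \<ge> 0" for k using A0 V0 by simp
    have fin: "\<bar>\<kappa> * S\<bar> \<le> \<kappa> * (B * V)" if "\<bar>S\<bar> \<le> A n * V + A (n - 2) * V + 4 * (c * V)" for S
    proof -
      have "A n * V + A (n - 2) * V + 4 * (c * V) = (A n + A (n - 2) + 4 * c) * V" by (simp add: algebra_simps)
      also have "\<dots> \<le> B * V" using B0(3) V0 by (intro mult_right_mono) (auto simp: c_def)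
      finally have "\<kappa> * \<bar>S\<bar> \<le> \<kappa> * (B * V)" using that \<kappa> by (intro mult_left_mono) auto
      then show ?thesis using \<kappa> by (simp only: abs_mult abs_of_pos)
    qed
    have "\<bar>green_G i None x y\<bar> \<le> \<kappa> * (B * V)"
    proof (cases i)
      case (Some a)
      \<comment> \<open>Substituting z_n = R_n - 2 Y isolates R_a R_n \<Delta>, which is of second
        order, and leaves 2 Y R_a D, which is of first order in q but carries a further factor
        Y.\<close>
      have zR: "z $ Some a = R $ Some a" "z $ None = R $ None - 2 * Y" by (simp_all add: z_def R_def Y_def refl_pt_def)
      have "\<bar>2 * Y * (R $ Some a * D)\<bar> \<le> 2 * Y * (N * (c * (q / N ^ (n + 2))))"
        unfolding abs_mult using zr D D2 pos N c0 by (intro mult_mono) (auto simp: c_def)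
      also have "\<dots> = 2 * (c * V)" using N by (simp add: V_def q_def power2_eq_square)
      finally have *: "\<bar>2 * Y * (R $ Some a * D)\<bar> \<le> 2 * (c * V)" .
      have eq: "z $ Some a * z $ None * D - 2 * (real n * (q * (R $ Some a * R $ None) / N ^ (n + 2)))
        = R $ Some a * R $ None * \<Delta> - 2 * Y * (R $ Some a * D)"
        unfolding zR \<Delta>_def by (simp add: algebra_simps)
      have "\<bar>u - w\<bar> \<le> a + b + 4 * d" if "\<bar>u\<bar> \<le> a'" "a' \<le> a" "\<bar>w\<bar> \<le> 2 * d" "0 \<le> b" "0 \<le> d" for u w a a' b d :: real
        using that by linarith
      from fin[OF this[OF RD AW * AV cV]] show ?thesis unfolding Some G(3) eq .
    next
      case None
      \<comment> \<open>The explicit q-terms remove the linear parts of both \<open>E\<close> and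
        \<open>D\<close>, and z_n^2 = R_n^2 - 4 q leaves only q D, again quadratic in q.\<close>
      have zR: "z $ None * z $ None = R $ None * R $ None - 4 * q" by (simp add: z_def R_def q_def X_def Y_def algebra_simps)
      have "4 * (q * D) \<le> 4 * (q * (c * (q / N ^ (n + 2))))"
        using pos D2 by (intro mult_left_mono) (auto simp: c_def)
      also have "\<dots> = 4 * (c * W)" by (simp add: W_def power2_eq_square)
      also have "\<dots> \<le> 4 * (c * V)" using WV c0 by (intro mult_left_mono) auto
      finally have *: "4 * (q * D) \<le> 4 * (c * V)" .
      have nn: "0 \<le> 4 * (q * D)" using pos D by simp
      have eq: "E + z $ None * z $ None * D - 2 * (q / N ^ n) - 2 * (real n * (q * (R $ None * R $ None) / N ^ (n + 2)))
        = (E - 2 * (q / N ^ n)) + R $ None * R $ None * \<Delta> - 4 * (q * D)"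
        unfolding zR \<Delta>_def by (simp add: algebra_simps)
      have "\<bar>e + u - p\<bar> \<le> a + b + 4 * d" if "\<bar>e\<bar> \<le> b'" "b' \<le> b" "\<bar>u\<bar> \<le> a'" "a' \<le> a" "0 \<le> p" "p \<le> 4 * d"
        for e u p a a' b b' d :: real
        using that by linarith
      from fin[OF this[OF E2 AW RD AW nn *]] show ?thesis unfolding None G(4) eq .
    qed
    then show "\<bar>green_G i None x y\<bar> \<le> \<kappa> * (B * (x $ None * (y $ None)\<^sup>2) / norm (x - refl_pt y) ^ (n + 1))"
      by (simp add: V_def X_def Y_def N_def R_def)
  qed
  have B_pos: "\<kappa> * B > 0" using \<kappa> B0(1) by (intro mult_pos_pos) auto
  show thesis
  proof (rule that[OF B_pos])
    fix x y :: "real ^ 'm option" and i j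
    assume x: "x \<in> half_space" and y: "y \<in> half_space" and xy: "x \<noteq> y"
    define q r N where "q = x $ None * y $ None" and "r = norm (x - y)" and "N = norm (x - refl_pt y)"
    have pos: "x $ None > 0" "y $ None > 0" "q > 0" "r > 0" "N > 0"
      using half_space_pos[OF x] half_space_pos[OF y] xy norm_sub_refl_pos[OF x y] by (auto simp: q_def r_def N_def)
    have "(10 * real n + 10) * q / (r ^ (n - 2) * N\<^sup>2) \<le> B * q / (r ^ (n - 2) * N\<^sup>2)"
      using B0(1) pos by (intro divide_right_mono mult_right_mono) auto
    from mult_left_mono[OF this less_imp_le[OF \<kappa>]] main[OF x y xy, of i j]
    show "\<bar>green_G i j x y\<bar> \<le> \<kappa> * B * (x $ None * y $ None) / (norm (x - y) ^ (CARD('m option) - 2) * norm (x - refl_pt y) ^ 2)"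
      unfolding n_def[symmetric] q_def[symmetric] r_def[symmetric] N_def[symmetric] by (simp add: mult.assoc)
    define V where "V = x $ None * (y $ None)\<^sup>2 / (r ^ (n - 2) * N ^ 3)"
    have "\<bar>green_G i None x y\<bar> \<le> \<kappa> * (B * V)"
    \<comment> \<open>In the first case r <= N passes from N^(n+1) to r^(n-2) N^3. In the second,
      N^2 - r^2 = 4 q forces 3 N^2 <= 16 q, and x_n <= N turns this into 3 N <= 16 y_n, so the extra
      factor y_n / N costs only 16/3.\<close>
    proof (cases "N \<le> 2 * r")
      case True
      have rN: "r \<le> N"
      unfolding r_def N_def by (rule norm_sub_le_norm_sub_refl[OF x y])
      have "B * (x $ None * (y $ None)\<^sup>2 / N ^ (n + 1)) \<le> B * V"
        unfolding V_def
      proof (intro mult_left_mono divide_left_mono)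
        have "n - 2 + 3 = n + 1" using n3 by simp
        then have "N ^ (n + 1) = N ^ (n - 2) * N ^ 3" by (metis power_add)
        then show "r ^ (n - 2) * N ^ 3 \<le> N ^ (n + 1)" using rN pos by (simp add: mult_right_mono power_mono)
      qed (use pos B0(1) in auto)
      from mult_left_mono[OF this less_imp_le[OF \<kappa>]] main2[OF x y xy, of i] True show ?thesis
        by (simp add: r_def N_def)
    next
      case False
      have "N\<^sup>2 - r\<^sup>2 = 4 * q" unfolding N_def r_def q_def by (rule norm_sub_refl_minus_sub_sq)
      moreover have "4 * r\<^sup>2 \<le> N\<^sup>2"
      proof -
        have "(2 * r)\<^sup>2 \<le> N\<^sup>2" using False pos by (intro power_mono) auto
        then show ?thesis by (simp add: power_mult_distrib)
      qed
      ultimately have q: "3 * N\<^sup>2 \<le> 16 * q" by linarith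
      have "x $ None \<le> N"
        using component_le_norm_cart[of "x - refl_pt y" None] pos by (simp add: N_def)
      then have "16 * q \<le> 16 * (N * y $ None)" using pos by (simp add: q_def)
      with q have "N * (3 * N) \<le> N * (16 * y $ None)" by (simp add: power2_eq_square)
      then have yN: "3 * N \<le> 16 * y $ None" using pos by simp
      define t where "t = q / (r ^ (n - 2) * N\<^sup>2)"
      have "t * (3 * N) \<le> t * (16 * y $ None)"
        using yN pos by (intro mult_left_mono) (auto simp: t_def)
      then have "t \<le> 16 / 3 * (t * y $ None / N)" using pos by (simp add: field_simps)
      also have "t * y $ None / N = V"
        by (simp add: t_def V_def q_def power2_eq_square power3_eq_cube mult_ac)
      finally have "t \<le> 16 / 3 * V" .
      then have "(10 * real n + 10) * t \<le> (10 * real n + 10) * (16 / 3 * V)" by (intro mult_left_mono) auto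
      also have "\<dots> \<le> B * V"
        unfolding mult.assoc[symmetric] using B0(2) pos by (intro mult_right_mono) (auto simp: V_def)
      finally show ?thesis
        using mult_left_mono[OF _ less_imp_le[OF \<kappa>]] main[OF x y xy, of i None]
        unfolding q_def[symmetric] r_def[symmetric] N_def[symmetric] times_divide_eq_right[symmetric] t_def[symmetric]
        by (meson order_trans)
    qed
    then show "\<bar>green_G i None x y\<bar> \<le> \<kappa> * B * (x $ None * (y $ None)\<^sup>2) / (norm (x - y) ^ (CARD('m option) - 2) * norm (x - refl_pt y) ^ 3)"
      unfolding n_def[symmetric] r_def[symmetric] N_def[symmetric] V_def by (simp add: mult.assoc)
  qed
qed

section \<open>Dimension two\<close>

text \<open>If f is not integrable its integral is 0 by convention, and G >= 0 because g dominates
  an absolute value.\<close>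

lemma abs_integral_le:
  fixes f g :: "'a \<Rightarrow> real"
  assumes "has_bochner_integral M g G" "\<And>x. \<bar>f x\<bar> \<le> g x"
  shows "\<bar>\<integral>x. f x \<partial>M\<bar> \<le> G"
proof (cases "integrable M f")
  case True
  have "\<bar>\<integral>x. f x \<partial>M\<bar> \<le> (\<integral>x. \<bar>f x\<bar> \<partial>M)" by (rule integral_abs_bound)
  also have "\<dots> \<le> (\<integral>x. g x \<partial>M)"
    using True assms by (intro integral_mono) (auto simp: has_bochner_integral_iff)
  finally show ?thesis using assms(1) by (simp add: has_bochner_integral_iff)
next
  case False
  have "0 \<le> (\<integral>x. g x \<partial>M)" using assms(2) by (intro integral_nonneg_AE AE_I2) (meson abs_ge_zero order_trans)
  then show ?thesis using False assms(1) by (simp add: not_integrable_integral_eq has_bochner_integral_iff)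
qed

text \<open>Comparison with the logarithm at height \<open>T\<close> replaces the divergent integral
  over all heights by one over [y_n, T]. The integrand is nonnegative, so the \<open>ennreal\<close>
  identity yields integrability and value together.\<close>

lemma has_bochner_integral_poisson_log:
  fixes x y :: "real ^ ('m::finite) option"
  assumes x: "x \<in> half_space" and y: "y \<in> half_space" and n: "CARD('m option) = 2" and T: "y $ None \<le> T"
  shows "has_bochner_integral lborel
    (\<lambda>\<xi>. x $ None / (norm (x - bdry \<xi>))\<^sup>2 * (ln ((norm (\<xi> - tang y))\<^sup>2 + T\<^sup>2) / 2 - ln (norm (bdry \<xi> - y))))
    (poisson_const TYPE('m) * (ln ((norm (tang x - tang y))\<^sup>2 + (x $ None + T)\<^sup>2) / 2 - ln (norm (x - refl_pt y))))"
    (is "has_bochner_integral _ ?f ?I")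
proof (rule has_bochner_integral_nn_integral)
  note pos = half_space_pos[OF x] half_space_pos[OF y]
    norm_sub_bdry_pos(1)[OF x] norm_sub_bdry_pos(2)[OF y] norm_sub_refl_pos[OF x y]
  define p :: real where "p = 1"
  have p: "p = (CARD('m) + 1) / 2" "pi powr p / Gamma p = poisson_const TYPE('m)"
    using n by (simp_all add: p_def poisson_const_def)
  have ln_half: "ln ((norm (bdry \<xi> - y))\<^sup>2) / 2 = ln (norm (bdry \<xi> - y))" "ln ((norm (x - refl_pt y))\<^sup>2) / 2 = ln (norm (x - refl_pt y))" for \<xi>
    using pos(4)[of \<xi>] pos(5) by (simp_all add: ln_realpow)
  have nonneg: "ln (norm (bdry \<xi> - y)) \<le> ln ((norm (\<xi> - tang y))\<^sup>2 + T\<^sup>2) / 2" for \<xi>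
    unfolding ln_half[symmetric]
    by (intro divide_right_mono ln_mono) (use pos(2) pos(4)[of \<xi>] T in \<open>auto simp: norm_bdry_sub_sq power_mono add_nonneg_pos\<close>)
  show "AE \<xi> in lborel. 0 \<le> ?f \<xi>" using nonneg pos by (auto simp: less_imp_le)
  have "ln (norm (x - refl_pt y)) \<le> ln ((norm (tang x - tang y))\<^sup>2 + (x $ None + T)\<^sup>2) / 2"
    unfolding ln_half[symmetric]
    by (intro divide_right_mono ln_mono) (use pos(1,2,5) T in \<open>auto simp: norm_sub_refl_sq intro!: power_mono add_nonneg_pos\<close>)
  then show "0 \<le> ?I" using poisson_const_pos[where 'm = 'm] by simp
  have "(\<integral>\<^sup>+\<xi>. ennreal (?f \<xi>) \<partial>lborel)
    = (\<integral>\<^sup>+\<xi>. ennreal (x $ None * ((norm (tang x - \<xi>))\<^sup>2 + (x $ None)\<^sup>2) powr (- p)) *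
       (\<integral>\<^sup>+\<sigma>\<in>{y $ None..T}. ennreal (\<sigma> * ((norm (\<xi> - tang y))\<^sup>2 + \<sigma>\<^sup>2) powr (- p)) \<partial>lborel) \<partial>lborel)"
  proof (intro nn_integral_cong)
    fix \<xi>
    have 1: "((norm (tang x - \<xi>))\<^sup>2 + (x $ None)\<^sup>2) powr (- p) = 1 / (norm (x - bdry \<xi>))\<^sup>2"
      by (simp add: p_def norm_sub_bdry_sq[symmetric] powr_minus divide_inverse)
    have 3: "(\<integral>\<^sup>+\<sigma>\<in>{y $ None..T}. ennreal (\<sigma> * ((norm (\<xi> - tang y))\<^sup>2 + \<sigma>\<^sup>2) powr (- p)) \<partial>lborel)
        = ennreal (ln ((norm (\<xi> - tang y))\<^sup>2 + T\<^sup>2) / 2 - ln (norm (bdry \<xi> - y)))"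
      using nn_integral_radial_log[of 0 "y $ None" T "norm (\<xi> - tang y)", unfolded add_0] pos(2) T
      by (simp only: p_def ln_half(1)[symmetric] norm_bdry_sub_sq order_refl)
    show "ennreal (?f \<xi>) = ennreal (x $ None * ((norm (tang x - \<xi>))\<^sup>2 + (x $ None)\<^sup>2) powr (- p)) *
       (\<integral>\<^sup>+\<sigma>\<in>{y $ None..T}. ennreal (\<sigma> * ((norm (\<xi> - tang y))\<^sup>2 + \<sigma>\<^sup>2) powr (- p)) \<partial>lborel)"
      unfolding 1 3 using pos(1) by (subst ennreal_mult'[symmetric]) auto
  qed
  also have "\<dots> = ennreal (pi powr p / Gamma p) * (\<integral>\<^sup>+\<sigma>\<in>{y $ None..T}. ennreal ((x $ None + \<sigma>) *
      ((norm (tang x - tang y))\<^sup>2 + (x $ None + \<sigma>)\<^sup>2) powr (- p)) \<partial>lborel)"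
    by (rule nn_integral_poisson_potential) (use pos p in auto)
  also have "(\<integral>\<^sup>+\<sigma>\<in>{y $ None..T}. ennreal ((x $ None + \<sigma>) *
      ((norm (tang x - tang y))\<^sup>2 + (x $ None + \<sigma>)\<^sup>2) powr (- p)) \<partial>lborel)
    = ennreal (ln ((norm (tang x - tang y))\<^sup>2 + (x $ None + T)\<^sup>2) / 2 - ln (norm (x - refl_pt y)))"
    using nn_integral_radial_log[of "x $ None" "y $ None" T "norm (tang x - tang y)"] pos(1,2) T
    by (simp only: p_def ln_half(2)[symmetric] norm_sub_refl_sq less_imp_le)
  also have "ennreal (pi powr p / Gamma p) * \<dots> = ennreal ?I"
    unfolding p(2) using poisson_const_pos[where 'm = 'm] by (subst ennreal_mult'[symmetric]) auto
  finally show "(\<integral>\<^sup>+\<xi>. ennreal (?f \<xi>) \<partial>lborel) = ennreal ?I" .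
qed auto

text \<open>Triangle inequality through y, at distance 2 y_n from its reflection. It bounds |R| / |x
  - y| by the kind of expression that stands inside the logarithm of the theorem.\<close>

lemma norm_sub_refl_le:
  fixes x y :: "real ^ ('m::finite) option"
  assumes "y \<in> half_space"
  shows "norm (x - refl_pt y) \<le> norm (x - y) + 2 * y $ None"
proof -
  have "(norm (y - refl_pt y))\<^sup>2 = (2 * y $ None)\<^sup>2" by (simp add: norm_sub_refl_sq)
  then have "norm (y - refl_pt y) = 2 * y $ None"
    by (rule power2_eq_imp_eq) (use half_space_pos[OF assms] in auto)
  then show ?thesis using norm_triangle_ineq[of "x - y" "y - refl_pt y"] by simp
qed

lemma green_G_bound_2:
  assumes n: "CARD('m::finite option) = 2"
  obtains C where "C > 0"
    and "\<And>x y :: real ^ 'm option. \<And>i j. x \<in> half_space \<Longrightarrow> y \<in> half_space \<Longrightarrow> x \<noteq> y \<Longrightarrow>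
      \<bar>green_G i j x y\<bar> \<le> C * ln (2 + y $ None / norm (x - y))"
proof -
  define \<omega> where "\<omega> = unit_ball_vol (2 :: real)"
  have \<omega>: "\<omega> > 0" by (simp add: \<omega>_def)
  define \<kappa> where "\<kappa> = 1 / (4 * \<omega>)"
  have \<kappa>: "\<kappa> > 0" using \<omega> by (simp add: \<kappa>_def)
  have pc: "poisson_const TYPE('m) = \<omega>" unfolding poisson_const_eq n by (simp add: \<omega>_def)
  define L where "L w = - (1 / (2 * pi)) * ln (norm w)" for w :: "real ^ 'm option"
  have U: "lorentz_U k l w = 1 / 2 * of_bool (k = l) * L w + \<kappa> * (w $ k * w $ l / (norm w)\<^sup>2)"
    for k l and w :: "real ^ 'm option"
    by (simp only: lorentz_U_def fund_E_def Let_def n \<kappa>_def \<omega>_def L_def) simp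
  have cc: "\<bar>\<kappa> * (w $ k * w $ l / (norm w)\<^sup>2)\<bar> \<le> \<kappa>" for k l and w :: "real ^ 'm option"
  proof -
    have "\<bar>w $ k * w $ l\<bar> \<le> norm w * norm w"
      unfolding abs_mult by (intro mult_mono component_le_norm_cart) auto
    then have "\<bar>w $ k * w $ l / (norm w)\<^sup>2\<bar> \<le> 1" by (cases "w = 0") (auto simp: power2_eq_square divide_le_eq_1)
    from mult_left_mono[OF this less_imp_le[OF \<kappa>]] show ?thesis
      unfolding abs_mult[of \<kappa>] abs_of_pos[OF \<kappa>] mult_1_right .
  qed
  \<comment> \<open>Two rational terms of size at most \<open>\<kappa>\<close>, plus twice the error
    2 \<open>\<kappa>\<close> + 2 / pi of the boundary integral.\<close>
  define c where "c = 6 * \<kappa> + 4 / pi"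
  have c: "c > 0" using \<kappa> by (simp add: c_def add_pos_pos)
  \<comment> \<open>For i = j = n the reflected term enters with sign +, and the boundary integral,
    which is about L R / 2 and is subtracted twice, restores the difference of logarithms.\<close>
  have main: "\<bar>green_G i j x y - 1 / 2 * of_bool (i = j) * (L (x - y) - L (x - refl_pt y))\<bar> \<le> c"
    if x: "x \<in> half_space" and y: "y \<in> half_space" for x y :: "real ^ 'm option" and i j
  proof -
    define X N where "X = x $ None" and "N = norm (x - refl_pt y)"
    have X: "X > 0" and Y: "y $ None > 0" and N: "N > 0"
      using half_space_pos[OF x] half_space_pos[OF y] norm_sub_refl_pos[OF x y] by (auto simp: X_def N_def)
    define P where "P \<xi> = X / (norm (x - bdry \<xi>))\<^sup>2" for \<xi>
    have P0: "P \<xi> \<ge> 0" for \<xi> using X by (simp add: P_def)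
    have "has_bochner_integral lborel (\<lambda>\<xi>. X * (1 / norm (x - bdry \<xi>) ^ CARD('m option))) (X * (\<omega> / X))"
      using has_bochner_integral_mult_right[OF has_bochner_integral_poisson[OF x], of X] by (simp only: pc X_def)
    then have P: "has_bochner_integral lborel P \<omega>"
      unfolding n P_def [abs_def] using X by simp
    define K where "K \<xi> = odqvist_K i None (x - bdry \<xi>)" for \<xi>
    have K: "K \<xi> = 2 * X\<^sup>2 / \<omega> * ((x - bdry \<xi>) $ i / norm (x - bdry \<xi>) ^ 4)" for \<xi>
      by (simp only: K_def odqvist_K_def Let_def n) (simp add: \<omega>_def X_def power2_eq_square mult_ac)
    have [measurable]: "K \<in> borel_measurable borel" unfolding K by measurable
    \<comment> \<open>\<open>K\<close> decays faster than the Poisson kernel \<open>P\<close> by the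
      factor X / r, which pays for a weight growing linearly in \<xi>, the bound used for
      \<open>h\<close> below.\<close>
    have K_le: "\<bar>K \<xi>\<bar> \<le> 2 / \<omega> * P \<xi>" and Ks_le: "\<bar>K \<xi>\<bar> * (1 + norm (\<xi> - tang x) / X) \<le> 4 / \<omega> * P \<xi>" for \<xi>
    proof -
      define r where "r = norm (x - bdry \<xi>)"
      have r: "X \<le> r" "r > 0" using normal_le_norm(1)[of x \<xi>] norm_sub_bdry_pos(1)[OF x] by (auto simp: X_def r_def)
      have "\<bar>K \<xi>\<bar> \<le> 2 * X\<^sup>2 / \<omega> * (r / r ^ 4)"
        unfolding K abs_mult abs_divide r_def[symmetric] using X \<omega> r component_le_norm_cart[of "x - bdry \<xi>" i]
        by (intro mult_mono divide_mono) (auto simp: r_def)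
      also have "\<dots> = 2 / \<omega> * P \<xi> * (X / r)"
        using r by (simp add: P_def r_def[symmetric] power2_eq_square power4_eq_xxxx)
      finally have 1: "\<bar>K \<xi>\<bar> \<le> 2 / \<omega> * P \<xi> * (X / r)" .
      have t0: "0 \<le> 2 / \<omega> * P \<xi>" using \<omega> P0 by simp
      have "2 / \<omega> * P \<xi> * (X / r) \<le> 2 / \<omega> * P \<xi> * 1"
        using r X by (intro mult_left_mono t0) simp
      with 1 show 2: "\<bar>K \<xi>\<bar> \<le> 2 / \<omega> * P \<xi>" by simp
      have "norm (\<xi> - tang x) \<le> r"
        by (rule power2_le_imp_le) (simp_all add: r_def norm_sub_bdry_sq norm_minus_commute)
      then have "\<bar>K \<xi>\<bar> * (norm (\<xi> - tang x) / X) \<le> 2 / \<omega> * P \<xi> * (X / r) * (r / X)"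
        using 1 X r t0 by (intro mult_mono divide_right_mono) auto
      also have "\<dots> = 2 / \<omega> * P \<xi>" using X r by simp
      finally have "\<bar>K \<xi>\<bar> * (norm (\<xi> - tang x) / X) \<le> 2 / \<omega> * P \<xi>" .
      with 2 show "\<bar>K \<xi>\<bar> * (1 + norm (\<xi> - tang x) / X) \<le> 4 / \<omega> * P \<xi>" by (simp add: distrib_left)
    qed
    have K_int: "has_bochner_integral lborel K (of_bool (i = None))"
    proof -
      have "has_bochner_integral lborel (\<lambda>\<xi>. 2 * X\<^sup>2 / \<omega> * ((x - bdry \<xi>) $ i / norm (x - bdry \<xi>) ^ (2 + 2)))
         (2 * X\<^sup>2 / \<omega> * (\<omega> / real 2 * of_bool (i = None) / X\<^sup>2))"
        using has_bochner_integral_mult_right[OF has_bochner_integral_deriv_poisson_1[OF x, of i], of "2 * X\<^sup>2 / \<omega>"]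
        by (simp only: n pc X_def)
      moreover have "2 * X\<^sup>2 / \<omega> * (\<omega> / real 2 * of_bool (i = None) / X\<^sup>2) = of_bool (i = None)" using X \<omega> by simp
      moreover have "(2::nat) + 2 = 4" by simp
      ultimately show ?thesis unfolding K [abs_def] by (simp only:)
    qed
    define I where "I = (LINT \<xi>|lborel. K \<xi> * lorentz_U None j (bdry \<xi> - y))"
    have G: "green_G i j x y = lorentz_U i j (x - y) - eps_sign j * lorentz_U i j (x - refl_pt y) - 2 * I"
      by (simp only: green_G_def I_def K_def)
    \<comment> \<open>A logarithm occurs only for j = n. As \<open>K\<close> has mass \<delta>_in,
      the comparison value arises by replacing |\<xi> - y| with |R| in it.\<close>
    have I: "\<bar>I - 1 / 2 * of_bool (i = None \<and> j = None) * L (x - refl_pt y)\<bar> \<le> 2 * \<kappa> + 2 / pi"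
    proof (cases j)
      case (Some b)
      have "\<bar>I\<bar> \<le> \<kappa> * (2 / \<omega> * \<omega>)"
        unfolding I_def
      proof (rule abs_integral_le)
        show "has_bochner_integral lborel (\<lambda>\<xi>. \<kappa> * (2 / \<omega> * P \<xi>)) (\<kappa> * (2 / \<omega> * \<omega>))"
          by (intro has_bochner_integral_mult_right P)
        show "\<bar>K \<xi> * lorentz_U None j (bdry \<xi> - y)\<bar> \<le> \<kappa> * (2 / \<omega> * P \<xi>)" for \<xi>
        proof -
          have "\<bar>lorentz_U None j (bdry \<xi> - y)\<bar> \<le> \<kappa>" using cc[of "bdry \<xi> - y" None j] Some by (simp add: U)
          then show ?thesis unfolding abs_mult mult.commute[of \<kappa>] using \<kappa> K_le[of \<xi>] by (intro mult_mono) auto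
        qed
      qed
      then have "\<bar>I\<bar> \<le> 2 * \<kappa>" using \<omega> by simp
      then have "\<bar>I\<bar> \<le> 2 * \<kappa> + 2 / pi" by (rule add_increasing2[rotated]) simp
      then show ?thesis using Some by simp
    next
      case None
      \<comment> \<open>With \<open>N\<close> as cutoff height, ln N - ln |\<xi> - y| = g - h. The
        part \<open>g\<close> is nonnegative and integrates exactly against \<open>P\<close>;
        \<open>h\<close> compares the cutoff logarithm with the constant ln N and is controlled by
        its slow growth.\<close>
      define h where "h \<xi> = ln ((norm (\<xi> - tang y))\<^sup>2 + N\<^sup>2) / 2 - ln N" for \<xi>
      define g where "g \<xi> = ln ((norm (\<xi> - tang y))\<^sup>2 + N\<^sup>2) / 2 - ln (norm (bdry \<xi> - y))" for \<xi>
      have YN: "y $ None \<le> N" and XN: "X \<le> N" and rN: "norm (tang x - tang y) \<le> N"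
      proof -
        have "X + y $ None \<le> N" using component_le_norm_cart[of "x - refl_pt y" None] by (simp add: N_def X_def)
        then show "y $ None \<le> N" "X \<le> N" using X Y by auto
        show "norm (tang x - tang y) \<le> N"
          by (rule power2_le_imp_le) (simp_all add: N_def norm_sub_refl_sq)
      qed
      have h: "0 \<le> h \<xi>" "h \<xi> \<le> 1 + norm (\<xi> - tang x) / X" for \<xi>
      proof -
        define a where "a = norm (\<xi> - tang y)"
        define s where "s = norm (\<xi> - tang x) / N"
        have s: "s \<ge> 0" using N by (simp add: s_def)
        have lnN: "ln (N\<^sup>2) / 2 = ln N" using N by (simp add: ln_realpow)
        have "ln (N\<^sup>2) \<le> ln (a\<^sup>2 + N\<^sup>2)" using N by (intro ln_mono) (auto simp: add_nonneg_pos)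
        then show "0 \<le> h \<xi>" unfolding h_def a_def[symmetric] lnN[symmetric] by simp
        have "a \<le> norm (\<xi> - tang x) + norm (tang x - tang y)"
          unfolding a_def using norm_triangle_ineq[of "\<xi> - tang x" "tang x - tang y"] by simp
        then have "a + N \<le> N * (2 + s)" using rN N by (simp add: s_def algebra_simps)
        moreover have "a\<^sup>2 + N\<^sup>2 \<le> (a + N)\<^sup>2" using N by (simp add: a_def power2_sum)
        moreover have "(a + N)\<^sup>2 \<le> (N * (2 + s))\<^sup>2" if "a + N \<le> N * (2 + s)"
          using that N by (intro power_mono) (auto simp: a_def)
        ultimately have "a\<^sup>2 + N\<^sup>2 \<le> (N * (2 + s))\<^sup>2" by linarith
        then have "ln (a\<^sup>2 + N\<^sup>2) \<le> ln ((N * (2 + s))\<^sup>2)" using N by (intro ln_mono) (auto simp: add_nonneg_pos)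
        also have "\<dots> = 2 * (ln N + ln (2 + s))" using N s by (simp add: ln_realpow ln_mult)
        finally have "h \<xi> \<le> ln (2 + s)" unfolding h_def a_def[symmetric] by simp
        also have "\<dots> \<le> 1 + s" using ln_le_minus_one[of "2 + s"] s by simp
        also have "s \<le> norm (\<xi> - tang x) / X" unfolding s_def using X XN by (intro divide_left_mono) auto
        finally show "h \<xi> \<le> 1 + norm (\<xi> - tang x) / X" by simp
      qed
      have g: "0 \<le> g \<xi>" for \<xi>
      proof -
        have "ln (norm (bdry \<xi> - y)) = ln ((norm (bdry \<xi> - y))\<^sup>2) / 2"
          using norm_sub_bdry_pos(2)[OF y, of \<xi>] by (simp add: ln_realpow)
        also have "\<dots> \<le> ln ((norm (\<xi> - tang y))\<^sup>2 + N\<^sup>2) / 2"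
          by (intro divide_right_mono ln_mono)
            (use Y norm_sub_bdry_pos(2)[OF y, of \<xi>] N YN in \<open>auto simp: norm_bdry_sub_sq power_mono add_nonneg_pos\<close>)
        finally show ?thesis by (simp add: g_def)
      qed
      \<comment> \<open>Both |x' - y'| and X are at most \<open>N\<close>, so the argument of the
        first logarithm is at most 5 N^2 and \<open>v\<close> is bounded by a constant.\<close>
      define v where "v = ln ((norm (tang x - tang y))\<^sup>2 + (X + N)\<^sup>2) / 2 - ln N"
      have Pg: "has_bochner_integral lborel (\<lambda>\<xi>. P \<xi> * g \<xi>) (\<omega> * v)"
        unfolding P_def g_def v_def N_def[symmetric] X_def
        using has_bochner_integral_poisson_log[OF x y n YN] by (simp only: pc N_def)
      have v: "v \<le> 2"
      proof -
        have "(norm (tang x - tang y))\<^sup>2 + (X + N)\<^sup>2 \<le> N\<^sup>2 + (2 * N)\<^sup>2"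
          using rN XN X N by (intro add_mono power_mono) auto
        also have "\<dots> = 5 * N\<^sup>2" by (simp add: power_mult_distrib)
        finally have "ln ((norm (tang x - tang y))\<^sup>2 + (X + N)\<^sup>2) \<le> ln (5 * N\<^sup>2)"
          using X N by (intro ln_mono) (auto simp: add_nonneg_pos)
        also have "\<dots> = ln 5 + 2 * ln N" using N by (simp add: ln_mult ln_realpow)
        also have "ln (5::real) \<le> 4" using ln_le_minus_one[of "5::real"] by simp
        finally show ?thesis by (simp add: v_def)
      qed
      define f where "f \<xi> = K \<xi> * (1 / (4 * pi) * (g \<xi> - h \<xi>) + \<kappa> * ((bdry \<xi> - y) $ None * (bdry \<xi> - y) $ None / (norm (bdry \<xi> - y))\<^sup>2))" for \<xi>
      define F where "F \<xi> = 1 / (4 * pi) * (2 / \<omega> * (P \<xi> * g \<xi>) + 4 / \<omega> * P \<xi>) + \<kappa> * (2 / \<omega> * P \<xi>)" for \<xi>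
      have F: "has_bochner_integral lborel F (1 / (4 * pi) * (2 / \<omega> * (\<omega> * v) + 4 / \<omega> * \<omega>) + \<kappa> * (2 / \<omega> * \<omega>))"
        unfolding F_def by (intro has_bochner_integral_add has_bochner_integral_mult_right P Pg)
      have fF: "\<bar>f \<xi>\<bar> \<le> F \<xi>" for \<xi>
      proof -
        have "\<bar>K \<xi> * g \<xi>\<bar> \<le> 2 / \<omega> * (P \<xi> * g \<xi>)"
          using mult_right_mono[OF K_le[of \<xi>] g[of \<xi>]] g[of \<xi>] by (simp add: abs_mult mult.assoc)
        moreover have "\<bar>K \<xi> * h \<xi>\<bar> \<le> 4 / \<omega> * P \<xi>"
        proof -
          have "\<bar>K \<xi> * h \<xi>\<bar> \<le> \<bar>K \<xi>\<bar> * (1 + norm (\<xi> - tang x) / X)"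
            unfolding abs_mult using h[of \<xi>] by (intro mult_left_mono) auto
          then show ?thesis using Ks_le[of \<xi>] by (rule order_trans)
        qed
        ultimately have "\<bar>K \<xi> * g \<xi> - K \<xi> * h \<xi>\<bar> \<le> 2 / \<omega> * (P \<xi> * g \<xi>) + 4 / \<omega> * P \<xi>"
          by linarith
        then have 1: "\<bar>1 / (4 * pi) * (K \<xi> * g \<xi> - K \<xi> * h \<xi>)\<bar> \<le> 1 / (4 * pi) * (2 / \<omega> * (P \<xi> * g \<xi>) + 4 / \<omega> * P \<xi>)"
          unfolding abs_mult by (intro mult_mono) auto
        have 2: "\<bar>\<kappa> * ((bdry \<xi> - y) $ None * (bdry \<xi> - y) $ None / (norm (bdry \<xi> - y))\<^sup>2) * K \<xi>\<bar> \<le> \<kappa> * (2 / \<omega> * P \<xi>)"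
          unfolding abs_mult[of _ "K \<xi>"] by (rule mult_mono[OF cc K_le]) (use \<kappa> in auto)
        have "f \<xi> = 1 / (4 * pi) * (K \<xi> * g \<xi> - K \<xi> * h \<xi>) + \<kappa> * ((bdry \<xi> - y) $ None * (bdry \<xi> - y) $ None / (norm (bdry \<xi> - y))\<^sup>2) * K \<xi>"
          unfolding f_def by (simp add: distrib_left right_diff_distrib diff_divide_distrib mult_ac)
        then show ?thesis unfolding F_def
          by (simp only:) (rule order_trans[OF abs_triangle_ineq add_mono[OF 1 2]])
      qed
      have f_int: "integrable lborel f"
      proof (rule Bochner_Integration.integrable_bound)
        show "integrable lborel F" using F by (rule integrable.intros)
        show "f \<in> borel_measurable lborel" unfolding f_def [abs_def] g_def h_def by measurable
        show "AE \<xi> in lborel. norm (f \<xi>) \<le> norm (F \<xi>)" using fF by (auto intro: order_trans[OF _ abs_ge_self])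
      qed
      have KU: "K \<xi> * lorentz_U None j (bdry \<xi> - y) = f \<xi> + 1 / 2 * L (x - refl_pt y) * K \<xi>" for \<xi>
      proof -
        have "1 / 2 * L (bdry \<xi> - y) = 1 / (4 * pi) * (g \<xi> - h \<xi>) + 1 / 2 * L (x - refl_pt y)"
          by (simp add: L_def g_def h_def N_def[symmetric] field_simps)
        then show ?thesis unfolding U f_def using None by (simp add: algebra_simps)
      qed
      have "I = (LINT \<xi>|lborel. f \<xi>) + 1 / 2 * L (x - refl_pt y) * of_bool (i = None)"
        unfolding I_def KU using f_int K_int
        by (subst Bochner_Integration.integral_add) (auto simp: has_bochner_integral_iff)
      moreover have "\<bar>LINT \<xi>|lborel. f \<xi>\<bar> \<le> 2 * \<kappa> + 2 / pi"
      proof -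
        have "\<bar>LINT \<xi>|lborel. f \<xi>\<bar> \<le> 1 / (4 * pi) * (2 / \<omega> * (\<omega> * v) + 4 / \<omega> * \<omega>) + \<kappa> * (2 / \<omega> * \<omega>)"
          by (rule abs_integral_le[OF F fF])
        also have "\<dots> = 1 / (4 * pi) * (2 * v + 4) + 2 * \<kappa>" using \<omega> by simp
        also have "\<dots> \<le> 1 / (4 * pi) * 8 + 2 * \<kappa>" using v by (intro add_mono mult_left_mono) auto
        finally show ?thesis by simp
      qed
      ultimately show ?thesis using None by (simp add: mult.commute)
    qed
    have "green_G i j x y - 1 / 2 * of_bool (i = j) * (L (x - y) - L (x - refl_pt y))
      = \<kappa> * ((x - y) $ i * (x - y) $ j / (norm (x - y))\<^sup>2)
      - eps_sign j * (\<kappa> * ((x - refl_pt y) $ i * (x - refl_pt y) $ j / (norm (x - refl_pt y))\<^sup>2))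
      - 2 * (I - 1 / 2 * of_bool (i = None \<and> j = None) * L (x - refl_pt y))"
    proof -
      have "- eps_sign j * (1 / 2 * of_bool (i = j)) = - (1 / 2 * of_bool (i = j)) + of_bool (i = None \<and> j = None)"
        by (auto simp: eps_sign_def)
      then have "- eps_sign j * (1 / 2 * of_bool (i = j)) * L (x - refl_pt y)
        = (- (1 / 2 * of_bool (i = j)) + of_bool (i = None \<and> j = None)) * L (x - refl_pt y)" by (simp only:)
      then show ?thesis unfolding G U by (simp add: algebra_simps del: of_bool_conj)
    qed
    moreover have "\<bar>eps_sign j * (\<kappa> * ((x - refl_pt y) $ i * (x - refl_pt y) $ j / (norm (x - refl_pt y))\<^sup>2))\<bar> \<le> \<kappa>"
    proof -
      have "\<bar>eps_sign j\<bar> = 1" by (simp add: eps_sign_def)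
      then show ?thesis using cc by (simp only: abs_mult[of "eps_sign j"] mult_1)
    qed
    moreover have "\<bar>u - w - 2 * s\<bar> \<le> a + a + 2 * b" if "\<bar>u\<bar> \<le> a" "\<bar>w\<bar> \<le> a" "\<bar>s\<bar> \<le> b" for u w s a b :: real
      using that by linarith
    note this[OF cc _ I]
    moreover have "c = \<kappa> + \<kappa> + 2 * (2 * \<kappa> + 2 / pi)" by (simp add: c_def)
    ultimately show ?thesis by (simp only:)
  qed
  \<comment> \<open>The bounded error is absorbed through ln (2 + y_n / |x - y|) >= ln 2; the
    summand 1 pays for the difference of logarithms.\<close>
  define C where "C = c / ln 2 + 1"
  have C: "C > 0" using c by (simp add: C_def add_pos_pos)
  show thesis
  proof (rule that[OF C])
    fix x y :: "real ^ 'm option" and i j :: "'m option"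
    assume x: "x \<in> half_space" and y: "y \<in> half_space" and xy: "x \<noteq> y"
    define r N where "r = norm (x - y)" and "N = norm (x - refl_pt y)"
    define M where "M = ln (2 + y $ None / r)"
    have pos: "x $ None > 0" "y $ None > 0" "r > 0" "N > 0"
      using half_space_pos[OF x] half_space_pos[OF y] xy norm_sub_refl_pos[OF x y] by (auto simp: r_def N_def)
    have rN: "r \<le> N"
    unfolding r_def N_def by (rule norm_sub_le_norm_sub_refl[OF x y])
    have l2: "M \<ge> ln 2" unfolding M_def using pos by (intro ln_mono) auto
    have "ln (N / r) \<le> ln ((2 + y $ None / r)\<^sup>2)"
    proof (rule ln_mono)
      \<comment> \<open>The square is a generous bound, chosen because its logarithm is exactly 2
        M.\<close>
      have "N / r \<le> 1 + 2 * (y $ None / r)"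
        using norm_sub_refl_le[OF y, of x] pos by (simp add: r_def N_def field_simps)
      also have "\<dots> \<le> (2 + y $ None / r)\<^sup>2"
      proof -
        have sq: "1 + 2 * s \<le> (2 + s)\<^sup>2" if "s \<ge> 0" for s :: real using that by (simp add: power2_sum)
        show ?thesis by (rule sq) (use pos in simp)
      qed
      finally show "N / r \<le> (2 + y $ None / r)\<^sup>2" .
    qed (use pos in \<open>auto intro!: add_pos_pos\<close>)
    also have "\<dots> = 2 * M" unfolding M_def using pos by (subst ln_realpow) (auto intro: add_pos_pos)
    finally have lnN: "ln N - ln r \<le> 2 * M" using pos by (simp add: ln_div)
    have lnN0: "0 \<le> ln N - ln r" using rN pos by simp
    have "L (x - y) - L (x - refl_pt y) = 1 / (2 * pi) * (ln N - ln r)"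
      by (simp add: L_def N_def r_def algebra_simps)
    moreover have "\<bar>1 / (2 * pi) * (ln N - ln r)\<bar> \<le> 1 / (2 * pi) * (2 * M)"
      unfolding abs_mult using lnN lnN0 by (intro mult_mono) auto
    ultimately have "\<bar>L (x - y) - L (x - refl_pt y)\<bar> \<le> 1 / (2 * pi) * (2 * M)" by (simp only:)
    then have "\<bar>1 / 2 * of_bool (i = j) * (L (x - y) - L (x - refl_pt y))\<bar> \<le> 1 / 2 * 1 * (1 / (2 * pi) * (2 * M))"
      unfolding abs_mult by (intro mult_mono) auto
    also have "\<dots> = 1 / (2 * pi) * M" by simp
    also have "\<dots> \<le> 1 * M"
    proof (rule mult_right_mono)
      show "0 \<le> M" using l2 ln_gt_zero[of "2::real"] by linarith
      show "1 / (2 * pi) \<le> 1" using pi_gt3 by (simp add: divide_le_eq_1)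
    qed
    finally have 1: "\<bar>1 / 2 * of_bool (i = j) * (L (x - y) - L (x - refl_pt y))\<bar> \<le> M" by simp
    have "c / ln 2 * ln 2 \<le> c / ln 2 * M" using c l2 by (intro mult_left_mono) auto
    then have 2: "c \<le> c / ln 2 * M" by simp
    have "\<bar>u\<bar> \<le> c' + l" if "\<bar>u - w\<bar> \<le> c" "\<bar>w\<bar> \<le> l" "c \<le> c'" for u w c' l :: real using that by linarith
    from this[OF main[OF x y, of i j] 1 2]
    show "\<bar>green_G i j x y\<bar> \<le> C * ln (2 + y $ None / norm (x - y))"
      unfolding r_def[symmetric] M_def[symmetric] C_def by (simp add: algebra_simps)
  qed
qed

theorem theorem2p4:
  "\<exists>C0>0. \<forall>x\<in>(half_space :: (real ^ ('m::finite) option) set). \<forall>y\<in>half_space.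
     x \<noteq> y \<longrightarrow>
     (\<forall>i j. \<bar>green_G i j x y\<bar> \<le>
        C0 * (x $ None * y $ None)
          / (norm (x - y) ^ (CARD('m option) - 2) * norm (x - refl_pt y) ^ 2)
        + C0 * of_bool (CARD('m option) = 2) * ln (2 + y $ None / norm (x - y))) \<and>
     (\<forall>i. \<bar>green_G i None x y\<bar> \<le>
        C0 * (x $ None * (y $ None) ^ 2)
          / (norm (x - y) ^ (CARD('m option) - 2) * norm (x - refl_pt y) ^ 3)
        + C0 * of_bool (CARD('m option) = 2) * ln (2 + y $ None / norm (x - y)))"
proof (cases "CARD('m option) = 2")
  case True
  obtain C where C: "C > 0" "\<And>x y :: real ^ 'm option. \<And>i j. x \<in> half_space \<Longrightarrow> y \<in> half_space \<Longrightarrow> x \<noteq> y \<Longrightarrow>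
      \<bar>green_G i j x y\<bar> \<le> C * ln (2 + y $ None / norm (x - y))"
    using green_G_bound_2[OF True] by blast
  show ?thesis
  proof (intro exI[of _ C] conjI ballI impI allI)
    fix x y :: "real ^ 'm option" and i j :: "'m option"
    assume xy: "x \<in> half_space" "y \<in> half_space" "x \<noteq> y"
    have pos: "x $ None > 0" "y $ None > 0" using half_space_pos[OF xy(1)] half_space_pos[OF xy(2)] by auto
    \<comment> \<open>In dimension two the logarithm alone gives both estimates; the algebraic term
      is nonnegative and can only enlarge the right-hand side.\<close>
    have le: "a \<le> b + C * of_bool (CARD('m option) = 2) * l" if "a \<le> C * l" "0 \<le> b" for a b l :: real
      using that unfolding True by simp
    show "\<bar>green_G i j x y\<bar> \<le> C * (x $ None * y $ None) / (norm (x - y) ^ (CARD('m option) - 2) * norm (x - refl_pt y) ^ 2)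
        + C * of_bool (CARD('m option) = 2) * ln (2 + y $ None / norm (x - y))"
      by (rule le[OF C(2)[OF xy]]) (use C(1) pos in simp)
    show "\<bar>green_G i None x y\<bar> \<le> C * (x $ None * (y $ None) ^ 2) / (norm (x - y) ^ (CARD('m option) - 2) * norm (x - refl_pt y) ^ 3)
        + C * of_bool (CARD('m option) = 2) * ln (2 + y $ None / norm (x - y))"
      by (rule le[OF C(2)[OF xy]]) (use C(1) pos in simp)
  qed (rule C(1))
next
  case False
  then have n: "CARD('m option) \<ge> 3" using CARD_option_ge_2[where 'm = 'm] by linarith
  obtain C where C: "C > 0"
    "\<And>x y :: real ^ 'm option. \<And>i j. x \<in> half_space \<Longrightarrow> y \<in> half_space \<Longrightarrow> x \<noteq> y \<Longrightarrow>
      \<bar>green_G i j x y\<bar> \<le> C * (x $ None * y $ None) / (norm (x - y) ^ (CARD('m option) - 2) * norm (x - refl_pt y) ^ 2)"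
    "\<And>x y :: real ^ 'm option. \<And>i. x \<in> half_space \<Longrightarrow> y \<in> half_space \<Longrightarrow> x \<noteq> y \<Longrightarrow>
      \<bar>green_G i None x y\<bar> \<le> C * (x $ None * (y $ None)\<^sup>2) / (norm (x - y) ^ (CARD('m option) - 2) * norm (x - refl_pt y) ^ 3)"
    using green_G_bounds_ge_3[OF n] by blast
  have "(of_bool (CARD('m option) = 2) :: real) = 0" using False by simp
  then show ?thesis
    by (simp only: mult_zero_left mult_zero_right add_0_right) (use C in blast)
qed

end
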